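(* Let $\mathcal{A} = (\mathfrak{so}(8)\oplus\mathfrak{so}(8)) \times (\mathbb{O}\otimes\mathbb{O})^3$. The binary operation on $\mathcal{A}$ defined by $$[(A,u,v,w),(B,x,y,z)] = (C,r,s,t),$$ where \begin{align*} C &=[A,B]-4\,u \curlywedge x - 4\Lambda^2(v \curlywedge y) - 4\Lambda(w \curlywedge z),\\ r &= A.x-B.u+\overline{v \ast z}-\overline{y \ast w},\\ s &= \Lambda(A).y-\Lambda(B).v+\overline{w \ast x}-\overline{z \ast u},\\ t &= \Lambda^2(A).z-\Lambda^2(B).w+\overline{u \ast y}-\overline{x \ast v}, \end{align*} for $A,B \in \mathfrak{so}(8)\oplus\mathfrak{so}(8)$ and $u,v,w,x,y,z \in \mathbb{O}\otimes\mathbb{O}$, is $\mathbb{R}$-bilinear, skew symmetric and satisfies the Jacobi identity. The real Lie algebra defined in this way is isomorphic to the Lie algebra of the compact exceptional simple Lie group of type $\mathrm{E}_8$.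
   Context: Octonions: $\mathbb{O}$ is the 8-dimensional real octonion algebra with basis $e=e_0$ (the identity), $e_1,\dots,e_7$, where $e_i^2=-e$ for $i\ge1$ and $e_1e_2=e_3$, $e_1e_4=e_5$, $e_2e_4=e_6$, $e_3e_4=e_7$, $e_5e_3=e_6$, $e_6e_1=e_7$, $e_7e_2=e_5$ (the remaining products are determined by the alternative laws). Via this basis $\mathbb{O}=\mathbb{R}^8$ (column vectors), with standard scalar product $\langle\cdot,\cdot\rangle$. Conjugation $a\mapsto\bar a$ is linear with $\bar e_0=e_0$, $\bar e_i=-e_i$ for $i\ge1$. $\mathrm{Pu}(\mathbb{O})$ is the span of $e_1,\dots,e_7$. $L_a(x)=ax$. Wedge and triality: $\mathfrak{so}(8)$ is the Lie algebra of real skew-symmetric $8\times8$ matrices with commutator bracket; for $x,y\in\mathbb{O}=\mathbb{R}^8$, $x\wedge y:=xy^t-yx^t\in\mathfrak{so}(8)$ (matrix products). $\lambda$ is the order-three automorphism of $\mathfrak{so}(8)$ determined by $\lambda(a\wedge b)=\tfrac12 L_{\bar b}\circ L_{\bar a}$ for $a\in\mathrm{Pu}(\mathbb{O})$, $b\in\mathbb{O}$, $\langle a,b\rangle=0$. $\Lambda$ is the automorphism of $\mathfrak{so}(8)\oplus\mathfrak{so}(8)$ given by $\Lambda(P,Q)=(\lambda(P),\lambda(Q))$, and $\Lambda^2=\Lambda\circ\Lambda$. Oct-octonions: $\mathbb{O}\otimes\mathbb{O}$ (tensor product over $\mathbb{R}$) has multiplication $(a\otimes b)\ast(c\otimes d)=ac\otimes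 bd$ and linear conjugation $\overline{a\otimes b}=\bar a\otimes\bar b$. It is identified with the space $\mathbb{R}(8)$ of real $8\times8$ matrices via $x\otimes y=xy^t$. Juxtaposition denotes the ordinary matrix product, $\ast$ the oct-octonionic product. For $A=(P,Q)\in\mathfrak{so}(8)\oplus\mathfrak{so}(8)$ and $X,Y\in\mathbb{R}(8)$: $A.X:=PX-XQ$ and $X\curlywedge Y:=(XY^t-YX^t,\;X^tY-Y^tX)\in\mathfrak{so}(8)\oplus\mathfrak{so}(8)$ (matrix products). $[A,B]$ is the bracket of the direct sum Lie algebra $\mathfrak{so}(8)\oplus\mathfrak{so}(8)$. *)

theory Defs
  imports "HOL-Analysis.Analysis"
begin

section \<open>Octonions\<close>

text \<open>The octonions are \<^typ>\<open>real^8\<close>. The index type \<^typ>\<open>8\<close> has the elements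
  \<open>0, \<dots>, 7\<close>, so that \<open>e\<^sub>0\<close> is the identity, and \<open>axis i 1\<close> is \<open>e\<^sub>i\<close>.\<close>

type_synonym oct = "real^8"
type_synonym mat8 = "real^8^8"

abbreviation oct_unit :: "8 \<Rightarrow> oct" where
  "oct_unit i \<equiv> axis i 1"

text \<open>The seven triples \<open>(i, j, k)\<close> with \<open>e\<^sub>i e\<^sub>j = e\<^sub>k\<close>; the alternative laws force
  \<open>e\<^sub>j e\<^sub>k = e\<^sub>i\<close>, \<open>e\<^sub>k e\<^sub>i = e\<^sub>j\<close> and \<open>e\<^sub>j e\<^sub>i = - e\<^sub>k\<close>.\<close>

definition oct_triples :: "(8 \<times> 8 \<times> 8) set" where
  "oct_triples = {(1,2,3), (1,4,5), (2,4,6), (3,4,7), (5,3,6), (6,1,7), (7,2,5)}"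

definition oct_cyclic :: "8 \<Rightarrow> 8 \<Rightarrow> 8 \<Rightarrow> bool" where
  "oct_cyclic i j k \<longleftrightarrow>
     (i, j, k) \<in> oct_triples \<or> (j, k, i) \<in> oct_triples \<or> (k, i, j) \<in> oct_triples"

text \<open>The coefficient of \<open>e\<^sub>k\<close> in \<open>e\<^sub>i e\<^sub>j\<close>.\<close>

definition oct_coeff :: "8 \<Rightarrow> 8 \<Rightarrow> 8 \<Rightarrow> real" where
  "oct_coeff i j k =
     (if i = 0 then (if k = j then 1 else 0)
      else if j = 0 then (if k = i then 1 else 0)
      else if i = j then (if k = 0 then - 1 else 0)
      else if oct_cyclic i j k then 1
      else if oct_cyclic j i k then - 1
      else 0)"

definition oct_mult :: "oct \<Rightarrow> oct \<Rightarrow> oct" where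
  "oct_mult a b = (\<chi> k. \<Sum>i\<in>UNIV. \<Sum>j\<in>UNIV. oct_coeff i j k * a $ i * b $ j)"

definition oct_cnj :: "oct \<Rightarrow> oct" where
  "oct_cnj a = (\<chi> i. if i = 0 then a $ i else - a $ i)"

definition oct_Pu :: "oct set" where
  "oct_Pu = span (oct_unit ` {i. i \<noteq> 0})"

definition oct_L :: "oct \<Rightarrow> mat8" where
  "oct_L a = matrix (oct_mult a)"


section \<open>The Lie algebra so(8) and triality\<close>

definition so8 :: "mat8 set" where
  "so8 = {P. transpose P = - P}"

definition commutator :: "real^'n^'n \<Rightarrow> real^'n^'n \<Rightarrow> real^'n^'n" where
  "commutator P Q = P ** Q - Q ** P"

text \<open>\<open>oct_tensor x y\<close> is the matrix \<open>x y\<^sup>t\<close>, i.e. the pure tensor \<open>x \<otimes> y\<close> under the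
  identification of the oct-octonions with the real 8 by 8 matrices.\<close>

definition oct_tensor :: "oct \<Rightarrow> oct \<Rightarrow> mat8" where
  "oct_tensor x y = (\<chi> i j. x $ i * y $ j)"

definition wedge :: "oct \<Rightarrow> oct \<Rightarrow> mat8" where
  "wedge x y = oct_tensor x y - oct_tensor y x"

text \<open>A skew-symmetric \<open>P\<close> equals
  \<open>\<Sum>i\<noteq>0. P\<^sub>i\<^sub>0 (e\<^sub>i \<and> e\<^sub>0) + 1/2 \<Sum>i,j\<noteq>0, i\<noteq>j. P\<^sub>i\<^sub>j (e\<^sub>i \<and> e\<^sub>j)\<close>,
  and the rule \<open>\<lambda>(a \<and> b) = 1/2 L(cnj b) L(cnj a)\<close> applies to each of these wedges. See
  \<open>triality_wedge\<close> and \<open>triality_unique\<close> below. Only the values on \<^const>\<open>so8\<close> matter.\<close>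

definition triality_wedge_unit :: "8 \<Rightarrow> 8 \<Rightarrow> mat8" where
  "triality_wedge_unit i j =
     (1/2) *\<^sub>R (oct_L (oct_cnj (oct_unit j)) ** oct_L (oct_cnj (oct_unit i)))"

definition triality :: "mat8 \<Rightarrow> mat8" where
  "triality P =
     (\<Sum>i\<in>-{0}. P $ i $ 0 *\<^sub>R triality_wedge_unit i 0)
     + (1/2) *\<^sub>R (\<Sum>i\<in>-{0}. \<Sum>j\<in>-{0,i}. P $ i $ j *\<^sub>R triality_wedge_unit i j)"

definition Triality :: "mat8 \<times> mat8 \<Rightarrow> mat8 \<times> mat8" where
  "Triality A = (triality (fst A), triality (snd A))"


section \<open>Oct-octonions\<close>

definition oo_mult :: "mat8 \<Rightarrow> mat8 \<Rightarrow> mat8" where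
  "oo_mult X Y =
     (\<Sum>i\<in>UNIV. \<Sum>j\<in>UNIV. \<Sum>k\<in>UNIV. \<Sum>l\<in>UNIV. (X $ i $ j * Y $ k $ l) *\<^sub>R
        oct_tensor (oct_mult (oct_unit i) (oct_unit k)) (oct_mult (oct_unit j) (oct_unit l)))"

definition oo_cnj :: "mat8 \<Rightarrow> mat8" where
  "oo_cnj X = (\<Sum>i\<in>UNIV. \<Sum>j\<in>UNIV. X $ i $ j *\<^sub>R
     oct_tensor (oct_cnj (oct_unit i)) (oct_cnj (oct_unit j)))"


section \<open>The bracket on \<open>(so(8) + so(8)) \<times> (O \<otimes> O)\<^sup>3\<close>\<close>

definition pair_bracket :: "mat8 \<times> mat8 \<Rightarrow> mat8 \<times> mat8 \<Rightarrow> mat8 \<times> mat8" where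
  "pair_bracket A B = (commutator (fst A) (fst B), commutator (snd A) (snd B))"

definition pair_act :: "mat8 \<times> mat8 \<Rightarrow> mat8 \<Rightarrow> mat8" where
  "pair_act A X = fst A ** X - X ** snd A"

definition curly_wedge :: "mat8 \<Rightarrow> mat8 \<Rightarrow> mat8 \<times> mat8" where
  "curly_wedge X Y =
     (X ** transpose Y - Y ** transpose X, transpose X ** Y - transpose Y ** X)"

type_synonym alg_A = "(mat8 \<times> mat8) \<times> mat8 \<times> mat8 \<times> mat8"

definition space_A :: "alg_A set" where
  "space_A = (so8 \<times> so8) \<times> UNIV \<times> UNIV \<times> UNIV"

fun bracket_A :: "alg_A \<Rightarrow> alg_A \<Rightarrow> alg_A" where
  "bracket_A (A, u, v, w) (B, x, y, z) =
    (pair_bracket A B - 4 *\<^sub>R curly_wedge u x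
       - 4 *\<^sub>R Triality (Triality (curly_wedge v y)) - 4 *\<^sub>R Triality (curly_wedge w z),
     pair_act A x - pair_act B u + oo_cnj (oo_mult v z) - oo_cnj (oo_mult y w),
     pair_act (Triality A) y - pair_act (Triality B) v
       + oo_cnj (oo_mult w x) - oo_cnj (oo_mult z u),
     pair_act (Triality (Triality A)) z - pair_act (Triality (Triality B)) w
       + oo_cnj (oo_mult u y) - oo_cnj (oo_mult x v))"


section \<open>Real Lie algebras on subspaces\<close>

definition bilinear_on :: "'a::real_vector set \<Rightarrow> ('a \<Rightarrow> 'a \<Rightarrow> 'a) \<Rightarrow> bool" where
  "bilinear_on V f \<longleftrightarrow>
     (\<forall>x\<in>V. \<forall>y\<in>V. \<forall>z\<in>V. f (x + y) z = f x z + f y z \<and> f z (x + y) = f z x + f z y) \<and>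
     (\<forall>c. \<forall>x\<in>V. \<forall>y\<in>V. f (c *\<^sub>R x) y = c *\<^sub>R f x y \<and> f x (c *\<^sub>R y) = c *\<^sub>R f x y)"

definition skew_symmetric_on :: "'a::real_vector set \<Rightarrow> ('a \<Rightarrow> 'a \<Rightarrow> 'a) \<Rightarrow> bool" where
  "skew_symmetric_on V f \<longleftrightarrow> (\<forall>x\<in>V. \<forall>y\<in>V. f x y = - f y x)"

definition jacobi_on :: "'a::real_vector set \<Rightarrow> ('a \<Rightarrow> 'a \<Rightarrow> 'a) \<Rightarrow> bool" where
  "jacobi_on V f \<longleftrightarrow>
     (\<forall>x\<in>V. \<forall>y\<in>V. \<forall>z\<in>V. f (f x y) z + f (f y z) x + f (f z x) y = 0)"

definition real_lie_algebra :: "'a::real_vector set \<Rightarrow> ('a \<Rightarrow> 'a \<Rightarrow> 'a) \<Rightarrow> bool" where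
  "real_lie_algebra V f \<longleftrightarrow>
     subspace V \<and> (\<forall>x\<in>V. \<forall>y\<in>V. f x y \<in> V) \<and>
     bilinear_on V f \<and> skew_symmetric_on V f \<and> jacobi_on V f"

definition linear_map_on :: "'a::real_vector set \<Rightarrow> ('a \<Rightarrow> 'b::real_vector) \<Rightarrow> bool" where
  "linear_map_on V \<phi> \<longleftrightarrow>
     (\<forall>x\<in>V. \<forall>y\<in>V. \<phi> (x + y) = \<phi> x + \<phi> y) \<and> (\<forall>c. \<forall>x\<in>V. \<phi> (c *\<^sub>R x) = c *\<^sub>R \<phi> x)"

definition lie_isomorphic ::
  "'a::real_vector set \<Rightarrow> ('a \<Rightarrow> 'a \<Rightarrow> 'a) \<Rightarrow> 'b::real_vector set \<Rightarrow> ('b \<Rightarrow> 'b \<Rightarrow> 'b) \<Rightarrow> bool" where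
  "lie_isomorphic V f W g \<longleftrightarrow>
     (\<exists>\<phi>. linear_map_on V \<phi> \<and> bij_betw \<phi> V W \<and> (\<forall>x\<in>V. \<forall>y\<in>V. \<phi> (f x y) = g (\<phi> x) (\<phi> y)))"

definition lie_ideal :: "'a::real_vector set \<Rightarrow> ('a \<Rightarrow> 'a \<Rightarrow> 'a) \<Rightarrow> 'a set \<Rightarrow> bool" where
  "lie_ideal V f I \<longleftrightarrow> subspace I \<and> I \<subseteq> V \<and> (\<forall>x\<in>V. \<forall>y\<in>I. f x y \<in> I)"

definition simple_lie_algebra :: "'a::real_vector set \<Rightarrow> ('a \<Rightarrow> 'a \<Rightarrow> 'a) \<Rightarrow> bool" where
  "simple_lie_algebra V f \<longleftrightarrow>
     real_lie_algebra V f \<and> (\<exists>x\<in>V. \<exists>y\<in>V. f x y \<noteq> 0) \<and>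
     (\<forall>I. lie_ideal V f I \<longrightarrow> I = {0} \<or> I = V)"

definition maximal_abelian :: "'a::real_vector set \<Rightarrow> ('a \<Rightarrow> 'a \<Rightarrow> 'a) \<Rightarrow> 'a set \<Rightarrow> bool" where
  "maximal_abelian V f T \<longleftrightarrow>
     subspace T \<and> T \<subseteq> V \<and> (\<forall>h\<in>T. \<forall>k\<in>T. f h k = 0) \<and>
     (\<forall>x\<in>V. (\<forall>h\<in>T. f h x = 0) \<longrightarrow> x \<in> T)"

text \<open>\<open>\<alpha>\<close> (only its values on \<open>T\<close> matter) is a root of the complexification of \<open>V\<close> with
  respect to \<open>T\<close>: it is non-zero on \<open>T\<close>, and there is a non-zero \<open>x + i y\<close> in the
  complexification with \<open>[h, x + i y] = \<alpha>(h) (x + i y)\<close> for all \<open>h\<close> in \<open>T\<close>. The equation is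
  written out in its real and imaginary parts.\<close>

definition lie_root ::
  "'a::real_vector set \<Rightarrow> ('a \<Rightarrow> 'a \<Rightarrow> 'a) \<Rightarrow> 'a set \<Rightarrow> ('a \<Rightarrow> complex) \<Rightarrow> bool" where
  "lie_root V f T \<alpha> \<longleftrightarrow>
     (\<exists>h\<in>T. \<alpha> h \<noteq> 0) \<and>
     (\<exists>x\<in>V. \<exists>y\<in>V. (x \<noteq> 0 \<or> y \<noteq> 0) \<and>
        (\<forall>h\<in>T. f h x = Re (\<alpha> h) *\<^sub>R x - Im (\<alpha> h) *\<^sub>R y \<and>
                f h y = Im (\<alpha> h) *\<^sub>R x + Re (\<alpha> h) *\<^sub>R y))"

text \<open>The root system of type \<open>E\<^sub>8\<close> in its standard coordinates: the 112 vectors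
  \<open>\<plusminus> \<epsilon>\<^sub>i \<plusminus> \<epsilon>\<^sub>j\<close> with \<open>i \<noteq> j\<close> and the 128 vectors \<open>1/2 \<Sum>i. \<plusminus> \<epsilon>\<^sub>i\<close> with an even number of
  minus signs.\<close>

definition E8_roots :: "(real^8) set" where
  "E8_roots =
     {axis i s + axis j t | i j s t. i \<noteq> j \<and> s \<in> {1, -1} \<and> t \<in> {1, -1}} \<union>
     {r. (\<forall>i. r $ i \<in> {1/2, -1/2}) \<and> even (card {i. r $ i < 0})}"

text \<open>Meant for the Lie algebra of a compact group. There a maximal abelian subalgebra \<open>T\<close> is the
  Lie algebra of a maximal torus, its complexification is a Cartan subalgebra, and the roots
  take purely imaginary values on \<open>T\<close>. The map \<open>r \<mapsto> i \<langle>r, \<phi>(\<cdot>)\<rangle>\<close> is then the required linear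
  isomorphism from \<open>R\<^sup>8\<close> onto the real span of the roots, carrying the \<open>E\<^sub>8\<close> root system
  exactly onto the roots of \<open>V\<close>.\<close>

definition has_root_system_E8 :: "'a::real_vector set \<Rightarrow> ('a \<Rightarrow> 'a \<Rightarrow> 'a) \<Rightarrow> bool" where
  "has_root_system_E8 V f \<longleftrightarrow>
     (\<exists>T (\<phi> :: 'a \<Rightarrow> real^8).
        maximal_abelian V f T \<and> linear_map_on T \<phi> \<and> bij_betw \<phi> T UNIV \<and>
        (\<forall>\<alpha>. lie_root V f T \<alpha> \<longleftrightarrow>
           (\<exists>r\<in>E8_roots. \<forall>h\<in>T. \<alpha> h = \<i> * complex_of_real (r \<bullet> \<phi> h))))"


section \<open>Compact linear Lie groups\<close>

text \<open>A compact subgroup of the general linear group is closed, hence a Lie subgroup; conversely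
  every compact Lie group has a faithful finite-dimensional representation.\<close>

definition compact_linear_group :: "(real^'n^'n) set \<Rightarrow> bool" where
  "compact_linear_group G \<longleftrightarrow>
     mat 1 \<in> G \<and> (\<forall>g\<in>G. \<forall>h\<in>G. g ** h \<in> G) \<and>
     (\<forall>g\<in>G. invertible g \<and> matrix_inv g \<in> G) \<and> compact G"

text \<open>The tangent space of \<open>G\<close> at the identity; its bracket is the matrix commutator.\<close>

definition lie_algebra_of :: "(real^'n^'n) set \<Rightarrow> (real^'n^'n) set" where
  "lie_algebra_of G =
     {X. \<exists>\<gamma>. (\<forall>s::real. \<gamma> s \<in> G \<and> \<gamma> differentiable (at s)) \<and>
             \<gamma> 0 = mat 1 \<and> (\<gamma> has_vector_derivative X) (at 0)}"

definition compact_simple_Lie_group_E8 :: "(real^'n^'n) set \<Rightarrow> bool" where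
  "compact_simple_Lie_group_E8 G \<longleftrightarrow>
     compact_linear_group G \<and> connected G \<and>
     simple_lie_algebra (lie_algebra_of G) commutator \<and>
     has_root_system_E8 (lie_algebra_of G) commutator"


section \<open>Consistency of the coordinate definitions\<close>

lemma UNIV_8: "(UNIV :: 8 set) = {0, 1, 2, 3, 4, 5, 6, 7}"
proof -
  have "card {0, 1, 2, 3, 4, 5, 6, 7 :: 8} = CARD(8)" by simp
  then show ?thesis by (metis card_subset_eq finite subset_UNIV)
qed

lemma oct_mult_linear: "linear (oct_mult a)" "linear (\<lambda>a. oct_mult a b)"
  by (auto intro!: linearI simp: oct_mult_def vec_eq_iff algebra_simps sum.distrib sum_distrib_left)


lemma neq_8:
  "(0::8) \<noteq> 1" "(0::8) \<noteq> 2" "(0::8) \<noteq> 3" "(0::8) \<noteq> 4" "(0::8) \<noteq> 5" "(0::8) \<noteq> 6" "(0::8) \<noteq> 7"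
  "(1::8) \<noteq> 0" "(1::8) \<noteq> 2" "(1::8) \<noteq> 3" "(1::8) \<noteq> 4" "(1::8) \<noteq> 5" "(1::8) \<noteq> 6" "(1::8) \<noteq> 7"
  "(2::8) \<noteq> 0" "(2::8) \<noteq> 1" "(2::8) \<noteq> 3" "(2::8) \<noteq> 4" "(2::8) \<noteq> 5" "(2::8) \<noteq> 6" "(2::8) \<noteq> 7"
  "(3::8) \<noteq> 0" "(3::8) \<noteq> 1" "(3::8) \<noteq> 2" "(3::8) \<noteq> 4" "(3::8) \<noteq> 5" "(3::8) \<noteq> 6" "(3::8) \<noteq> 7"
  "(4::8) \<noteq> 0" "(4::8) \<noteq> 1" "(4::8) \<noteq> 2" "(4::8) \<noteq> 3" "(4::8) \<noteq> 5" "(4::8) \<noteq> 6" "(4::8) \<noteq> 7"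
  "(5::8) \<noteq> 0" "(5::8) \<noteq> 1" "(5::8) \<noteq> 2" "(5::8) \<noteq> 3" "(5::8) \<noteq> 4" "(5::8) \<noteq> 6" "(5::8) \<noteq> 7"
  "(6::8) \<noteq> 0" "(6::8) \<noteq> 1" "(6::8) \<noteq> 2" "(6::8) \<noteq> 3" "(6::8) \<noteq> 4" "(6::8) \<noteq> 5" "(6::8) \<noteq> 7"
  "(7::8) \<noteq> 0" "(7::8) \<noteq> 1" "(7::8) \<noteq> 2" "(7::8) \<noteq> 3" "(7::8) \<noteq> 4" "(7::8) \<noteq> 5" "(7::8) \<noteq> 6"
  by simp_all
lemma sum_8: "sum f (UNIV :: 8 set) = f 0 + f 1 + f 2 + f 3 + f 4 + f 5 + f 6 + f 7"
  unfolding UNIV_8 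
  by (simp only: sum.insert insert_iff empty_iff neq_8 finite.emptyI finite.insertI sum.empty add_0_right
   simp_thms add.assoc)

lemma oct_cyclic_iff:
  "oct_cyclic i j k \<longleftrightarrow> (i, j, k) \<in> {(1,2,3), (1,4,5), (2,4,6), (3,4,7), (5,3,6), (6,1,7), (7,2,5),
     (2,3,1), (4,5,1), (4,6,2), (4,7,3), (3,6,5), (1,7,6), (2,5,7),
     (3,1,2), (5,1,4), (6,2,4), (7,3,4), (6,5,3), (7,6,1), (5,7,2)}"
  unfolding oct_cyclic_def oct_triples_def by (simp only: insert_iff empty_iff prod.inject) argo

lemmas oct_coeff_rules = oct_coeff_def oct_cyclic_iff insert_iff empty_iff prod.inject neq_8
    simp_thms if_True if_False

lemma oct_mult_nth:
  "oct_mult a b $ 0 = a$0*b$0 - a$1*b$1 - a$2*b$2 - a$3*b$3 - a$4*b$4 - a$5*b$5 - a$6*b$6 - a$7*b$7"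
  "oct_mult a b $ 1 = a$0*b$1 + a$1*b$0 + a$2*b$3 - a$3*b$2 + a$4*b$5 - a$5*b$4 - a$6*b$7 + a$7*b$6"
  "oct_mult a b $ 2 = a$0*b$2 - a$1*b$3 + a$2*b$0 + a$3*b$1 + a$4*b$6 + a$5*b$7 - a$6*b$4 - a$7*b$5"
  "oct_mult a b $ 3 = a$0*b$3 + a$1*b$2 - a$2*b$1 + a$3*b$0 + a$4*b$7 - a$5*b$6 + a$6*b$5 - a$7*b$4"
  "oct_mult a b $ 4 = a$0*b$4 - a$1*b$5 - a$2*b$6 - a$3*b$7 + a$4*b$0 + a$5*b$1 + a$6*b$2 + a$7*b$3"
  "oct_mult a b $ 5 = a$0*b$5 + a$1*b$4 - a$2*b$7 + a$3*b$6 - a$4*b$1 + a$5*b$0 - a$6*b$3 + a$7*b$2"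
  "oct_mult a b $ 6 = a$0*b$6 + a$1*b$7 + a$2*b$4 - a$3*b$5 - a$4*b$2 + a$5*b$3 + a$6*b$0 - a$7*b$1"
  "oct_mult a b $ 7 = a$0*b$7 - a$1*b$6 + a$2*b$5 + a$3*b$4 - a$4*b$3 - a$5*b$2 + a$6*b$1 + a$7*b$0"
  by (simp_all only: oct_mult_def vec_lambda_beta sum_8 oct_coeff_rules mult_zero_left mult_1_left
     add_0_left add_0_right mult_minus1 add_uminus_conv_diff mult_minus_left)

lemma forall_8: "(\<forall>i::8. P i) \<longleftrightarrow> P 0 \<and> P 1 \<and> P 2 \<and> P 3 \<and> P 4 \<and> P 5 \<and> P 6 \<and> P 7"
proof -
  have "(\<forall>i::8. P i) \<longleftrightarrow> (\<forall>i\<in>{0, 1, 2, 3, 4, 5, 6, 7 :: 8}. P i)"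
    by (simp only: UNIV_8[symmetric] ball_UNIV)
  then show ?thesis by (simp only: ball_simps simp_thms)
qed

lemma oct_alternative:
  "oct_mult a (oct_mult a b) = oct_mult (oct_mult a a) b"
  "oct_mult (oct_mult b a) a = oct_mult b (oct_mult a a)"
  by (simp_all only: vec_eq_iff forall_8 oct_mult_nth) (safe; algebra)+

lemma oct_unit_nth: "oct_unit i $ j = (if j = i then 1 else 0)"
  by (simp add: axis_def)

lemma oct_mult_units: "oct_mult (oct_unit i) (oct_unit j) $ k = oct_coeff i j k"
proof -
  have "oct_mult (oct_unit i) (oct_unit j) $ k =
      (\<Sum>p\<in>UNIV. if p = i then \<Sum>q\<in>UNIV. if q = j then oct_coeff p q k else 0 else 0)"
    unfolding oct_mult_def vec_lambda_beta oct_unit_nth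
    by (intro sum.cong refl) (auto intro!: sum.neutral sum.cong simp del: sum.delta sum.delta')
  then show ?thesis by simp
qed

lemma oct_mult_unit_table:
  "oct_mult (oct_unit 0) a = a" "oct_mult a (oct_unit 0) = a"
  "i \<noteq> 0 \<Longrightarrow> oct_mult (oct_unit i) (oct_unit i) = - oct_unit 0"
  "oct_mult (oct_unit 1) (oct_unit 2) = oct_unit 3"
  "oct_mult (oct_unit 1) (oct_unit 4) = oct_unit 5"
  "oct_mult (oct_unit 2) (oct_unit 4) = oct_unit 6"
  "oct_mult (oct_unit 3) (oct_unit 4) = oct_unit 7"
  "oct_mult (oct_unit 5) (oct_unit 3) = oct_unit 6"
  "oct_mult (oct_unit 6) (oct_unit 1) = oct_unit 7"
  "oct_mult (oct_unit 7) (oct_unit 2) = oct_unit 5"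
proof -
  show "i \<noteq> 0 \<Longrightarrow> oct_mult (oct_unit i) (oct_unit i) = - oct_unit 0"
    by (simp add: vec_eq_iff oct_mult_units oct_unit_nth oct_coeff_def)
  show "oct_mult (oct_unit 0) a = a" "oct_mult a (oct_unit 0) = a"
    by (simp_all only: vec_eq_iff forall_8 oct_mult_nth oct_unit_nth neq_8 simp_thms if_True if_False
      mult_zero_left mult_zero_right mult_1_left mult_1_right add_0_left add_0_right diff_0_right)
qed (simp_all only: vec_eq_iff forall_8 oct_mult_units oct_unit_nth oct_coeff_rules)

lemma oct_Pu_iff: "a \<in> oct_Pu \<longleftrightarrow> a $ 0 = 0"
proof
  assume "a \<in> oct_Pu"
  then show "a $ 0 = 0"
    unfolding oct_Pu_def by (induction rule: span_induct_alt) (auto simp: axis_def)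
next
  assume a: "a $ 0 = 0"
  have "a = (\<Sum>i\<in>UNIV. a $ i *\<^sub>R oct_unit i)"
    using basis_expansion[of a] by (simp add: scalar_mult_eq_scaleR)
  also have "\<dots> \<in> oct_Pu"
    unfolding oct_Pu_def
  proof (intro span_sum)
    fix i :: 8
    show "a $ i *\<^sub>R oct_unit i \<in> span (oct_unit ` {i. i \<noteq> 0})"
      using a by (cases "i = 0") (auto intro: span_scale span_base span_zero)
  qed
  finally show "a \<in> oct_Pu" .
qed

lemma oct_cnj_unit: "oct_cnj (oct_unit i) = (if i = 0 then 1 else -1) *\<^sub>R oct_unit i"
  by (auto simp: oct_cnj_def axis_def vec_eq_iff)

lemma oct_cnj_linear: "linear oct_cnj"
  by (auto intro!: linearI simp: oct_cnj_def vec_eq_iff)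

lemma oct_L_mult: "oct_L a *v x = oct_mult a x"
  by (simp add: oct_L_def oct_mult_linear)

lemma oct_L_linear: "linear oct_L"
  by (rule linearI; rule matrix_eq[THEN iffD2])
    (simp_all add: oct_L_mult matrix_vector_mult_add_rdistrib linear_add[OF oct_mult_linear(2)]
      linear_scale[OF oct_mult_linear(2)] scaleR_matrix_vector_assoc[symmetric])

lemma oct_L_sq:
  assumes "a $ 0 = 0"
  shows "oct_L a ** oct_L a = - (a \<bullet> a) *\<^sub>R mat 1"
proof (rule matrix_eq[THEN iffD2], rule allI)
  fix x
  have aa: "oct_mult a a = - (a \<bullet> a) *\<^sub>R oct_unit 0"
    unfolding vec_eq_iff forall_8
    by (simp only: oct_mult_nth inner_vec_def sum_8 assms oct_unit_nth vector_scaleR_component neq_8) 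
       (simp add: algebra_simps)
  have "oct_mult a (oct_mult a x) = - (a \<bullet> a) *\<^sub>R x"
    unfolding oct_alternative(1) aa linear_scale[OF oct_mult_linear(2)] oct_mult_unit_table ..
  then show "(oct_L a ** oct_L a) *v x = (- (a \<bullet> a) *\<^sub>R mat 1) *v x"
    by (simp add: oct_L_mult matrix_vector_mul_assoc[symmetric] scaleR_matrix_vector_assoc[symmetric]
       del: scaleR_minus_left)
qed

lemma oo_mult_tensor:
  "oo_mult (oct_tensor a b) (oct_tensor c d) = oct_tensor (oct_mult a c) (oct_mult b d)"
proof -
  have "oo_mult (oct_tensor a b) (oct_tensor c d) $ p $ q = oct_mult a c $ p * oct_mult b d $ q" for p q
  proof -
    have "oo_mult (oct_tensor a b) (oct_tensor c d) $ p $ q =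
      (\<Sum>i\<in>UNIV. \<Sum>j\<in>UNIV. \<Sum>k\<in>UNIV. \<Sum>l\<in>UNIV.
         (oct_coeff i k p * a $ i * c $ k) * (oct_coeff j l q * b $ j * d $ l))"
      by (simp add: oo_mult_def oct_tensor_def oct_mult_units mult_ac)
    also have "\<dots> = (\<Sum>i\<in>UNIV. \<Sum>k\<in>UNIV. oct_coeff i k p * a $ i * c $ k) *
                   (\<Sum>j\<in>UNIV. \<Sum>l\<in>UNIV. oct_coeff j l q * b $ j * d $ l)"
      by (simp only: sum_product)
    finally show ?thesis by (simp add: oct_mult_def)
  qed
  then show ?thesis by (simp add: vec_eq_iff oct_tensor_def)
qed

lemma oo_mult_linear: "linear (oo_mult X)" "linear (\<lambda>X. oo_mult X Y)"
  by (auto intro!: linearI simp: oo_mult_def algebra_simps sum.distrib scaleR_sum_right)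

lemma oo_cnj_nth: "oo_cnj X $ p $ q = (if p = 0 then 1 else -1) * (if q = 0 then 1 else -1) * X $ p $ q"
proof -
  have "oo_cnj X $ p $ q = (\<Sum>i\<in>UNIV. if i = p then \<Sum>j\<in>UNIV. if j = q then
      (if p = 0 then 1 else -1) * (if q = 0 then 1 else -1) * X $ p $ q else 0 else 0)"
    unfolding oo_cnj_def sum_component
    by (intro sum.cong refl)
       (auto simp: oct_tensor_def oct_cnj_unit oct_unit_nth intro!: sum.neutral sum.cong simp del: sum.delta sum.delta')
  then show ?thesis by simp
qed

lemma oo_cnj_tensor: "oo_cnj (oct_tensor a b) = oct_tensor (oct_cnj a) (oct_cnj b)"
  by (simp add: vec_eq_iff oo_cnj_nth) (simp add: oct_tensor_def oct_cnj_def)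

lemma oo_cnj_linear: "linear oo_cnj"
  by (auto intro!: linearI simp: vec_eq_iff oo_cnj_nth algebra_simps)

lemma triality_linear: "linear triality"
  by (auto intro!: linearI simp: triality_def algebra_simps sum.distrib scaleR_sum_right)

lemma matrix_mul_bilinear: "bilinear (\<lambda>(A :: mat8) (B :: mat8). A ** B)"
  by (auto intro!: linearI simp: bilinear_def vec_eq_iff matrix_matrix_mult_def algebra_simps
      sum.distrib sum_distrib_left)

lemma oct_L_anticommute:
  assumes "a $ 0 = 0" "b $ 0 = 0"
  shows "oct_L a ** oct_L b + oct_L b ** oct_L a = - (2 * (a \<bullet> b)) *\<^sub>R mat 1"
proof -
  have "oct_L (a + b) ** oct_L (a + b) = - ((a + b) \<bullet> (a + b)) *\<^sub>R mat 1"
    using assms by (intro oct_L_sq) simp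
  then have "oct_L a ** oct_L a + oct_L a ** oct_L b + oct_L b ** oct_L a + oct_L b ** oct_L b
     = - (a \<bullet> a + 2 * (a \<bullet> b) + b \<bullet> b) *\<^sub>R mat 1"
    by (simp add: linear_add[OF oct_L_linear] bilinear_ladd[OF matrix_mul_bilinear] bilinear_radd[OF matrix_mul_bilinear] inner_add inner_commute add_ac)
  then show ?thesis
    unfolding oct_L_sq[OF assms(1)] oct_L_sq[OF assms(2)]
    by (simp add: algebra_simps) (simp add: eq_neg_iff_add_eq_0 add.assoc)
qed

lemma oct_expand: "a = (\<Sum>i\<in>UNIV. a $ i *\<^sub>R oct_unit i)"
  using basis_expansion[of a] by (simp add: scalar_mult_eq_scaleR)

lemma triality_wedge_unit_skew:
  assumes "i \<noteq> 0" "j \<noteq> 0" "i \<noteq> j"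
  shows "triality_wedge_unit j i = - triality_wedge_unit i j"
proof -
  have "oct_L (oct_unit i) ** oct_L (oct_unit j) + oct_L (oct_unit j) ** oct_L (oct_unit i) = 0"
    using assms oct_L_anticommute[of "oct_unit i" "oct_unit j"] by (simp add: oct_unit_nth inner_axis)
  then show ?thesis
    using assms
    by (simp add: triality_wedge_unit_def oct_cnj_unit linear_neg[OF oct_L_linear]
        bilinear_lneg[OF matrix_mul_bilinear] bilinear_rneg[OF matrix_mul_bilinear] eq_neg_iff_add_eq_0
        flip: scaleR_add_right)
qed

lemma triality_wedge_unit_diag:
  assumes "i \<noteq> 0"
  shows "triality_wedge_unit i i = - (1/2) *\<^sub>R mat 1"
  using assms oct_L_sq[of "oct_unit i"]
  by (simp add: triality_wedge_unit_def oct_cnj_unit linear_neg[OF oct_L_linear] oct_unit_nth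
        bilinear_lneg[OF matrix_mul_bilinear] bilinear_rneg[OF matrix_mul_bilinear] inner_axis)

theorem triality_wedge:
  assumes "a \<in> oct_Pu" "a \<bullet> b = 0"
  shows "triality (wedge a b) = (1/2) *\<^sub>R (oct_L (oct_cnj b) ** oct_L (oct_cnj a))"
proof -
  let ?T = triality_wedge_unit
  let ?N = "- {0 :: 8}"
  have a0: "a $ 0 = 0" using assms(1) by (simp add: oct_Pu_iff)
  have P: "wedge a b $ i $ j = a $ i * b $ j - b $ i * a $ j" for i j
    by (simp add: wedge_def oct_tensor_def)
  have L: "oct_L (oct_cnj x) = (\<Sum>i\<in>UNIV. x $ i *\<^sub>R oct_L (oct_cnj (oct_unit i)))" for x
    by (subst oct_expand[of x]) (simp add: linear_sum[OF oct_cnj_linear] linear_sum[OF oct_L_linear]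
        linear_scale[OF oct_cnj_linear] linear_scale[OF oct_L_linear])
  have split0: "(\<Sum>i\<in>UNIV. f i) = f 0 + (\<Sum>i\<in>?N. f i)" for f :: "8 \<Rightarrow> mat8"
    using sum.remove[of UNIV "0::8" f] by (simp add: Compl_eq_Diff_UNIV)
  have "(1/2) *\<^sub>R (oct_L (oct_cnj b) ** oct_L (oct_cnj a)) =
      (\<Sum>j\<in>UNIV. \<Sum>i\<in>UNIV. (a $ i * b $ j) *\<^sub>R ?T i j)"
    unfolding L[of a] L[of b] bilinear_sum[OF matrix_mul_bilinear, unfolded sum.cartesian_product[symmetric]]
    by (simp add: triality_wedge_unit_def scaleR_sum_right bilinear_lmul[OF matrix_mul_bilinear]
        bilinear_rmul[OF matrix_mul_bilinear] mult_ac flip: sum.cartesian_product)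
  also have "\<dots> = (\<Sum>i\<in>UNIV. \<Sum>j\<in>UNIV. (a $ i * b $ j) *\<^sub>R ?T i j)"
    by (rule sum.swap)
  also have "\<dots> = (\<Sum>i\<in>?N. (a $ i * b $ 0) *\<^sub>R ?T i 0) + (\<Sum>i\<in>?N. \<Sum>j\<in>?N. (a $ i * b $ j) *\<^sub>R ?T i j)"
    by (simp add: split0 a0 sum.distrib)
  also have "(\<Sum>i\<in>?N. \<Sum>j\<in>?N. (a $ i * b $ j) *\<^sub>R ?T i j) =
      (\<Sum>i\<in>?N. (a $ i * b $ i) *\<^sub>R ?T i i + (\<Sum>j\<in>-{0,i}. (a $ i * b $ j) *\<^sub>R ?T i j))"
  proof (rule sum.cong[OF refl])
    fix i :: 8 assume "i \<in> ?N"
    moreover have "?N - {i} = -{0,i}" by auto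
    ultimately show "(\<Sum>j\<in>?N. (a $ i * b $ j) *\<^sub>R ?T i j) =
        (a $ i * b $ i) *\<^sub>R ?T i i + (\<Sum>j\<in>-{0,i}. (a $ i * b $ j) *\<^sub>R ?T i j)"
      using sum.remove[of ?N i "\<lambda>j. (a $ i * b $ j) *\<^sub>R ?T i j"] by simp
  qed
  also have "\<dots> = (\<Sum>i\<in>?N. (a $ i * b $ i) *\<^sub>R ?T i i) + (\<Sum>i\<in>?N. \<Sum>j\<in>-{0,i}. (a $ i * b $ j) *\<^sub>R ?T i j)"
    by (simp only: sum.distrib)
  also have "(\<Sum>i\<in>?N. (a $ i * b $ i) *\<^sub>R ?T i i) = 0"
  proof -
    have "(\<Sum>i\<in>?N. a $ i * b $ i) = a \<bullet> b"
      using a0 sum.remove[of UNIV "0::8" "\<lambda>i. a $ i * b $ i"]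
      by (simp add: inner_vec_def Compl_eq_Diff_UNIV)
    have "(\<Sum>i\<in>?N. (a $ i * b $ i) *\<^sub>R ?T i i) = (\<Sum>i\<in>?N. (a $ i * b $ i) *\<^sub>R (- (1/2) *\<^sub>R mat 1))"
      by (rule sum.cong) (simp_all add: triality_wedge_unit_diag)
    also have "\<dots> = (\<Sum>i\<in>?N. a $ i * b $ i) *\<^sub>R (- (1/2) *\<^sub>R mat 1)"
      by (rule scaleR_sum_left[symmetric])
    finally show ?thesis using \<open>(\<Sum>i\<in>?N. a $ i * b $ i) = a \<bullet> b\<close> assms(2) by simp
  qed
  finally have rhs: "(1/2) *\<^sub>R (oct_L (oct_cnj b) ** oct_L (oct_cnj a)) =
      (\<Sum>i\<in>?N. (a $ i * b $ 0) *\<^sub>R ?T i 0) + (\<Sum>i\<in>?N. \<Sum>j\<in>-{0,i}. (a $ i * b $ j) *\<^sub>R ?T i j)"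
    (is "_ = ?A + ?B") by simp
  have off: "(\<Sum>i\<in>?N. \<Sum>j\<in>-{0,i}. f i j) = (\<Sum>i\<in>?N. \<Sum>j\<in>?N. if i = j then 0 else f i j)"
    for f :: "8 \<Rightarrow> 8 \<Rightarrow> mat8"
  proof (rule sum.cong[OF refl])
    fix i :: 8 assume "i \<in> ?N"
    show "(\<Sum>j\<in>-{0,i}. f i j) = (\<Sum>j\<in>?N. if i = j then 0 else f i j)"
      by (rule sum.mono_neutral_cong_left) auto
  qed
  have neg: "(\<Sum>i\<in>?N. \<Sum>j\<in>-{0,i}. (b $ i * a $ j) *\<^sub>R ?T i j) = - ?B"
  proof -
    have "(\<Sum>i\<in>?N. \<Sum>j\<in>-{0,i}. (b $ i * a $ j) *\<^sub>R ?T i j) =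
        (\<Sum>j\<in>?N. \<Sum>i\<in>?N. if i = j then 0 else (b $ i * a $ j) *\<^sub>R ?T i j)"
      unfolding off by (rule sum.swap)
    also have "\<dots> = (\<Sum>j\<in>?N. \<Sum>i\<in>?N. - (if j = i then 0 else (a $ j * b $ i) *\<^sub>R ?T j i))"
    proof (intro sum.cong refl)
      fix i j :: 8 assume "i \<in> ?N" "j \<in> ?N"
      then show "(if i = j then 0 else (b $ i * a $ j) *\<^sub>R ?T i j) =
          - (if j = i then 0 else (a $ j * b $ i) *\<^sub>R ?T j i)"
        using triality_wedge_unit_skew[of j i] by (auto simp: mult.commute)
    qed
    finally show ?thesis unfolding off by (simp only: sum_negf)
  qed
  have "(\<Sum>i\<in>?N. \<Sum>j\<in>-{0,i}. wedge a b $ i $ j *\<^sub>R ?T i j) =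
      ?B - (\<Sum>i\<in>?N. \<Sum>j\<in>-{0,i}. (b $ i * a $ j) *\<^sub>R ?T i j)"
    by (simp only: P scaleR_diff_left sum_subtractf)
  also have "\<dots> = 2 *\<^sub>R ?B"
    unfolding neg by (simp only: diff_minus_eq_add scaleR_2)
  finally have B2: "(\<Sum>i\<in>?N. \<Sum>j\<in>-{0,i}. wedge a b $ i $ j *\<^sub>R ?T i j) = 2 *\<^sub>R ?B" .
  show ?thesis
    unfolding rhs triality_def B2 by (simp add: P a0)
qed

theorem triality_unique:
  assumes lin: "linear_map_on so8 f"
    and f: "\<And>a b. a \<in> oct_Pu \<Longrightarrow> a \<bullet> b = 0 \<Longrightarrow>
              f (wedge a b) = (1/2) *\<^sub>R (oct_L (oct_cnj b) ** oct_L (oct_cnj a))"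
    and P: "P \<in> so8"
  shows "f P = triality P"
proof -
  have tr: "transpose (A + B) = transpose A + transpose B" "transpose (c *\<^sub>R A) = c *\<^sub>R transpose A"
    for A B :: mat8 and c :: real
    by (simp_all add: transpose_def vec_eq_iff)
  have so8: "A + B \<in> so8" "c *\<^sub>R A \<in> so8" if "A \<in> so8" "B \<in> so8" for A B c
    using that by (simp_all add: so8_def tr)
  have z: "(0 :: mat8) \<in> so8" by (simp add: so8_def transpose_def vec_eq_iff)
  have W: "wedge x y \<in> so8" for x y
    by (simp add: so8_def transpose_def vec_eq_iff wedge_def oct_tensor_def)
  have f0: "f 0 = 0" using lin z unfolding linear_map_on_def by (metis scale_zero_left)
  have fsum: "(\<Sum>i\<in>I. g i) \<in> so8 \<and> f (\<Sum>i\<in>I. g i) = (\<Sum>i\<in>I. f (g i))"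
    if "\<And>i. i \<in> I \<Longrightarrow> g i \<in> so8" "finite I" for I :: "8 set" and g
    using that(2,1) by (induction I) (use lin z so8 f0 in \<open>auto simp: linear_map_on_def\<close>)
  let ?N = "- {0 :: 8}"
  let ?w = "\<lambda>i j. wedge (oct_unit i) (oct_unit j)"
  let ?A = "\<Sum>i\<in>?N. P $ i $ 0 *\<^sub>R ?w i 0"
  let ?B = "\<lambda>i. \<Sum>j\<in>-{0,i}. P $ i $ j *\<^sub>R ?w i j"
  have sk: "P $ j $ i = - P $ i $ j" for i j
  proof -
    have "transpose P $ i $ j = (- P) $ i $ j"
      using P by (simp only: so8_def mem_Collect_eq)
    then show ?thesis by (simp add: transpose_def)
  qed
  have d: "P $ i $ i = 0" for i using sk[of i i] by simp
  have eq: "P = ?A + (1/2) *\<^sub>R (\<Sum>i\<in>?N. ?B i)"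
  proof -
    have full: "(\<Sum>i\<in>UNIV. \<Sum>j\<in>UNIV. P $ i $ j *\<^sub>R ?w i j) = 2 *\<^sub>R P"
    proof -
      have "(\<Sum>i\<in>UNIV. \<Sum>j\<in>UNIV. P $ i $ j *\<^sub>R ?w i j) $ p $ q = 2 * P $ p $ q" for p q
      proof -
        have "(\<Sum>i\<in>UNIV. \<Sum>j\<in>UNIV. P $ i $ j *\<^sub>R ?w i j) $ p $ q =
          (\<Sum>i\<in>UNIV. \<Sum>j\<in>UNIV. (if i = p then if j = q then P $ i $ j else 0 else 0)
              - (if i = q then if j = p then P $ i $ j else 0 else 0))"
          unfolding sum_component by (intro sum.cong refl) (auto simp: wedge_def oct_tensor_def oct_unit_nth)
        also have "\<dots> = (\<Sum>i\<in>UNIV. if i = p then \<Sum>j\<in>UNIV. if j = q then P $ i $ j else 0 else 0)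
              - (\<Sum>i\<in>UNIV. if i = q then \<Sum>j\<in>UNIV. if j = p then P $ i $ j else 0 else 0)"
          unfolding sum_subtractf by (intro arg_cong2[where f = minus] sum.cong refl) auto
        also have "\<dots> = P $ p $ q - P $ q $ p" by simp
        finally show ?thesis using sk[of q p] by simp
      qed
      then show ?thesis by (simp add: vec_eq_iff)
    qed
    have w: "?w j i = - ?w i j" for i j by (simp add: wedge_def)
    have split0: "(\<Sum>i\<in>UNIV. g i) = g 0 + (\<Sum>i\<in>?N. g i)" for g :: "8 \<Rightarrow> mat8"
      using sum.remove[of UNIV "0::8" g] by (simp add: Compl_eq_Diff_UNIV)
    have c: "P $ 0 $ j *\<^sub>R ?w 0 j = P $ j $ 0 *\<^sub>R ?w j 0" for j
      using sk[of 0 j] w[of 0 j] by simp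
    have B: "(\<Sum>j\<in>?N. P $ i $ j *\<^sub>R ?w i j) = ?B i" for i
      by (rule sum.mono_neutral_cong_right) (auto simp: d)
    have "2 *\<^sub>R P = ?A + ?A + (\<Sum>i\<in>?N. ?B i)"
      unfolding full[symmetric] split0 sum.distrib by (simp only: d c scaleR_zero_left B add_0_left add_ac)
    then have "(1/2) *\<^sub>R (2 *\<^sub>R P) = (1/2) *\<^sub>R (2 *\<^sub>R ?A + (\<Sum>i\<in>?N. ?B i))"
      by (simp only: scaleR_2)
    then show ?thesis by (simp add: scaleR_add_right)
  qed
  have fw: "f (?w i j) = triality_wedge_unit i j" if "i \<noteq> 0" "i \<noteq> j" for i j
    using that unfolding triality_wedge_unit_def
    by (intro f) (auto simp: oct_Pu_iff oct_unit_nth inner_axis)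
  have fs: "f (c *\<^sub>R A) = c *\<^sub>R f A" "f (A + B) = f A + f B" if "A \<in> so8" "B \<in> so8" for c A B
    using lin that by (auto simp: linear_map_on_def)
  have fwc: "c *\<^sub>R ?w i j \<in> so8 \<and> f (c *\<^sub>R ?w i j) = c *\<^sub>R f (?w i j)" for c i j
    using W so8 fs by blast
  have fB: "?B i \<in> so8 \<and> f (?B i) = (\<Sum>j\<in>-{0,i}. P $ i $ j *\<^sub>R f (?w i j))" for i
    using fsum[of "-{0,i}" "\<lambda>j. P $ i $ j *\<^sub>R ?w i j"] fwc by simp
  have fA: "?A \<in> so8 \<and> f ?A = (\<Sum>i\<in>?N. P $ i $ 0 *\<^sub>R f (?w i 0))"
    using fsum[of ?N "\<lambda>i. P $ i $ 0 *\<^sub>R ?w i 0"] fwc by simp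
  have fBB: "(\<Sum>i\<in>?N. ?B i) \<in> so8 \<and> f (\<Sum>i\<in>?N. ?B i) = (\<Sum>i\<in>?N. f (?B i))"
    using fsum[of ?N ?B] fB by simp
  let ?S = "\<Sum>i\<in>?N. ?B i"
  have S: "?S \<in> so8" and A: "?A \<in> so8" using fBB fA by blast+
  have "f P = f (?A + (1/2) *\<^sub>R ?S)"
    by (rule arg_cong[OF eq])
  also have "\<dots> = f ?A + f ((1/2) *\<^sub>R ?S)"
    by (rule fs(2)[OF A so8(2)[OF S S]])
  also have "f ((1/2) *\<^sub>R ?S) = (1/2) *\<^sub>R f ?S"
    by (rule fs(1)[OF S S])
  also have "f ?A = (\<Sum>i\<in>?N. P $ i $ 0 *\<^sub>R triality_wedge_unit i 0)"
    unfolding conjunct2[OF fA] by (intro sum.cong refl) (simp add: fw)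
  also have "f ?S = (\<Sum>i\<in>?N. \<Sum>j\<in>-{0,i}. P $ i $ j *\<^sub>R triality_wedge_unit i j)"
    unfolding conjunct2[OF fBB] conjunct2[OF fB] by (intro sum.cong refl) (auto simp: fw)
  finally show ?thesis
    unfolding triality_def .
qed

end

theory Submission
  imports Defs
begin

text \<open>The principle of triality says that \<open>P\<close>, \<open>\<lambda>(P)\<close>, \<open>\<lambda>\<^sup>2(P)\<close> together annihilate the cyclic trilinear
  form \<open>\<langle>cnj (a b), c\<rangle>\<close>. On wedges it is a consequence of the Clifford relation alone, and \<open>\<lambda>(P)\<close>,
  \<open>\<lambda>\<^sup>2(P)\<close> are the only skew maps related to \<open>P\<close> in this way, so that \<open>\<lambda>\<^sup>3 = 1\<close> and the compatibility
  with brackets follow from the symmetry of the relation. Tensoring gives the Jacobi identity for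
  elements of different summands; the cyclic automorphism \<open>(A,u,v,w) \<mapsto> (\<Lambda>A,v,w,u)\<close> reduces the number
  of cases.

  The form \<open>1/8 \<langle>A,B\<rangle> + \<langle>u,x\<rangle> + \<langle>v,y\<rangle> + \<langle>w,z\<rangle>\<close> is invariant and positive definite. Hence every skew
  derivation is inner, and the identity component of the group of orthogonal automorphisms is a
  compact group whose Lie algebra is isomorphic to the algebra. A maximal torus is spanned by
  \<open>e\<^sub>0 \<and> e\<^sub>1\<close>, \<open>e\<^sub>2 \<and> e\<^sub>3\<close>, \<open>e\<^sub>4 \<and> e\<^sub>5\<close>, \<open>e\<^sub>6 \<and> e\<^sub>7\<close> in both copies of \<open>so(8)\<close>. Both copies of \<open>so(8)\<close> and
  the first copy of the oct-octonions contribute the integral roots, and triality turns the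
  weights of the first copy into the half-integral ones.\<close>

section \<open>Octonion identities\<close>

text \<open>Triality is prescribed only on wedges of orthogonal vectors whose first entry is
  imaginary. The proof therefore derives a formula for all wedges and afterwards works with the
  relation to the trilinear form, which does not mention the coordinates of the definition. For
  \<open>v = w = 0\<close> the bracket is that of so(16), with \<open>u\<close> scaled by 2 as the
  off-diagonal block; the other two copies of the oct-octonions form a half-spin module of dimension
  128. In terms of roots, 24 + 24 + 64 = 112 integral ones come from so(16) and 64 + 64 = 128 from
  the rest. That there are no further roots is seen from the common kernel of the weight
  functionals, which is the torus. The group has to be a set of matrices whose tangent space is
  computed exactly: the exponential series supplies enough curves, and differentiating the defining
  equations bounds the tangent space from above. The second argument produces skew derivations,
  which is why the automorphisms are required to be orthogonal; the same requirement makes the group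
  compact.\<close>

lemma oct_cnj_nth:
  "oct_cnj a $ 0 = a $ 0" "oct_cnj a $ 1 = - a $ 1" "oct_cnj a $ 2 = - a $ 2"
  "oct_cnj a $ 3 = - a $ 3" "oct_cnj a $ 4 = - a $ 4" "oct_cnj a $ 5 = - a $ 5"
  "oct_cnj a $ 6 = - a $ 6" "oct_cnj a $ 7 = - a $ 7"
  by (simp_all only: oct_cnj_def vec_lambda_beta neq_8 if_True if_False simp_thms)

lemma inner_oct:
  "(a :: oct) \<bullet> b = a$0*b$0 + a$1*b$1 + a$2*b$2 + a$3*b$3 + a$4*b$4 + a$5*b$5 + a$6*b$6 + a$7*b$7"
  by (simp only: inner_vec_def sum_8 inner_real_def)

lemma oct_cnj_cnj [simp]: "oct_cnj (oct_cnj a) = a"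
  by (simp add: vec_eq_iff oct_cnj_def)

lemma oct_cnj_mult: "oct_cnj (oct_mult a b) = oct_mult (oct_cnj b) (oct_cnj a)"
  by (simp only: vec_eq_iff forall_8 oct_mult_nth oct_cnj_nth) (simp add: algebra_simps)

lemma oct_inner_cnj: "oct_cnj a \<bullet> b = a \<bullet> oct_cnj b"
  by (simp only: inner_oct oct_cnj_nth mult_minus_left mult_minus_right)

lemma oct_inner_mult_left: "oct_mult a b \<bullet> c = b \<bullet> oct_mult (oct_cnj a) c"
  by (simp only: inner_oct oct_cnj_nth oct_mult_nth) (simp add: algebra_simps)

lemma oct_inner_mult_right: "oct_mult a b \<bullet> c = a \<bullet> oct_mult c (oct_cnj b)"
  by (metis oct_inner_mult_left oct_inner_cnj oct_cnj_mult oct_cnj_cnj)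

lemma oct_square: "oct_mult a a = (2 * a $ 0) *\<^sub>R a - (a \<bullet> a) *\<^sub>R oct_unit 0"
  by (simp only: vec_eq_iff forall_8 oct_mult_nth inner_oct vector_minus_component
      vector_scaleR_component real_scaleR_def oct_unit_nth neq_8 if_True if_False simp_thms)
     (safe; simp add: algebra_simps)

lemma oct_cnj_eq: "oct_cnj a = (2 * a $ 0) *\<^sub>R oct_unit 0 - a"
  by (simp add: vec_eq_iff oct_cnj_def axis_def)

lemmas oct_simps = linear_add[OF oct_mult_linear(1)] linear_add[OF oct_mult_linear(2)]
  linear_diff[OF oct_mult_linear(1)] linear_diff[OF oct_mult_linear(2)]
  linear_scale[OF oct_mult_linear(1)] linear_scale[OF oct_mult_linear(2)]
  linear_neg[OF oct_mult_linear(1)] linear_neg[OF oct_mult_linear(2)]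
  linear_0[OF oct_mult_linear(1)] linear_0[OF oct_mult_linear(2)]
  linear_add[OF oct_cnj_linear] linear_diff[OF oct_cnj_linear] linear_scale[OF oct_cnj_linear]
  linear_neg[OF oct_cnj_linear] linear_0[OF oct_cnj_linear]

lemma oct_left_cnj: "oct_mult (oct_cnj a) (oct_mult a b) = (a \<bullet> a) *\<^sub>R b"
  by (simp only: oct_cnj_eq oct_simps oct_alternative oct_square oct_mult_unit_table) simp

lemma oct_right_cnj: "oct_mult (oct_mult b a) (oct_cnj a) = (a \<bullet> a) *\<^sub>R b"
  by (simp only: oct_cnj_eq oct_simps oct_alternative oct_square oct_mult_unit_table) simp

lemma oct_left_polar:
  "oct_mult (oct_cnj x) (oct_mult y z) + oct_mult (oct_cnj y) (oct_mult x z) = (2 * (x \<bullet> y)) *\<^sub>R z"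
  using oct_left_cnj[of "x + y" z]
  by (simp add: oct_simps oct_left_cnj inner_add inner_commute algebra_simps scaleR_2)

lemma oct_right_polar:
  "oct_mult (oct_mult z y) (oct_cnj x) + oct_mult (oct_mult z x) (oct_cnj y) = (2 * (x \<bullet> y)) *\<^sub>R z"
  using oct_right_cnj[of z "x + y"]
  by (simp add: oct_simps oct_right_cnj inner_add inner_commute algebra_simps scaleR_2)

text \<open>Each pair of units confines \<open>q\<close> to the quaternion subalgebra which that
  pair generates. The three subalgebras used meet only in the real multiples of
  \<open>oct_unit 0\<close>.\<close>

lemma oct_nucleus:
  assumes "\<And>a b. oct_mult (oct_mult a b) q = oct_mult a (oct_mult b q)" "q $ 0 = 0"
  shows "q = 0"
proof -
  let ?n = "\<lambda>i j k. oct_mult (oct_mult (oct_unit i) (oct_unit j)) q $ k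
    = oct_mult (oct_unit i) (oct_mult (oct_unit j) q) $ k"
  have u: "oct_unit i $ j = (if j = i then 1 else 0)" for i j :: 8 by (rule oct_unit_nth)
  have "?n 1 2 4" "?n 1 2 5" "?n 1 2 6" "?n 1 2 7" "?n 1 4 2" "?n 1 4 3" "?n 1 4 6" "?n 1 4 7"
    "?n 2 4 1" "?n 2 4 5" "?n 2 4 3" "?n 2 4 7"
    by (simp_all only: assms)
  then have "q $ 1 = 0 \<and> q $ 2 = 0 \<and> q $ 3 = 0 \<and> q $ 4 = 0 \<and> q $ 5 = 0 \<and> q $ 6 = 0 \<and> q $ 7 = 0"
    apply (simp only: oct_mult_nth u neq_8 simp_thms if_True if_False
      mult_zero_left mult_zero_right mult_1_left mult_1_right add_0_left add_0_right diff_0_right diff_0 assms(2))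
    by simp
  then show ?thesis using assms(2) by (simp only: vec_eq_iff forall_8 zero_index simp_thms)
qed


section \<open>Triality\<close>

lemma transpose_algebra:
  "transpose (A + B) = transpose A + transpose (B :: 'a::ring_1^'n^'m)"
  "transpose (A - B) = transpose A - transpose B" "transpose (- A) = - transpose A"
  "transpose (0 :: 'a::ring_1^'n^'m) = 0"
  by (simp_all add: transpose_def vec_eq_iff)

lemma subspace_so8: "subspace so8"
  by (auto simp: subspace_def so8_def transpose_algebra transpose_scalar)

lemma so8_nth:
  assumes "P \<in> so8" shows "P $ j $ i = - P $ i $ j"
proof -
  have "transpose P $ i $ j = (- P) $ i $ j"
    using assms by (simp only: so8_def mem_Collect_eq)
  then show ?thesis by (simp add: transpose_def)
qed

lemma matrix_vector_mult_minus: "(- A) *v x = - (A *v (x :: real^'n))"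
  by (simp add: vec_eq_iff matrix_vector_mult_def sum_negf)

lemma so8_inner_skew:
  assumes "P \<in> so8" shows "(P *v x) \<bullet> y = - (x \<bullet> (P *v y))"
proof -
  have "(P *v x) \<bullet> y = (y v* P) \<bullet> x" by (subst inner_commute) (rule dot_lmul_matrix[symmetric])
  also have "\<dots> = (transpose P *v y) \<bullet> x" by (simp only: transpose_matrix_vector)
  also have "\<dots> = - (x \<bullet> (P *v y))"
    using assms by (simp only: so8_def mem_Collect_eq matrix_vector_mult_minus) (simp add: inner_commute)
  finally show ?thesis .
qed

lemma so8I_inner:
  assumes "\<And>x y. (P *v x) \<bullet> y = - (x \<bullet> (P *v y))" shows "P \<in> so8"
proof -
  have *: "P $ j $ i = - P $ i $ j" for i j
    using assms[of "axis i 1" "axis j 1"]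
    by (simp only: matrix_vector_mult_basis inner_axis inner_axis' column_def vec_lambda_beta
        inner_real_def mult_1_left mult_1_right)
  show ?thesis by (auto simp: so8_def vec_eq_iff transpose_def intro: *)
qed

lemma wedge_so8: "wedge x y \<in> so8"
  by (simp add: so8_def transpose_def vec_eq_iff wedge_def oct_tensor_def)

lemma wedge_mult: "wedge x y *v a = (y \<bullet> a) *\<^sub>R x - (x \<bullet> a) *\<^sub>R y"
  by (simp add: vec_eq_iff matrix_vector_mult_def wedge_def oct_tensor_def inner_vec_def
      algebra_simps sum_subtractf sum_distrib_left)

lemma bilinear_wedge: "bilinear wedge"
  by (auto intro!: linearI simp: bilinear_def wedge_def oct_tensor_def vec_eq_iff algebra_simps)

lemma so8_span: "so8 = span (range (\<lambda>(x, y). wedge x y))"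
proof
  show "span (range (\<lambda>(x, y). wedge x y)) \<subseteq> so8"
    by (intro span_minimal subspace_so8) (auto simp: wedge_so8)
  show "so8 \<subseteq> span (range (\<lambda>(x, y). wedge x y))"
  proof
    fix P assume P: "P \<in> so8"
    have "P $ p $ q = (\<Sum>i\<in>UNIV. (1/2) *\<^sub>R wedge (column i P) (axis i 1)) $ p $ q" for p q
    proof -
      have "(\<Sum>i\<in>UNIV. (1/2) *\<^sub>R wedge (column i P) (axis i 1)) $ p $ q
        = (\<Sum>i\<in>UNIV. if i = q then P$p$i/2 else 0) - (\<Sum>i\<in>UNIV. if i = p then P$q$i/2 else 0)"
        unfolding sum_component sum_subtractf[symmetric]
        by (intro sum.cong) (auto simp: wedge_def oct_tensor_def column_def axis_def)
      also have "\<dots> = P $ p $ q" using so8_nth[OF P, of q p] by simp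
      finally show ?thesis by simp
    qed
    then have "P = (\<Sum>i\<in>UNIV. (1/2) *\<^sub>R wedge (column i P) (axis i 1))"
      by (simp add: vec_eq_iff)
    also have "\<dots> \<in> span (range (\<lambda>(x, y). wedge x y))"
      by (intro span_sum span_scale span_base) auto
    finally show "P \<in> span (range (\<lambda>(x, y). wedge x y))" .
  qed
qed

lemma linear_eq_on_so8:
  assumes "linear f" "linear g" "\<And>a b. f (wedge a b) = g (wedge a b)" "P \<in> so8"
  shows "f P = g P"
  by (rule linear_eq_on_span[OF assms(1,2) _ assms(4)[unfolded so8_span]]) (auto simp: assms(3))

text \<open>The defining rule covers orthogonal pairs with \<open>a\<close> imaginary. The Clifford
  relation moves the conjugation from \<open>b\<close> to \<open>a\<close>, and subtracting the
  scalar part makes the right-hand side skew in \<open>a\<close> and \<open>b\<close>. The formula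
  then holds for all pairs and turns later statements on wedges into octonion identities.\<close>

lemma triality_wedge_mult:
  "triality (wedge a b) *v c = (1/2) *\<^sub>R (oct_mult (oct_cnj a) (oct_mult b c) - (a \<bullet> b) *\<^sub>R c)"
proof -
  let ?f = "\<lambda>a b. triality (wedge a b) *v c"
  let ?g = "\<lambda>a b. (1/2) *\<^sub>R (oct_mult (oct_cnj a) (oct_mult b c) - (a \<bullet> b) *\<^sub>R c)"
  have wsw: "wedge b a = - wedge a b" for a b by (simp add: wedge_def)
  have pure: "?f (oct_unit i) (oct_unit j) = ?g (oct_unit i) (oct_unit j)"
    if ij: "i \<noteq> 0" "i \<noteq> j" for i j
  proof -
    have o: "oct_unit i \<bullet> oct_unit j = 0" using ij by (simp add: inner_axis_axis)
    have c: "oct_cnj (oct_unit i) = - oct_unit i" using ij by (simp add: oct_cnj_unit)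
    have "?f (oct_unit i) (oct_unit j) = (1/2) *\<^sub>R oct_mult (oct_cnj (oct_unit j)) (oct_mult (oct_cnj (oct_unit i)) c)"
      by (subst triality_wedge) (use ij o in \<open>auto simp: oct_Pu_iff axis_def scaleR_matrix_vector_assoc[symmetric] matrix_vector_mul_assoc[symmetric] oct_L_mult\<close>)
    also have "\<dots> = (1/2) *\<^sub>R oct_mult (oct_cnj (oct_unit i)) (oct_mult (oct_unit j) c)"
      using oct_left_polar[of "oct_unit i" "oct_unit j" c] by (simp add: o c oct_simps eq_neg_iff_add_eq_0)
    finally show ?thesis by (simp add: o)
  qed
  have "?f = ?g"
  proof (rule bilinear_eq_stdbasis)
    show "bilinear ?f" using bilinear_wedge
      by (auto intro!: linearI simp: bilinear_def linear_iff linear_add[OF triality_linear] linear_scale[OF triality_linear]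
        matrix_vector_mult_add_rdistrib scaleR_matrix_vector_assoc)
    show "bilinear ?g"
      by (auto intro!: linearI simp: bilinear_def oct_simps algebra_simps inner_add add_divide_distrib)
    fix x y :: oct assume "x \<in> Basis" "y \<in> Basis"
    then obtain i j where xy: "x = oct_unit i" "y = oct_unit j" by (auto simp: Basis_vec_def)
    have eq: "?f x x = 0" "?g x x = 0" for x
      by (simp_all add: wedge_def linear_0[OF triality_linear] oct_left_cnj)
    consider "i = j" | "i \<noteq> 0" "i \<noteq> j" | "j \<noteq> 0" "i \<noteq> j" by metis
    then show "?f x y = ?g x y"
    proof cases
      case 3
      have "?g x y + ?g y x = 0"
        using oct_left_polar[of x y c] by (simp add: vec_eq_iff inner_commute field_simps)
      then have "?g x y = - ?g y x" by (rule eq_neg_iff_add_eq_0[THEN iffD2])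
      moreover have "?f x y = - ?f y x"
        by (subst wsw) (simp add: linear_neg[OF triality_linear] matrix_vector_mult_minus)
      moreover have "?f y x = ?g y x" unfolding xy using 3 by (intro pure) auto
      ultimately show ?thesis by (simp only:)
    next
      case 1
      then show ?thesis using eq[of x] by (simp only: xy)
    next
      case 2
      then show ?thesis unfolding xy by (rule pure)
    qed
  qed
  then show ?thesis by (rule fun_cong[OF fun_cong])
qed


lemmas matrix_vector_simps = matrix_vector_mult_add_rdistrib matrix_vector_mult_diff_rdistrib
  matrix_vector_right_distrib matrix_vector_mult_diff_distrib matrix_vector_mult_minus
  scaleR_matrix_vector_assoc[symmetric] matrix_vector_mul_assoc[symmetric]

section \<open>Octonion conjugation and the invariant trilinear form\<close>

definition oct_cnj_mat :: mat8 where
  "oct_cnj_mat = matrix oct_cnj"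

lemma oct_cnj_mat_mult [simp]: "oct_cnj_mat *v a = oct_cnj a"
  by (simp add: oct_cnj_mat_def oct_cnj_linear)

text \<open>\<open>oct_cnj\<close> is orthogonal of determinant -1, so this is an outer automorphism
  of so(8) of order two. With triality it generates the symmetric group on three letters; the
  relation between them is the first part of \<open>triality_triality\<close>.\<close>

definition conj_oct_cnj :: "mat8 \<Rightarrow> mat8" where
  "conj_oct_cnj P = oct_cnj_mat ** P ** oct_cnj_mat"

lemma conj_oct_cnj_mult: "conj_oct_cnj P *v a = oct_cnj (P *v oct_cnj a)"
  by (simp add: conj_oct_cnj_def matrix_vector_simps)

lemma conj_oct_cnj_wedge: "conj_oct_cnj (wedge a b) = wedge (oct_cnj a) (oct_cnj b)"
  by (simp add: matrix_eq conj_oct_cnj_mult wedge_mult oct_simps oct_inner_cnj)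

lemma conj_oct_cnj_so8: "P \<in> so8 \<Longrightarrow> conj_oct_cnj P \<in> so8"
  by (rule so8I_inner) (simp add: conj_oct_cnj_mult oct_inner_cnj so8_inner_skew)

lemma conj_oct_cnj_linear: "linear conj_oct_cnj"
  by (rule linearI) (simp_all add: matrix_eq conj_oct_cnj_mult matrix_vector_simps oct_simps)

lemma triality_so8:
  assumes "P \<in> so8" shows "triality P \<in> so8"
proof -
  have "transpose (triality P) = - triality P"
  proof (rule linear_eq_on_so8[OF _ _ _ assms])
    show "linear (\<lambda>P. transpose (triality P))"
      using triality_linear by (auto intro!: linearI simp: transpose_algebra transpose_scalar linear_add linear_scale)
    show "linear (\<lambda>P. - triality P)"
      using triality_linear by (rule linear_compose_neg)
    fix a b
    have "triality (wedge a b) \<in> so8"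
    proof (rule so8I_inner)
      fix x y
      have "(oct_mult (oct_cnj a) (oct_mult b x) + oct_mult (oct_cnj b) (oct_mult a x)) \<bullet> y
          = 2 * (a \<bullet> b) * (x \<bullet> y)"
        by (simp only: oct_left_polar) simp
      moreover have "oct_mult (oct_cnj b) (oct_mult a x) \<bullet> y = x \<bullet> oct_mult (oct_cnj a) (oct_mult b y)"
        by (simp add: oct_inner_mult_left)
      ultimately show "(triality (wedge a b) *v x) \<bullet> y = - (x \<bullet> (triality (wedge a b) *v y))"
        by (simp add: triality_wedge_mult algebra_simps)
    qed
    then show "transpose (triality (wedge a b)) = - triality (wedge a b)"
      by (simp add: so8_def)
  qed
  then show ?thesis by (simp add: so8_def)
qed

text \<open>This is the real part of \<open>(a b) c\<close>, which accounts for the cyclic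
  symmetry.\<close>

definition oct_form :: "oct \<Rightarrow> oct \<Rightarrow> oct \<Rightarrow> real" where
  "oct_form a b c = oct_cnj (oct_mult a b) \<bullet> c"

lemma oct_form_cyclic: "oct_form a b c = oct_form b c a"
proof -
  have "oct_form b c a = c \<bullet> oct_mult (oct_cnj b) (oct_cnj a)"
    by (simp only: oct_form_def oct_inner_cnj oct_inner_mult_left)
  then show ?thesis by (simp only: oct_form_def oct_cnj_mult inner_commute)
qed

lemma oct_form_linear:
  "linear (\<lambda>a. oct_form a b c)" "linear (\<lambda>b. oct_form a b c)" "linear (oct_form a b)"
  by (auto intro!: linearI simp: oct_form_def oct_simps inner_add)

lemmas oct_form_simps =
  linear_add[OF oct_form_linear(1)] linear_diff[OF oct_form_linear(1)] linear_scale[OF oct_form_linear(1)]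
  linear_add[OF oct_form_linear(2)] linear_diff[OF oct_form_linear(2)] linear_scale[OF oct_form_linear(2)]
  linear_add[OF oct_form_linear(3)] linear_diff[OF oct_form_linear(3)] linear_scale[OF oct_form_linear(3)]

text \<open>The triples that annihilate the trilinear form infinitesimally. Unlike the formula for
  \<open>triality\<close>, this relation is visibly stable under rotation, differences and
  commutators, and \<open>triality\<close> is recovered from it by uniqueness.\<close>

definition triality_related :: "mat8 \<Rightarrow> mat8 \<Rightarrow> mat8 \<Rightarrow> bool" where
  "triality_related P Q R \<longleftrightarrow> (\<forall>a b c.
     oct_form (P *v a) b c + oct_form a (Q *v b) c + oct_form a b (R *v c) = 0)"

lemma triality_related_rotate:
  assumes "triality_related P Q R" shows "triality_related Q R P"
  unfolding triality_related_def
proof (intro allI)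
  fix a b c
  have "oct_form (P *v c) a b + oct_form c (Q *v a) b + oct_form c a (R *v b) = 0"
    using assms by (simp add: triality_related_def)
  then show "oct_form (Q *v a) b c + oct_form a (R *v b) c + oct_form a b (P *v c) = 0"
    using oct_form_cyclic[of "P *v c" a b] oct_form_cyclic[of c "Q *v a" b] oct_form_cyclic[of c a "R *v b"]
    by simp
qed

lemma triality_related_diff:
  assumes "triality_related P Q R" "triality_related P' Q' R'"
  shows "triality_related (P - P') (Q - Q') (R - R')"
  unfolding triality_related_def
proof (intro allI)
  fix a b c
  have "oct_form (P *v a) b c + oct_form a (Q *v b) c + oct_form a b (R *v c) = 0"
    "oct_form (P' *v a) b c + oct_form a (Q' *v b) c + oct_form a b (R' *v c) = 0"
    using assms by (simp_all add: triality_related_def)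
  then show "oct_form ((P - P') *v a) b c + oct_form a ((Q - Q') *v b) c + oct_form a b ((R - R') *v c) = 0"
    by (simp add: matrix_vector_simps oct_form_simps)
qed

text \<open>For first entry 0 the relation makes \<open>D\<close> commute with all left
  multiplications. So \<open>D\<close> is right multiplication by \<open>D 1\<close>, which is
  imaginary because \<open>D\<close> is skew and associates with all products because
  \<open>D\<close> commutes with them; \<open>oct_nucleus\<close> applies.\<close>

lemma triality_related_zero:
  assumes rel: "triality_related 0 D E" and D: "D \<in> so8"
  shows "D = 0" "E = 0"
proof -
  have r: "oct_form a (D *v b) c + oct_form a b (E *v c) = 0" for a b c
    using rel by (simp add: triality_related_def oct_form_def oct_simps)
  have m: "D *v oct_mult a b = oct_mult a (D *v b)" for a b
  proof -
    \<comment> \<open>The relation at \<open>(1, a b, c)\<close> and at \<open>(a, b, c)\<close>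
      contains the same term in \<open>E\<close>, so comparing the two eliminates
      \<open>E\<close>.\<close>
    have "oct_cnj (D *v oct_mult a b - oct_mult a (D *v b)) \<bullet> c = 0" for c
      using r[of "oct_unit 0" "oct_mult a b" c] r[of a b c]
      by (simp add: oct_form_def oct_mult_unit_table oct_simps inner_diff_left)
    then have "oct_cnj (D *v oct_mult a b - oct_mult a (D *v b)) = 0"
      using inner_eq_zero_iff by blast
    then have "oct_cnj (oct_cnj (D *v oct_mult a b - oct_mult a (D *v b))) = 0"
      by (simp only: oct_simps)
    then show ?thesis by simp
  qed
  let ?q = "D *v oct_unit 0"
  have "?q \<bullet> oct_unit 0 = - (oct_unit 0 \<bullet> ?q)" by (rule so8_inner_skew[OF D])
  then have q0: "?q $ 0 = 0" by (simp add: inner_axis inner_axis')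
  have Da: "D *v a = oct_mult a ?q" for a
    using m[of a "oct_unit 0"] by (simp only: oct_mult_unit_table)
  have q: "?q = 0"
    by (rule oct_nucleus[OF _ q0]) (simp only: Da[symmetric] m)
  have "D *v a = 0" for a
    by (subst Da) (simp only: q oct_simps)
  then show D0: "D = 0"
    by (simp add: matrix_eq)
  have "E *v c = 0" for c
  proof -
    have "oct_cnj b \<bullet> (E *v c) = 0" for b
      using r[of "oct_unit 0" b c] by (simp add: oct_form_def oct_mult_unit_table D0 oct_simps)
    then have "oct_cnj (oct_cnj (E *v c)) \<bullet> (E *v c) = 0" by blast
    then show ?thesis by simp
  qed
  then show "E = 0" by (simp add: matrix_eq)
qed

lemma triality_related_unique:
  assumes "triality_related P Q R" "triality_related P Q' R'" "Q \<in> so8" "Q' \<in> so8"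
  shows "Q = Q'" "R = R'"
proof -
  have "triality_related 0 (Q - Q') (R - R')"
    using triality_related_diff[OF assms(1,2)] by simp
  moreover have "Q - Q' \<in> so8" using assms(3,4) subspace_so8 by (rule subspace_diff[rotated])
  ultimately show "Q = Q'" "R = R'" using triality_related_zero by force+
qed

text \<open>On wedges both companions are Clifford products, so the relation is a consequence of
  the Clifford relation \<open>L(cnj x) L(y) + L(cnj y) L(x) = 2\<langle>x,y\<rangle>\<close> alone.\<close>

lemma triality_related_triality:
  assumes "P \<in> so8"
  shows "triality_related P (triality P) (conj_oct_cnj (triality (conj_oct_cnj P)))"
proof -
  have "oct_form (P *v a) b c + oct_form a (triality P *v b) c
      + oct_form a b (conj_oct_cnj (triality (conj_oct_cnj P)) *v c) = 0" for a b c
  proof (rule linear_eq_on_so8[where g = "\<lambda>_. 0", OF _ _ _ assms])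
    show "linear (\<lambda>P. oct_form (P *v a) b c + oct_form a (triality P *v b) c
      + oct_form a b (conj_oct_cnj (triality (conj_oct_cnj P)) *v c))"
      by (rule linearI) (simp_all add: oct_form_simps matrix_vector_simps linear_add[OF triality_linear]
        linear_scale[OF triality_linear] linear_add[OF conj_oct_cnj_linear]
        linear_scale[OF conj_oct_cnj_linear] algebra_simps)
    fix x y
    let ?m = oct_mult
    have polar: "?m u (?m (oct_cnj v) z) = (2 * (u \<bullet> v)) *\<^sub>R z - ?m v (?m (oct_cnj u) z)" for u v z
      using oct_left_polar[of "oct_cnj u" "oct_cnj v" z] by (simp add: oct_inner_cnj eq_diff_eq)
    have polar': "?m (oct_cnj u) (?m v z) = (2 * (u \<bullet> v)) *\<^sub>R z - ?m (oct_cnj v) (?m u z)" for u v z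
      using oct_left_polar[of u v z] by (simp add: eq_diff_eq)
    \<comment> \<open>Three Clifford exchanges: \<open>x\<close> with \<open>a\<close>, then
      \<open>y\<close> with \<open>a\<close>, and finally \<open>x\<close> with \<open>y\<close> in
      front of \<open>b\<close>.\<close>
    have "?m y (?m (oct_cnj x) (?m a b)) = (2 * (x \<bullet> a)) *\<^sub>R ?m y b - (2 * (y \<bullet> a)) *\<^sub>R ?m x b
        + (2 * (x \<bullet> y)) *\<^sub>R ?m a b - ?m a (?m (oct_cnj x) (?m y b))"
      by (simp add: polar'[of x a b] polar[of y a] polar'[of y x b] oct_simps inner_commute)
    then have e: "?m y (?m (oct_cnj x) (?m a b)) \<bullet> oct_cnj c =
        2 * (x \<bullet> a) * (?m y b \<bullet> oct_cnj c) - 2 * (y \<bullet> a) * (?m x b \<bullet> oct_cnj c)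
        + 2 * (x \<bullet> y) * (?m a b \<bullet> oct_cnj c) - ?m a (?m (oct_cnj x) (?m y b)) \<bullet> oct_cnj c"
      by (simp add: inner_add_left inner_diff_left)
    \<comment> \<open>Adjointness moves the multiplications in the third slot onto
      \<open>a b\<close>, where the exchange formula applies.\<close>
    have "oct_form a b (?m (?m c y) (oct_cnj x)) = ?m a b \<bullet> oct_cnj (?m (?m c y) (oct_cnj x))"
      by (simp only: oct_form_def oct_inner_cnj)
    also have "\<dots> = oct_mult y (oct_mult (oct_cnj x) (oct_mult a b)) \<bullet> oct_cnj c"
      by (simp add: oct_cnj_mult oct_inner_mult_left[of y] oct_inner_mult_left[of "oct_cnj x"])
    finally have f: "oct_form a b (?m (?m c y) (oct_cnj x)) =
        oct_mult y (oct_mult (oct_cnj x) (oct_mult a b)) \<bullet> oct_cnj c" .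
    show "oct_form (wedge x y *v a) b c + oct_form a (triality (wedge x y) *v b) c
      + oct_form a b (conj_oct_cnj (triality (conj_oct_cnj (wedge x y))) *v c) = 0"
      unfolding conj_oct_cnj_wedge conj_oct_cnj_mult triality_wedge_mult wedge_mult
      by (simp add: oct_form_simps oct_simps oct_cnj_mult f e oct_inner_cnj)
         (simp add: oct_form_def oct_inner_cnj field_simps)
  qed (simp add: linear_iff)
  then show ?thesis by (simp add: triality_related_def)
qed

text \<open>Write \<open>S\<close> for the map on the right of the first equation. The triple of
  \<open>P\<close> under \<open>triality_related_triality\<close>, rotated once, and the triple of
  \<open>triality P\<close> have the same first entry. Uniqueness gives
  \<open>S P = triality (triality P)\<close> and \<open>P = S (triality P)\<close>, and combining
  the two gives order three.\<close>

lemma triality_triality: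
  assumes "P \<in> so8"
  shows "triality (triality P) = conj_oct_cnj (triality (conj_oct_cnj P))" (is ?A)
    and "triality (triality (triality P)) = P" (is ?B)
proof -
  let ?S = "\<lambda>P. conj_oct_cnj (triality (conj_oct_cnj P))"
  have so: "triality P \<in> so8" "?S P \<in> so8" if "P \<in> so8" for P
    using that by (simp_all add: triality_so8 conj_oct_cnj_so8)
  have *: "?S P = triality (triality P)" "P = ?S (triality P)" if "P \<in> so8" for P
    using triality_related_unique[OF triality_related_rotate[OF triality_related_triality[OF that]]
        triality_related_triality[OF so(1)[OF that]] so(2)[OF that] so(1)[OF so(1)[OF that]]]
    by blast+
  show ?A using * assms by simp
  show ?B using *(1)[OF so(1)[OF assms]] *(2)[OF assms] by simp
qed

lemma triality_related_triality':
  "P \<in> so8 \<Longrightarrow> triality_related P (triality P) (triality (triality P))"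
  using triality_related_triality triality_triality(1) by simp

section \<open>Triality as an isometric Lie algebra automorphism\<close>

lemma matrix_mul_minus: "A ** (- B) = - (A ** B)" "(- A) ** B = - (A ** B)"
  for A :: "'a::ring_1^'n^'m"
  by (simp_all add: matrix_matrix_mult_def vec_eq_iff sum_negf)

lemma commutator_so8: "P \<in> so8 \<Longrightarrow> Q \<in> so8 \<Longrightarrow> commutator P Q \<in> so8"
  by (simp add: so8_def commutator_def transpose_algebra matrix_transpose_mul matrix_mul_minus)

text \<open>Related triples are closed under componentwise commutators, and the first entry of a
  triple determines the second among skew matrices.\<close>

lemma triality_commutator:
  assumes "P \<in> so8" "P' \<in> so8"
  shows "triality (commutator P P') = commutator (triality P) (triality P')"
proof -
  have "triality_related (commutator P P') (commutator Q Q') (commutator R R')"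
    if "triality_related P Q R" "triality_related P' Q' R'" for Q Q' R R'
    unfolding triality_related_def
  proof (intro allI)
    fix a b c
    have r: "oct_form (P *v a) b c + oct_form a (Q *v b) c + oct_form a b (R *v c) = 0"
      "oct_form (P' *v a) b c + oct_form a (Q' *v b) c + oct_form a b (R' *v c) = 0" for a b c
      using that by (auto simp: triality_related_def)
    show "oct_form (commutator P P' *v a) b c + oct_form a (commutator Q Q' *v b) c
        + oct_form a b (commutator R R' *v c) = 0"
      using r(1)[of "P' *v a" b c] r(1)[of a "Q' *v b" c] r(1)[of a b "R' *v c"]
        r(2)[of "P *v a" b c] r(2)[of a "Q *v b" c] r(2)[of a b "R *v c"]
      by (simp add: commutator_def matrix_vector_simps oct_form_simps)
  qed
  then have "triality_related (commutator P P') (commutator (triality P) (triality P'))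
      (commutator (triality (triality P)) (triality (triality P')))"
    using assms triality_related_triality' by blast
  moreover have "triality_related (commutator P P') (triality (commutator P P'))
      (triality (triality (commutator P P')))"
    using assms by (intro triality_related_triality' commutator_so8)
  ultimately show ?thesis
    using assms by (intro triality_related_unique(1)) (auto intro!: triality_so8 commutator_so8)
qed

lemma inner_matrix: "M \<bullet> N = (\<Sum>i\<in>UNIV. \<Sum>j\<in>UNIV. M $ i $ j * N $ i $ j)" for M :: "real^'n^'m"
  by (simp add: inner_vec_def)

lemma inner_oct_tensor: "M \<bullet> oct_tensor c d = c \<bullet> (M *v d)"
  by (simp add: inner_matrix oct_tensor_def matrix_vector_mult_def inner_vec_def sum_distrib_left mult_ac)

lemma inner_wedge: "M \<in> so8 \<Longrightarrow> M \<bullet> wedge c d = 2 * (c \<bullet> (M *v d))"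
  using so8_inner_skew[of M c d] by (simp add: wedge_def inner_diff_right inner_oct_tensor inner_commute)

text \<open>As triality has order three, this says that it is an isometry for the trace form. On
  wedges both sides equal \<open>oct_mult a c \<bullet> oct_mult b d - (a \<bullet> b) * (c
  \<bullet> d)\<close>: the left side by adjointness of left multiplications, the right side by that
  of right multiplications.\<close>

lemma triality_adjoint:
  assumes "P \<in> so8" "Q \<in> so8"
  shows "triality P \<bullet> Q = P \<bullet> triality (triality Q)"
proof (rule linear_eq_on_so8[OF _ _ _ assms(1)])
  have tt: "linear (\<lambda>Q. triality (triality Q))"
    using linear_compose[OF triality_linear triality_linear] by (simp add: o_def)
  show "linear (\<lambda>P. triality P \<bullet> Q)"
    by (rule linearI) (simp_all add: linear_add[OF triality_linear] linear_scale[OF triality_linear] inner_add_left)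
  show "linear (\<lambda>P. P \<bullet> triality (triality Q))"
    by (rule linearI) (simp_all add: inner_add_left)
  fix a b
  show "triality (wedge a b) \<bullet> Q = wedge a b \<bullet> triality (triality Q)"
  proof (rule linear_eq_on_so8[OF _ _ _ assms(2)])
    show "linear (inner (triality (wedge a b)))"
      by (rule linearI) (simp_all add: inner_add_right)
    show "linear (\<lambda>Q. wedge a b \<bullet> triality (triality Q))"
      by (rule linearI) (simp_all add: linear_add[OF tt] linear_scale[OF tt] inner_add_right)
    fix c d
    have "triality (wedge a b) \<bullet> wedge c d = 2 * (c \<bullet> (triality (wedge a b) *v d))"
      by (intro inner_wedge triality_so8 wedge_so8)
    also have "\<dots> = oct_mult a c \<bullet> oct_mult b d - (a \<bullet> b) * (c \<bullet> d)"
      by (simp add: triality_wedge_mult inner_diff_right oct_inner_mult_left)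
    also have "\<dots> = 2 * (a \<bullet> (triality (triality (wedge c d)) *v b))"
      by (simp add: triality_triality(1) wedge_so8 conj_oct_cnj_wedge conj_oct_cnj_mult triality_wedge_mult
        oct_simps oct_cnj_mult inner_diff_right oct_inner_mult_right oct_inner_cnj)
    also have "\<dots> = wedge a b \<bullet> triality (triality (wedge c d))"
      by (simp add: inner_wedge triality_so8 wedge_so8 inner_commute[of "wedge a b"])
    finally show "triality (wedge a b) \<bullet> wedge c d = wedge a b \<bullet> triality (triality (wedge c d))" .
  qed
qed

section \<open>Oct-octonions\<close>

lemma oct_tensor_simps:
  "oct_tensor (a + b) c = oct_tensor a c + oct_tensor b c"
  "oct_tensor (a - b) c = oct_tensor a c - oct_tensor b c"
  "oct_tensor (r *\<^sub>R a) c = r *\<^sub>R oct_tensor a c"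
  "oct_tensor a (c + d) = oct_tensor a c + oct_tensor a d"
  "oct_tensor a (c - d) = oct_tensor a c - oct_tensor a d"
  "oct_tensor a (r *\<^sub>R c) = r *\<^sub>R oct_tensor a c"
  by (simp_all add: oct_tensor_def vec_eq_iff algebra_simps)

lemma linear_eq_tensor:
  assumes "linear f" "linear g" "\<And>a b. f (oct_tensor a b) = g (oct_tensor a b)"
  shows "f X = g X"
proof -
  have "X = (\<Sum>i\<in>UNIV. oct_tensor (axis i 1) (X $ i))"
    by (simp add: vec_eq_iff oct_tensor_def axis_def if_distrib[of "\<lambda>x. x * _"] cong: if_cong)
  then show ?thesis
    by (metis (no_types, lifting) linear_sum assms sum.cong)
qed

lemma transpose_oct_tensor: "transpose (oct_tensor a b) = oct_tensor b a"
  by (simp add: oct_tensor_def transpose_def vec_eq_iff)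

lemma oct_tensor_matrix_mult: "oct_tensor a b ** oct_tensor c d = (b \<bullet> c) *\<^sub>R oct_tensor a d"
  by (simp add: vec_eq_iff matrix_matrix_mult_def oct_tensor_def inner_vec_def sum_distrib_left
    sum_distrib_right mult_ac)

lemma oct_tensor_inner: "oct_tensor a b \<bullet> oct_tensor c d = (a \<bullet> c) * (b \<bullet> d)"
  by (simp add: inner_matrix oct_tensor_def inner_vec_def sum_product mult_ac)

abbreviation so8_pair :: "(mat8 \<times> mat8) set" where
  "so8_pair \<equiv> so8 \<times> so8"

lemma subspace_so8_pair: "subspace so8_pair"
  by (intro subspace_Times subspace_so8)

lemma pair_act_oct_tensor:
  assumes "A \<in> so8_pair"
  shows "pair_act A (oct_tensor a b) = oct_tensor (fst A *v a) b + oct_tensor a (snd A *v b)"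
proof -
  have s: "snd A $ k $ q = - snd A $ q $ k" for k q using assms by (intro so8_nth) auto
  show ?thesis
    unfolding vec_eq_iff
  proof (intro allI)
    fix p q
    have "(\<Sum>k\<in>UNIV. a $ p * b $ k * snd A $ k $ q) = - (\<Sum>k\<in>UNIV. a $ p * (snd A $ q $ k * b $ k))"
      by (subst s) (simp add: sum_negf mult_ac)
    then show "pair_act A (oct_tensor a b) $ p $ q
        = (oct_tensor (fst A *v a) b + oct_tensor a (snd A *v b)) $ p $ q"
      by (simp add: pair_act_def matrix_matrix_mult_def oct_tensor_def matrix_vector_mult_def
          sum_distrib_left sum_distrib_right mult_ac)
  qed
qed

lemma curly_wedge_oct_tensor:
  "curly_wedge (oct_tensor a b) (oct_tensor c d) = ((b \<bullet> d) *\<^sub>R wedge a c, (a \<bullet> c) *\<^sub>R wedge b d)"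
  by (simp add: curly_wedge_def transpose_oct_tensor oct_tensor_matrix_mult wedge_def inner_commute
    scaleR_diff_right)

text \<open>Product and conjugation occur in the bracket only together. The combined product is the
  one that has a cyclic trilinear form.\<close>

definition oo_mult_cnj :: "mat8 \<Rightarrow> mat8 \<Rightarrow> mat8" where
  "oo_mult_cnj X Y = oo_cnj (oo_mult X Y)"

lemma oo_mult_cnj_oct_tensor: "oo_mult_cnj (oct_tensor a b) (oct_tensor c d) =
    oct_tensor (oct_cnj (oct_mult a c)) (oct_cnj (oct_mult b d))"
  by (simp add: oo_mult_cnj_def oo_mult_tensor oo_cnj_tensor)

lemma oo_mult_cnj_linear: "linear (oo_mult_cnj X)" "linear (\<lambda>X. oo_mult_cnj X Y)"
  unfolding oo_mult_cnj_def
  using linear_compose[OF oo_mult_linear(1) oo_cnj_linear] linear_compose[OF oo_mult_linear(2) oo_cnj_linear]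
  by (simp_all add: o_def)

lemma matrix_mul_scaleR:
  "(c *\<^sub>R A) ** B = c *\<^sub>R (A ** B)" "A ** (c *\<^sub>R B) = c *\<^sub>R (A ** B)"
  for A :: "real^'n^'m" and B :: "real^'k^'n"
  by (simp_all add: matrix_matrix_mult_def vec_eq_iff sum_distrib_left mult_ac)

lemma matrix_mul_diff:
  "(A - A') ** B = A ** B - A' ** B" "A ** (B - B') = A ** B - A ** B'"
  for A :: "real^'n^'m" and B :: "real^'k^'n"
  by (simp_all add: matrix_matrix_mult_def vec_eq_iff algebra_simps sum_subtractf)

lemma matrix_mul_add:
  "(A + A') ** B = A ** B + A' ** B" "A ** (B + B') = A ** B + A ** B'"
  for A :: "real^'n^'m" and B :: "real^'k^'n"
  by (simp_all add: matrix_matrix_mult_def vec_eq_iff algebra_simps sum.distrib)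

lemmas matrix_mul_simps = matrix_mul_add matrix_mul_diff matrix_mul_scaleR matrix_mul_minus

lemma pair_act_linear: "linear (pair_act A)" "linear (\<lambda>A. pair_act A X)"
  by (auto intro!: linearI simp: pair_act_def matrix_mul_simps algebra_simps)

lemma curly_wedge_linear: "linear (curly_wedge X)" "linear (\<lambda>X. curly_wedge X Y)"
  by (auto intro!: linearI simp: curly_wedge_def matrix_mul_simps transpose_algebra transpose_scalar algebra_simps)

lemma pair_bracket_linear: "linear (pair_bracket A)" "linear (\<lambda>A. pair_bracket A B)"
  by (auto intro!: linearI simp: pair_bracket_def commutator_def matrix_mul_simps algebra_simps)

lemma Triality_linear: "linear Triality"
  by (auto intro!: linearI simp: Triality_def linear_add[OF triality_linear] linear_scale[OF triality_linear])

lemmas linear_ops = oo_mult_cnj_linear pair_act_linear curly_wedge_linear pair_bracket_linear Triality_linear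

lemmas linear_ops_simps = linear_ops[THEN linear_add] linear_ops[THEN linear_diff]
  linear_ops[THEN linear_scale] linear_ops[THEN linear_neg] linear_ops[THEN linear_0]

lemma curly_wedge_so8: "curly_wedge X Y \<in> so8_pair"
  by (simp add: curly_wedge_def so8_def transpose_algebra matrix_transpose_mul)

lemma Triality_so8: "A \<in> so8_pair \<Longrightarrow> Triality A \<in> so8_pair"
  by (auto simp: Triality_def triality_so8)

lemma pair_bracket_so8: "A \<in> so8_pair \<Longrightarrow> B \<in> so8_pair \<Longrightarrow> pair_bracket A B \<in> so8_pair"
  by (auto simp: pair_bracket_def commutator_so8)

lemma Triality_cube: "A \<in> so8_pair \<Longrightarrow> Triality (Triality (Triality A)) = A"
  by (auto simp: Triality_def triality_triality(2))

lemma Triality_bracket: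
  "A \<in> so8_pair \<Longrightarrow> B \<in> so8_pair \<Longrightarrow> Triality (pair_bracket A B) = pair_bracket (Triality A) (Triality B)"
  by (auto simp: Triality_def pair_bracket_def triality_commutator)

lemma Triality_adjoint:
  assumes "A \<in> so8_pair" "B \<in> so8_pair"
  shows "Triality A \<bullet> B = A \<bullet> Triality (Triality B)"
  using assms by (auto simp: Triality_def inner_prod_def triality_adjoint)

section \<open>Triality identities for the oct-octonions\<close>

lemma triality_cnj_mult:
  assumes "P \<in> so8"
  shows "triality (triality P) *v oct_cnj (oct_mult a b)
    = oct_cnj (oct_mult (P *v a) b) + oct_cnj (oct_mult a (triality P *v b))"
proof -
  have "(triality (triality P) *v oct_cnj (oct_mult a b)) \<bullet> c
    = (oct_cnj (oct_mult (P *v a) b) + oct_cnj (oct_mult a (triality P *v b))) \<bullet> c" for c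
  proof -
    have "oct_form (P *v a) b c + oct_form a (triality P *v b) c + oct_form a b (triality (triality P) *v c) = 0"
      using triality_related_triality'[OF assms] by (simp add: triality_related_def)
    moreover have "(triality (triality P) *v oct_cnj (oct_mult a b)) \<bullet> c
        = - (oct_cnj (oct_mult a b) \<bullet> (triality (triality P) *v c))"
      by (intro so8_inner_skew triality_so8 assms)
    ultimately show ?thesis by (simp add: oct_form_def inner_add_left)
  qed
  then show ?thesis by (metis vector_eq_rdot)
qed

lemma triality_triality_wedge_mult:
  "triality (triality (wedge a b)) *v c = (1/2) *\<^sub>R (oct_mult (oct_mult c b) (oct_cnj a) - (a \<bullet> b) *\<^sub>R c)"
  by (simp add: triality_triality(1) wedge_so8 conj_oct_cnj_wedge conj_oct_cnj_mult triality_wedge_mult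
        oct_simps oct_cnj_mult oct_inner_cnj)

text \<open>On pure tensors the action is a sum over the two tensor factors, and each summand is an
  instance of \<open>triality_cnj_mult\<close>.\<close>

lemma Triality_act_mult_cnj:
  assumes "A \<in> so8_pair"
  shows "pair_act (Triality (Triality A)) (oo_mult_cnj u y)
    = oo_mult_cnj (pair_act A u) y + oo_mult_cnj u (pair_act (Triality A) y)" (is "?f u y = ?g u y")
proof -
  have f: "?f (oct_tensor a b) (oct_tensor c d) = ?g (oct_tensor a b) (oct_tensor c d)" for a b c d
  proof -
    have "fst A \<in> so8" "snd A \<in> so8" using assms by auto
    then show ?thesis
      by (simp add: oo_mult_cnj_oct_tensor pair_act_oct_tensor assms Triality_so8 linear_ops_simps
          oct_tensor_simps Triality_def triality_cnj_mult triality_so8)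
  qed
  have lin: "linear (\<lambda>u. ?f u x)" "linear (\<lambda>x. ?f u x)" "linear (\<lambda>u. ?g u x)" "linear (\<lambda>x. ?g u x)" for u x
    by (rule linearI; simp add: linear_ops_simps algebra_simps)+
  show ?thesis
    by (rule linear_eq_tensor[OF lin(1,3)], rule linear_eq_tensor[OF lin(2,4)], rule f)
qed

text \<open>On pure tensors the second product is rewritten in both tensor factors by the Clifford
  relation. Expanding, the term that is quadratic in the Clifford products cancels against the first
  product, and the mixed terms form the action of the curly wedge. The factor left over is 1/4,
  which is where the coefficient 4 in the bracket comes from.\<close>

lemma Triality_curly_wedge_act:
  "pair_act (Triality (curly_wedge u x)) y = (1/4) *\<^sub>R
    (oo_mult_cnj (oo_mult_cnj x y) u - oo_mult_cnj (oo_mult_cnj u y) x)" (is "?f u x y = ?g u x y")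
proof -
  have f: "?f (oct_tensor a b) (oct_tensor c d) (oct_tensor p q)
      = ?g (oct_tensor a b) (oct_tensor c d) (oct_tensor p q)" for a b c d p q
  proof -
    have *: "oct_mult (oct_cnj c) (oct_mult a p) = (2 * (a \<bullet> c)) *\<^sub>R p - oct_mult (oct_cnj a) (oct_mult c p)"
      for a c p using oct_left_polar[of a c p] by (simp add: eq_diff_eq add.commute)
    have "Triality (curly_wedge (oct_tensor a b) (oct_tensor c d)) \<in> so8_pair"
      by (intro Triality_so8 curly_wedge_so8)
    then show ?thesis
      by (simp add: oo_mult_cnj_oct_tensor pair_act_oct_tensor oct_cnj_mult *[of c a p] *[of d b q])
         (simp add: curly_wedge_oct_tensor Triality_def linear_scale[OF triality_linear] triality_wedge_mult
           scaleR_matrix_vector_assoc[symmetric] oct_tensor_simps, simp add: vec_eq_iff algebra_simps)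
  qed
  have lin: "linear (\<lambda>u. ?f u x y)" "linear (\<lambda>x. ?f u x y)" "linear (\<lambda>y. ?f u x y)"
    "linear (\<lambda>u. ?g u x y)" "linear (\<lambda>x. ?g u x y)" "linear (\<lambda>y. ?g u x y)" for u x y
    by (rule linearI; simp add: linear_ops_simps algebra_simps)+
  show ?thesis
    by (rule linear_eq_tensor[OF lin(1,4)], rule linear_eq_tensor[OF lin(2,5)],
        rule linear_eq_tensor[OF lin(3,6)], rule f)
qed

text \<open>The mirror image of \<open>Triality_curly_wedge_act\<close>: the second power of
  triality acts by right multiplications, and \<open>oct_right_polar\<close> takes the place of
  \<open>oct_left_polar\<close>.\<close>

lemma Triality_Triality_curly_wedge_act:
  "pair_act (Triality (Triality (curly_wedge u x))) z = (1/4) *\<^sub>R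
    (oo_mult_cnj u (oo_mult_cnj z x) - oo_mult_cnj x (oo_mult_cnj z u))" (is "?f u x z = ?g u x z")
proof -
  have f: "?f (oct_tensor a b) (oct_tensor c d) (oct_tensor p q)
      = ?g (oct_tensor a b) (oct_tensor c d) (oct_tensor p q)" for a b c d p q
  proof -
    have *: "oct_mult (oct_mult p a) (oct_cnj c) = (2 * (a \<bullet> c)) *\<^sub>R p - oct_mult (oct_mult p c) (oct_cnj a)"
      for a c p using oct_right_polar[of p a c] by (simp add: eq_diff_eq inner_commute add.commute)
    have "Triality (Triality (curly_wedge (oct_tensor a b) (oct_tensor c d))) \<in> so8_pair"
      by (intro Triality_so8 curly_wedge_so8)
    then show ?thesis
      by (simp add: oo_mult_cnj_oct_tensor pair_act_oct_tensor oct_cnj_mult *[of p a c] *[of q b d])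
         (simp add: curly_wedge_oct_tensor Triality_def linear_scale[OF triality_linear] triality_triality_wedge_mult
           scaleR_matrix_vector_assoc[symmetric] oct_tensor_simps, simp add: vec_eq_iff algebra_simps)
  qed
  have lin: "linear (\<lambda>u. ?f u x y)" "linear (\<lambda>x. ?f u x y)" "linear (\<lambda>y. ?f u x y)"
    "linear (\<lambda>u. ?g u x y)" "linear (\<lambda>x. ?g u x y)" "linear (\<lambda>y. ?g u x y)" for u x y
    by (rule linearI; simp add: linear_ops_simps algebra_simps)+
  show ?thesis
    by (rule linear_eq_tensor[OF lin(1,4)], rule linear_eq_tensor[OF lin(2,5)],
        rule linear_eq_tensor[OF lin(3,6)], rule f)
qed

lemma oo_mult_cnj_cyclic: "oo_mult_cnj u y \<bullet> z = oo_mult_cnj y z \<bullet> u" (is "?f u y z = ?g u y z")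
proof -
  have f: "?f (oct_tensor a b) (oct_tensor c d) (oct_tensor p q)
      = ?g (oct_tensor a b) (oct_tensor c d) (oct_tensor p q)" for a b c d p q
    using oct_form_cyclic[of a c p] oct_form_cyclic[of b d q]
    by (simp add: oo_mult_cnj_oct_tensor oct_tensor_inner oct_form_def)
  have lin: "linear (\<lambda>u. ?f u x y)" "linear (\<lambda>x. ?f u x y)" "linear (\<lambda>y. ?f u x y)"
    "linear (\<lambda>u. ?g u x y)" "linear (\<lambda>x. ?g u x y)" "linear (\<lambda>y. ?g u x y)" for u x y
    by (rule linearI; simp add: linear_ops_simps inner_add_left inner_add_right)+
  show ?thesis
    by (rule linear_eq_tensor[OF lin(1,4)], rule linear_eq_tensor[OF lin(2,5)],
        rule linear_eq_tensor[OF lin(3,6)], rule f)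
qed

text \<open>Up to the factor 2 the curly wedge is the moment map of the action. This duality
  transfers invariance statements from the action to the curly wedge.\<close>

lemma inner_curly_wedge:
  assumes "C \<in> so8_pair"
  shows "curly_wedge u x \<bullet> C = 2 * (u \<bullet> pair_act C x)" (is "?f u x = ?g u x")
proof -
  have f: "?f (oct_tensor a b) (oct_tensor c d) = ?g (oct_tensor a b) (oct_tensor c d)" for a b c d
  proof -
    have "C \<bullet> curly_wedge (oct_tensor a b) (oct_tensor c d) =
        2 * (oct_tensor a b \<bullet> pair_act C (oct_tensor c d))"
      using assms by (auto simp: curly_wedge_oct_tensor inner_prod_def inner_wedge pair_act_oct_tensor
        inner_add_right oct_tensor_inner)
    then show ?thesis by (simp only: inner_commute)
  qed
  have lin: "linear (\<lambda>u. ?f u x)" "linear (\<lambda>x. ?f u x)" "linear (\<lambda>u. ?g u x)" "linear (\<lambda>x. ?g u x)" for u x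
    by (rule linearI; simp add: linear_ops_simps inner_add_left inner_add_right)+
  show ?thesis
    by (rule linear_eq_tensor[OF lin(1,3)], rule linear_eq_tensor[OF lin(2,4)], rule f)
qed

lemma pair_act_skew:
  assumes "C \<in> so8_pair" shows "pair_act C u \<bullet> x = - (u \<bullet> pair_act C x)"
proof -
  have "curly_wedge x u = - curly_wedge u x" by (simp add: curly_wedge_def)
  then show ?thesis
    using inner_curly_wedge[OF assms, of u x] inner_curly_wedge[OF assms, of x u]
    by (simp add: inner_commute)
qed

text \<open>Testing against an arbitrary \<open>C\<close> turns this identity into the invariance
  \<open>Triality_act_mult_cnj\<close> of the cyclic trilinear form.\<close>

lemma curly_wedge_mult_cnj:
  "curly_wedge (oo_mult_cnj y z) u + Triality (Triality (curly_wedge (oo_mult_cnj z u) y))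
    + Triality (curly_wedge (oo_mult_cnj u y) z) = 0" (is "?W = 0")
proof -
  have W: "?W \<in> so8_pair"
    by (intro subspace_add[OF subspace_so8_pair] Triality_so8 curly_wedge_so8)
  have "?W \<bullet> C = 0" if C: "C \<in> so8_pair" for C
  proof -
    have "curly_wedge (oo_mult_cnj y z) u \<bullet> C = 2 * (oo_mult_cnj (pair_act C u) y \<bullet> z)"
      by (simp add: inner_curly_wedge C oo_mult_cnj_cyclic[of _ y z])
    moreover have "Triality (Triality (curly_wedge (oo_mult_cnj z u) y)) \<bullet> C
        = 2 * (oo_mult_cnj u (pair_act (Triality C) y) \<bullet> z)"
      by (simp add: inner_curly_wedge Triality_adjoint Triality_cube Triality_so8 curly_wedge_so8 C
          oo_mult_cnj_cyclic[of z u])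
    moreover have "Triality (curly_wedge (oo_mult_cnj u y) z) \<bullet> C
        = - (2 * (pair_act (Triality (Triality C)) (oo_mult_cnj u y) \<bullet> z))"
      by (simp add: inner_curly_wedge Triality_adjoint Triality_so8 curly_wedge_so8 C pair_act_skew)
    ultimately show ?thesis
      by (simp add: inner_add_left Triality_act_mult_cnj[OF C])
  qed
  from this[OF W] show ?thesis by simp
qed


section \<open>The Jacobi identity\<close>

lemma bracket_A_eq:
  "bracket_A (A, u, v, w) (B, x, y, z) =
    (pair_bracket A B - 4 *\<^sub>R curly_wedge u x
       - 4 *\<^sub>R Triality (Triality (curly_wedge v y)) - 4 *\<^sub>R Triality (curly_wedge w z),
     pair_act A x - pair_act B u + oo_mult_cnj v z - oo_mult_cnj y w,
     pair_act (Triality A) y - pair_act (Triality B) v + oo_mult_cnj w x - oo_mult_cnj z u,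
     pair_act (Triality (Triality A)) z - pair_act (Triality (Triality B)) w
       + oo_mult_cnj u y - oo_mult_cnj x v)"
  by (simp add: oo_mult_cnj_def)

declare bracket_A.simps [simp del]

definition rotate_A :: "alg_A \<Rightarrow> alg_A" where
  "rotate_A X = (case X of (A, u, v, w) \<Rightarrow> (Triality A, v, w, u))"

lemma space_A_iff: "(A, u, v, w) \<in> space_A \<longleftrightarrow> A \<in> so8_pair"
  by (auto simp: space_A_def)

lemma rotate_A_space: "X \<in> space_A \<Longrightarrow> rotate_A X \<in> space_A"
  by (cases X) (simp add: rotate_A_def space_A_iff Triality_so8 del: mem_Times_iff)

lemma rotate_A_cube: "X \<in> space_A \<Longrightarrow> rotate_A (rotate_A (rotate_A X)) = X"
  by (cases X) (simp add: rotate_A_def space_A_iff Triality_cube del: mem_Times_iff)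

lemma rotate_A_linear: "linear rotate_A"
  by (rule linearI) (simp_all add: rotate_A_def split_beta linear_ops_simps)

lemma rotate_A_bracket:
  assumes "X \<in> space_A" "Y \<in> space_A"
  shows "rotate_A (bracket_A X Y) = bracket_A (rotate_A X) (rotate_A Y)"
proof -
  obtain A u v w B x y z where XY: "X = (A, u, v, w)" "Y = (B, x, y, z)"
    by (metis prod_cases4)
  have "A \<in> so8_pair" "B \<in> so8_pair" using assms by (simp_all only: XY space_A_iff)
  then show ?thesis
    by (simp add: XY rotate_A_def bracket_A_eq linear_ops_simps Triality_bracket Triality_cube curly_wedge_so8
        del: mem_Times_iff)
qed

lemma bracket_A_space:
  assumes "X \<in> space_A" "Y \<in> space_A"
  shows "bracket_A X Y \<in> space_A"
proof -
  obtain A u v w B x y z where XY: "X = (A, u, v, w)" "Y = (B, x, y, z)"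
    by (metis prod_cases4)
  have "A \<in> so8_pair" "B \<in> so8_pair" using assms by (simp_all only: XY space_A_iff)
  then show ?thesis
    unfolding XY bracket_A_eq space_A_iff
    by (intro subspace_diff[OF subspace_so8_pair] subspace_scale[OF subspace_so8_pair] pair_bracket_so8
      Triality_so8 curly_wedge_so8)
qed

text \<open>The Jacobi identity of so(16) for three elements of its off-diagonal block. Expanded, it
  is a cancellation of triple matrix products.\<close>

lemma curly_wedge_act_cyclic:
  "pair_act (curly_wedge r u) x = - pair_act (curly_wedge u x) r - pair_act (curly_wedge x r) u"
  by (simp add: curly_wedge_def pair_act_def matrix_mul_simps matrix_mul_assoc)

lemma pair_act_bracket:
  "pair_act (pair_bracket A B) X = pair_act A (pair_act B X) - pair_act B (pair_act A X)"
  by (simp add: pair_act_def pair_bracket_def commutator_def matrix_mul_simps matrix_mul_assoc)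

lemma pair_bracket_cyclic:
  "pair_bracket (pair_bracket C A) B = - pair_bracket (pair_bracket A B) C - pair_bracket (pair_bracket B C) A"
  by (simp add: pair_bracket_def commutator_def matrix_mul_simps matrix_mul_assoc)

text \<open>A rotated form of \<open>Triality_act_mult_cnj\<close>: that lemma is applied to
  \<open>Triality C\<close>, and the third power of triality cancels.\<close>

lemma pair_act_mult_cnj:
  assumes "C \<in> so8_pair"
  shows "pair_act C (oo_mult_cnj v z)
    = oo_mult_cnj (pair_act (Triality C) v) z + oo_mult_cnj v (pair_act (Triality (Triality C)) z)"
  using Triality_act_mult_cnj[OF Triality_so8[OF assms]] by (simp only: Triality_cube[OF assms])

lemma pair_bracket_curly_wedge:
  assumes "C \<in> so8_pair"
  shows "pair_bracket (curly_wedge u x) C = curly_wedge (pair_act C x) u - curly_wedge (pair_act C u) x"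
proof -
  have "transpose (fst C) = - fst C" "transpose (snd C) = - snd C"
    using assms by (auto simp: so8_def)
  then show ?thesis
    by (simp add: pair_bracket_def commutator_def curly_wedge_def pair_act_def transpose_algebra
      matrix_transpose_mul matrix_mul_simps matrix_mul_assoc)
qed

text \<open>The equivariance of the curly wedge, transported by triality. For this \<open>C\<close>
  is written as the image of \<open>Triality (Triality C)\<close>, or as the second image of
  \<open>Triality C\<close>.\<close>

lemma pair_bracket_Triality_curly_wedge:
  assumes C: "C \<in> so8_pair"
  shows "pair_bracket (Triality (curly_wedge w z)) C =
      Triality (curly_wedge (pair_act (Triality (Triality C)) z) w)
      - Triality (curly_wedge (pair_act (Triality (Triality C)) w) z)" (is ?A)
    and "pair_bracket (Triality (Triality (curly_wedge v y))) C =
      Triality (Triality (curly_wedge (pair_act (Triality C) y) v))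
      - Triality (Triality (curly_wedge (pair_act (Triality C) v) y))" (is ?B)
proof -
  have "pair_bracket (Triality (curly_wedge w z)) C =
      Triality (pair_bracket (curly_wedge w z) (Triality (Triality C)))"
    by (simp only: Triality_bracket curly_wedge_so8 Triality_so8 Triality_cube C)
  then show ?A
    by (simp only: pair_bracket_curly_wedge Triality_so8 C linear_ops_simps)
  have "pair_bracket (Triality (Triality (curly_wedge v y))) C =
      Triality (Triality (pair_bracket (curly_wedge v y) (Triality C)))"
    by (simp only: Triality_bracket curly_wedge_so8 Triality_so8 Triality_cube C)
  then show ?B
    by (simp only: pair_bracket_curly_wedge Triality_so8 C linear_ops_simps)
qed

definition jacobiator_A :: "alg_A \<Rightarrow> alg_A \<Rightarrow> alg_A \<Rightarrow> alg_A" where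
  "jacobiator_A X Y Z = bracket_A (bracket_A X Y) Z + bracket_A (bracket_A Y Z) X + bracket_A (bracket_A Z X) Y"

lemma jacobiator_A_fst:
  assumes "X \<in> space_A" "Y \<in> space_A" "Z \<in> space_A"
  shows "fst (jacobiator_A X Y Z) = 0"
proof -
  obtain A u v w B x y z C r s t where XYZ: "X = (A, u, v, w)" "Y = (B, x, y, z)" "Z = (C, r, s, t)"
    by (metis prod_cases4)
  have S: "A \<in> so8_pair" "B \<in> so8_pair" "C \<in> so8_pair" using assms by (simp_all only: XYZ space_A_iff)
  \<comment> \<open>The identity \<open>curly_wedge_mult_cnj\<close> is solved for its untwisted
    term. The six instances below correspond to the six ways of taking one entry from each argument
    and from each copy of the oct-octonions; fixing them keeps the rewriting finite.\<close>
  have m: "curly_wedge (oo_mult_cnj b c) a = - Triality (Triality (curly_wedge (oo_mult_cnj c a) b))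
    - Triality (curly_wedge (oo_mult_cnj a b) c)" for a b c
    using curly_wedge_mult_cnj[of b c a] by (simp add: eq_diff_eq eq_neg_iff_add_eq_0 add_ac)
  show ?thesis
    by (simp add: XYZ jacobiator_A_def bracket_A_eq linear_ops_simps
        pair_bracket_cyclic[of C A B] pair_bracket_curly_wedge pair_bracket_Triality_curly_wedge S
        m[of v z r] m[of y w r] m[of y t u] m[of s z u] m[of s w x] m[of v t x]
        del: mem_Times_iff)
       (simp add: algebra_simps)
qed

lemma jacobiator_A_snd:
  assumes "X \<in> space_A" "Y \<in> space_A" "Z \<in> space_A"
  shows "fst (snd (jacobiator_A X Y Z)) = 0"
proof -
  obtain A u v w B x y z C r s t where XYZ: "X = (A, u, v, w)" "Y = (B, x, y, z)" "Z = (C, r, s, t)"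
    by (metis prod_cases4)
  have S: "A \<in> so8_pair" "B \<in> so8_pair" "C \<in> so8_pair" using assms by (simp_all only: XYZ space_A_iff)
  show ?thesis
    by (simp add: XYZ jacobiator_A_def bracket_A_eq linear_ops_simps
        pair_act_mult_cnj pair_act_bracket curly_wedge_act_cyclic[of r u x]
        Triality_curly_wedge_act Triality_Triality_curly_wedge_act S
        del: mem_Times_iff)
       (simp add: algebra_simps)
qed

lemma jacobiator_A:
  assumes "X \<in> space_A" "Y \<in> space_A" "Z \<in> space_A"
  shows "jacobiator_A X Y Z = 0"
proof -
  have rot: "rotate_A (jacobiator_A X Y Z) = jacobiator_A (rotate_A X) (rotate_A Y) (rotate_A Z)"
    if "X \<in> space_A" "Y \<in> space_A" "Z \<in> space_A" for X Y Z
    using that by (simp add: jacobiator_A_def linear_add[OF rotate_A_linear] rotate_A_bracket bracket_A_space)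
  \<comment> \<open>The second components of the jacobiators of the once and twice rotated arguments
    are the third and fourth components of the original one.\<close>
  note * = jacobiator_A_snd[OF assms] jacobiator_A_fst[OF assms]
    jacobiator_A_snd[OF assms[THEN rotate_A_space]]
    jacobiator_A_snd[OF assms[THEN rotate_A_space, THEN rotate_A_space]]
  show ?thesis
    using * by (cases "jacobiator_A X Y Z")
      (simp add: rot[symmetric] assms rotate_A_space, simp add: rotate_A_def zero_prod_def)
qed

lemma subspace_space_A: "subspace space_A"
  unfolding space_A_def by (intro subspace_Times subspace_so8 subspace_UNIV)

lemma bracket_A_linear: "linear (bracket_A X)" "linear (\<lambda>X. bracket_A X Y)"
proof -
  obtain A u v w where X: "X = (A, u, v, w)" by (metis prod_cases4)
  show "linear (bracket_A X)"
  proof (rule linearI)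
    fix Y Z :: alg_A and c :: real
    obtain B x y z C r s t where YZ: "Y = (B, x, y, z)" "Z = (C, r, s, t)" by (metis prod_cases4)
    show "bracket_A X (Y + Z) = bracket_A X Y + bracket_A X Z" "bracket_A X (c *\<^sub>R Y) = c *\<^sub>R bracket_A X Y"
      by (simp_all add: X YZ bracket_A_eq linear_ops_simps algebra_simps)
  qed
  obtain B x y z where Y: "Y = (B, x, y, z)" by (metis prod_cases4)
  show "linear (\<lambda>X. bracket_A X Y)"
  proof (rule linearI)
    fix X Z :: alg_A and c :: real
    obtain A u v w C r s t where XZ: "X = (A, u, v, w)" "Z = (C, r, s, t)" by (metis prod_cases4)
    show "bracket_A (X + Z) Y = bracket_A X Y + bracket_A Z Y" "bracket_A (c *\<^sub>R X) Y = c *\<^sub>R bracket_A X Y"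
      by (simp_all add: XZ Y bracket_A_eq linear_ops_simps algebra_simps)
  qed
qed

lemma bracket_A_skew: "bracket_A X Y = - bracket_A Y X"
proof -
  obtain A u v w B x y z where XY: "X = (A, u, v, w)" "Y = (B, x, y, z)" by (metis prod_cases4)
  have "curly_wedge u x = - curly_wedge x u" "pair_bracket A B = - pair_bracket B A" for u x A B
    by (simp_all add: curly_wedge_def pair_bracket_def commutator_def)
  note * = this(1)[of u x] this(1)[of v y] this(1)[of w z] this(2)[of A B]
  show ?thesis
    unfolding XY bracket_A_eq * by (simp add: linear_ops_simps algebra_simps)
qed

lemma real_lie_algebra_A: "real_lie_algebra space_A bracket_A"
  unfolding real_lie_algebra_def
proof (intro conjI)
  show "bilinear_on space_A bracket_A"
    by (simp add: bilinear_on_def linear_add[OF bracket_A_linear(1)] linear_add[OF bracket_A_linear(2)]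
      linear_scale[OF bracket_A_linear(1)] linear_scale[OF bracket_A_linear(2)])
  show "skew_symmetric_on space_A bracket_A"
    unfolding skew_symmetric_on_def using bracket_A_skew by blast
  show "jacobi_on space_A bracket_A"
    unfolding jacobi_on_def using jacobiator_A[unfolded jacobiator_A_def] by blast
qed (auto simp: subspace_space_A bracket_A_space)


section \<open>The invariant inner product\<close>

text \<open>The weight 1/8 balances the coefficient 4 in the bracket against the factor 2 in
  \<open>inner_curly_wedge\<close>.\<close>

definition form_A :: "alg_A \<Rightarrow> alg_A \<Rightarrow> real" where
  "form_A X Y = (1/8) * (fst X \<bullet> fst Y) + snd X \<bullet> snd Y"

lemma matrix_mul_inner:
  fixes P :: "real^'k^'m" and Q :: "real^'n^'k"
  shows "(P ** Q) \<bullet> R = P \<bullet> (R ** transpose Q)" "(P ** Q) \<bullet> R = Q \<bullet> (transpose P ** R)"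
proof -
  have "(\<Sum>i\<in>UNIV. \<Sum>j\<in>UNIV. \<Sum>k\<in>UNIV. P$i$k * Q$k$j * R$i$j)
    = (\<Sum>i\<in>UNIV. \<Sum>k\<in>UNIV. \<Sum>j\<in>UNIV. P$i$k * Q$k$j * R$i$j)"
    by (rule sum.cong[OF refl], rule sum.swap)
  then show "(P ** Q) \<bullet> R = P \<bullet> (R ** transpose Q)"
    by (simp add: inner_matrix matrix_matrix_mult_def transpose_def sum_distrib_left sum_distrib_right mult_ac)
  have "(\<Sum>i\<in>UNIV. \<Sum>j\<in>UNIV. \<Sum>k\<in>UNIV. P$i$k * Q$k$j * R$i$j)
    = (\<Sum>i\<in>UNIV. \<Sum>k\<in>UNIV. \<Sum>j\<in>UNIV. P$i$k * Q$k$j * R$i$j)"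
    by (rule sum.cong[OF refl], rule sum.swap)
  also have "\<dots> = (\<Sum>k\<in>UNIV. \<Sum>i\<in>UNIV. \<Sum>j\<in>UNIV. P$i$k * Q$k$j * R$i$j)"
    by (rule sum.swap)
  also have "\<dots> = (\<Sum>k\<in>UNIV. \<Sum>j\<in>UNIV. \<Sum>i\<in>UNIV. P$i$k * Q$k$j * R$i$j)"
    by (rule sum.cong[OF refl], rule sum.swap)
  finally show "(P ** Q) \<bullet> R = Q \<bullet> (transpose P ** R)"
    by (simp add: inner_matrix matrix_matrix_mult_def transpose_def sum_distrib_left sum_distrib_right mult_ac)
qed

lemma commutator_inner:
  fixes P Q R :: "real^'n^'n"
  assumes "transpose Q = - Q" shows "commutator P Q \<bullet> R = P \<bullet> commutator Q R"
  using assms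
  by (simp add: commutator_def inner_diff_left inner_diff_right matrix_mul_inner(1)[of P Q]
      matrix_mul_inner(2)[of Q P] matrix_mul_minus)

lemma pair_bracket_inner: "B \<in> so8_pair \<Longrightarrow> pair_bracket A B \<bullet> C = A \<bullet> pair_bracket B C"
  by (auto simp: pair_bracket_def inner_prod_def commutator_inner so8_def)

text \<open>The terms match by type: \<open>pair_bracket_inner\<close> for three elements of so(8) +
  so(8), \<open>inner_curly_wedge\<close> for one such element with two from the same copy of the
  oct-octonions, and \<open>oo_mult_cnj_cyclic\<close> for one element from each copy.\<close>

lemma form_A_invariant:
  assumes "X \<in> space_A" "Y \<in> space_A" "Z \<in> space_A"
  shows "form_A (bracket_A X Y) Z = form_A X (bracket_A Y Z)"
proof -
  obtain A u v w B x y z C r s t where XYZ: "X = (A, u, v, w)" "Y = (B, x, y, z)" "Z = (C, r, s, t)"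
    by (metis prod_cases4)
  have S: "A \<in> so8_pair" "B \<in> so8_pair" "C \<in> so8_pair" using assms by (simp_all only: XYZ space_A_iff)
  have c: "curly_wedge a b \<bullet> C = 2 * (a \<bullet> pair_act C b)"
    "Triality (curly_wedge a b) \<bullet> C = 2 * (a \<bullet> pair_act (Triality (Triality C)) b)"
    "Triality (Triality (curly_wedge a b)) \<bullet> C = 2 * (a \<bullet> pair_act (Triality C) b)"
    if "C \<in> so8_pair" for C a b
    using that by (simp_all add: inner_curly_wedge Triality_adjoint Triality_cube Triality_so8 curly_wedge_so8
       del: mem_Times_iff)
  have c': "A \<bullet> curly_wedge a b = 2 * (a \<bullet> pair_act A b)"
    "A \<bullet> Triality (curly_wedge a b) = 2 * (a \<bullet> pair_act (Triality (Triality A)) b)"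
    "A \<bullet> Triality (Triality (curly_wedge a b)) = 2 * (a \<bullet> pair_act (Triality A) b)" for a b
    using c[OF S(1), of a b] by (simp_all only: inner_commute)
  have k: "pair_act C a \<bullet> b = - (a \<bullet> pair_act C b)" if "C \<in> so8_pair" for C a b
    by (rule pair_act_skew[OF that])
  have m: "oo_mult_cnj a b \<bullet> d = d \<bullet> oo_mult_cnj a b" for a b d by (rule inner_commute)
  note cy = oo_mult_cnj_cyclic[unfolded m]
  show ?thesis
    by (simp add: XYZ form_A_def bracket_A_eq inner_add_left inner_diff_left inner_add_right inner_diff_right
      c[OF S(3)] c' k[OF S(1)] k[OF S(2)] k[OF Triality_so8[OF S(1)]] k[OF Triality_so8[OF S(2)]]
      k[OF Triality_so8[OF Triality_so8[OF S(1)]]] k[OF Triality_so8[OF Triality_so8[OF S(2)]]]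
      pair_bracket_inner[OF S(2)] m
      cy[of v z r] cy[of z r v] cy[of y w r] cy[of w r y] cy[of w x s] cy[of x s w] cy[of z u s] cy[of u s z]
      cy[of u y t] cy[of y t u] cy[of x v t] cy[of v t x])
      (simp add: field_simps inner_commute)
qed


section \<open>Simplicity\<close>

lemma oo_mult_cnj_unit:
  "oo_mult_cnj u (oct_tensor (oct_unit 0) (oct_unit 0)) = oo_cnj u"
  "oo_mult_cnj (oct_tensor (oct_unit 0) (oct_unit 0)) u = oo_cnj u"
proof -
  show "oo_mult_cnj u (oct_tensor (oct_unit 0) (oct_unit 0)) = oo_cnj u"
    by (rule linear_eq_tensor[OF oo_mult_cnj_linear(2) oo_cnj_linear])
       (simp add: oo_mult_cnj_oct_tensor oct_mult_unit_table oo_cnj_tensor)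
  show "oo_mult_cnj (oct_tensor (oct_unit 0) (oct_unit 0)) u = oo_cnj u"
    by (rule linear_eq_tensor[OF oo_mult_cnj_linear(1) oo_cnj_linear])
       (simp add: oo_mult_cnj_oct_tensor oct_mult_unit_table oo_cnj_tensor)
qed

lemma oo_cnj_cnj [simp]: "oo_cnj (oo_cnj X) = X"
  by (simp add: vec_eq_iff oo_cnj_nth)

lemma oo_cnj_0 [simp]: "oo_cnj 0 = 0"
  by (rule linear_0[OF oo_cnj_linear])

lemma oo_cnj_eq_0_iff [simp]: "oo_cnj X = 0 \<longleftrightarrow> X = 0"
  by (metis oo_cnj_cnj oo_cnj_0)

lemma subspace_tensor_UNIV:
  assumes "subspace J" "\<And>i j. oct_tensor (oct_unit i) (oct_unit j) \<in> J"
  shows "J = UNIV"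
proof -
  have "X \<in> J" for X
  proof -
    have "X $ p $ q = (\<Sum>i\<in>UNIV. \<Sum>j\<in>UNIV. X $ i $ j *\<^sub>R oct_tensor (oct_unit i) (oct_unit j)) $ p $ q" for p q
    proof -
      have "(\<Sum>i\<in>UNIV. \<Sum>j\<in>UNIV. X $ i $ j *\<^sub>R oct_tensor (oct_unit i) (oct_unit j)) $ p $ q
        = (\<Sum>i\<in>UNIV. if i = p then \<Sum>j\<in>UNIV. if j = q then X $ i $ j else 0 else 0)"
        unfolding sum_component
        by (intro sum.cong refl) (auto simp: oct_tensor_def oct_unit_nth intro!: sum.neutral sum.cong
            simp del: sum.delta sum.delta')
      then show ?thesis by simp
    qed
    then have "X = (\<Sum>i\<in>UNIV. \<Sum>j\<in>UNIV. X $ i $ j *\<^sub>R oct_tensor (oct_unit i) (oct_unit j))"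
      unfolding vec_eq_iff by blast
    also have "\<dots> \<in> J"
      using assms by (intro subspace_sum subspace_scale) auto
    finally show ?thesis .
  qed
  then show ?thesis by auto
qed

lemma exists_third: "\<exists>k :: 8. k \<noteq> i \<and> k \<noteq> j"
proof -
  have "card {i, j} < CARD(8)" by (cases "i = j") auto
  then have "{i, j} \<noteq> UNIV" by (metis less_irrefl)
  then show ?thesis by auto
qed

text \<open>Products of elements of \<open>so(8)\<close> contain all matrix units.\<close>

lemma irreducible_pair_act:
  assumes J: "subspace J" and act: "\<And>C u. C \<in> so8_pair \<Longrightarrow> u \<in> J \<Longrightarrow> pair_act C u \<in> J"
    and u: "u \<in> J" "u \<noteq> 0"
  shows "J = UNIV"
proof -
  let ?E = "\<lambda>i j. oct_tensor (oct_unit i) (oct_unit j)"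
  have z: "(0 :: mat8) \<in> so8" by (rule subspace_0[OF subspace_so8])
  have uu: "oct_unit i \<bullet> oct_unit j = (if i = j then 1 else 0)" for i j :: 8
    by (simp add: inner_axis_axis)
  have left: "P ** x \<in> J" if "P \<in> so8" "x \<in> J" for P x
    using act[of "(P, 0)" x] that z by (simp add: pair_act_def)
  have right: "x ** P \<in> J" if "P \<in> so8" "x \<in> J" for P x
    using act[of "(0, - P)" x] that z subspace_neg[OF subspace_so8] by (simp add: pair_act_def matrix_mul_minus)
  have E: "?E i k = wedge (oct_unit i) (oct_unit j) ** wedge (oct_unit j) (oct_unit k)"
    if "j \<noteq> i" "j \<noteq> k" "i \<noteq> k" for i j k
    using that by (simp add: wedge_def matrix_mul_simps oct_tensor_matrix_mult uu)
  have EE: "?E i j ** ?E j k = ?E i k" for i j k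
    by (simp add: oct_tensor_matrix_mult uu)
  have l1: "?E i k ** x \<in> J" if "x \<in> J" "i \<noteq> k" for i k x
  proof -
    obtain j where "j \<noteq> i" "j \<noteq> k" using exists_third by blast
    then show ?thesis
      using that by (subst E[of j]) (auto simp: matrix_mul_assoc[symmetric] intro!: left wedge_so8)
  qed
  \<comment> \<open>A product of two wedges gives only the off-diagonal matrix units. A diagonal
    unit is reached as a product of two off-diagonal ones.\<close>
  have l: "?E i k ** x \<in> J" if x: "x \<in> J" for i k x
  proof -
    obtain j where j: "j \<noteq> i" "j \<noteq> k" using exists_third by blast
    have "?E i k ** x = ?E i j ** (?E j k ** x)" by (simp add: EE matrix_mul_assoc)
    then show ?thesis using j x by (auto intro!: l1)
  qed
  have r1: "x ** ?E i k \<in> J" if "x \<in> J" "i \<noteq> k" for i k x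
  proof -
    obtain j where "j \<noteq> i" "j \<noteq> k" using exists_third by blast
    then show ?thesis
      using that by (subst E[of j]) (auto simp: matrix_mul_assoc intro!: right wedge_so8)
  qed
  have r: "x ** ?E i k \<in> J" if x: "x \<in> J" for i k x
  proof -
    obtain j where j: "j \<noteq> i" "j \<noteq> k" using exists_third by blast
    have "x ** ?E i k = (x ** ?E i j) ** ?E j k" by (simp add: EE matrix_mul_assoc[symmetric])
    then show ?thesis using j x by (auto intro!: r1)
  qed
  obtain k l where kl: "u $ k $ l \<noteq> 0" using u(2) by (auto simp: vec_eq_iff)
  have "?E i j \<in> J" for i j
  proof -
    have "?E i k ** u ** ?E l j = (u $ k $ l) *\<^sub>R ?E i j"
      by (simp add: vec_eq_iff matrix_matrix_mult_def oct_tensor_def oct_unit_nth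
        if_distrib[of "\<lambda>x. x * _"] if_distrib[of "\<lambda>x. _ * x"] cong: if_cong)
    then have "(u $ k $ l) *\<^sub>R ?E i j \<in> J" using l r u(1) by metis
    then have "(1 / u $ k $ l) *\<^sub>R ((u $ k $ l) *\<^sub>R ?E i j) \<in> J" by (rule subspace_scale[OF J])
    then show ?thesis using kl by simp
  qed
  then show ?thesis by (rule subspace_tensor_UNIV[OF J])
qed

text \<open>\<open>ad(h)\<^sup>2 + 1\<close> for \<open>h = 2 e\<^sub>0 \<and> e\<^sub>1\<close> in the first factor separates the three copies of
  \<open>O \<otimes> O\<close>: on the vector representation \<open>h\<close> has eigenvalues \<open>0, \<plusminus>2i\<close>, on the two spin
  representations only \<open>\<plusminus>i\<close>.\<close>

definition spin_elt :: "mat8 \<times> mat8" where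
  "spin_elt = (2 *\<^sub>R wedge (oct_unit 0) (oct_unit 1), 0)"

lemma spin_elt_so8: "spin_elt \<in> so8_pair"
  by (auto simp: spin_elt_def intro!: subspace_scale[OF subspace_so8] wedge_so8 subspace_0[OF subspace_so8])

lemma spin_elt_act:
  "pair_act (Triality spin_elt) (pair_act (Triality spin_elt) X) = - X"
  "pair_act (Triality (Triality spin_elt)) (pair_act (Triality (Triality spin_elt)) X) = - X"
  "pair_act spin_elt (pair_act spin_elt X) + X = 0 \<longleftrightarrow> X = 0"
proof -
  have ac: "pair_act (P, 0) X = P ** X" for P X by (simp add: pair_act_def)
  have cu: "oct_cnj (oct_unit 0) = oct_unit 0" by (simp add: oct_cnj_unit)
  have o: "oct_unit 0 \<bullet> oct_unit (1::8) = 0" by (simp add: inner_axis_axis)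
  define P where "P = 2 *\<^sub>R wedge (oct_unit 0) (oct_unit 1)"
  have s: "spin_elt = (P, 0)" "Triality spin_elt = (triality P, 0)"
    "Triality (Triality spin_elt) = (triality (triality P), 0)"
    by (simp_all add: spin_elt_def Triality_def P_def linear_0[OF triality_linear])
  \<comment> \<open>On the two spin representations the element acts as left and as right
    multiplication by \<open>oct_unit 1\<close>, and both maps square to minus the identity.\<close>
  have "triality P *v c = oct_mult (oct_unit 1) c" for c
    by (simp add: P_def linear_scale[OF triality_linear] scaleR_matrix_vector_assoc[symmetric]
        triality_wedge_mult cu o oct_mult_unit_table)
  then have "triality P ** triality P = - mat 1"
    by (simp add: matrix_eq matrix_vector_simps oct_alternative oct_mult_unit_table oct_simps)
  then show "pair_act (Triality spin_elt) (pair_act (Triality spin_elt) X) = - X"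
    by (simp add: s(2) ac matrix_mul_assoc matrix_mul_minus)
  have "triality (triality P) *v c = oct_mult c (oct_unit 1)" for c
    by (simp add: P_def linear_scale[OF triality_linear] scaleR_matrix_vector_assoc[symmetric]
        triality_triality_wedge_mult cu o oct_mult_unit_table)
  then have "triality (triality P) ** triality (triality P) = - mat 1"
    by (simp add: matrix_eq matrix_vector_simps oct_alternative oct_mult_unit_table oct_simps)
  then show "pair_act (Triality (Triality spin_elt)) (pair_act (Triality (Triality spin_elt)) X) = - X"
    by (simp add: s(3) ac matrix_mul_assoc matrix_mul_minus)
  have i: "c = 0" if "P *v (P *v c) + c = 0" for c
  proof -
    have Pc: "P *v c = 2 *\<^sub>R (c $ 1 *\<^sub>R oct_unit 0 - c $ 0 *\<^sub>R oct_unit 1)" for c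
      by (simp add: P_def scaleR_matrix_vector_assoc[symmetric] wedge_mult inner_axis')
    have "P *v (P *v c) = - 4 *\<^sub>R (c $ 0 *\<^sub>R oct_unit 0 + c $ 1 *\<^sub>R oct_unit 1)"
      unfolding Pc[of "P *v c"] by (simp add: Pc oct_unit_nth algebra_simps)
    then have e: "(- 4 *\<^sub>R (c $ 0 *\<^sub>R oct_unit 0 + c $ 1 *\<^sub>R oct_unit 1) + c) $ i = 0" for i
      using that by simp
    have "c $ 0 = 0" "c $ 1 = 0" using e[of 0] e[of 1] by (simp_all add: oct_unit_nth)
    then have "c $ i = 0" for i using e[of i] by simp
    then show ?thesis by (simp add: vec_eq_iff)
  qed
  have "X = 0" if X: "P ** (P ** X) + X = 0"
  proof -
    have "X *v x = 0" for x
    proof (rule i)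
      have "P *v (P *v (X *v x)) + X *v x = (P ** (P ** X) + X) *v x"
        by (simp add: matrix_vector_simps)
      then show "P *v (P *v (X *v x)) + X *v x = 0" using X by simp
    qed
    then show ?thesis by (simp add: matrix_eq)
  qed
  then show "pair_act spin_elt (pair_act spin_elt X) + X = 0 \<longleftrightarrow> X = 0"
    by (auto simp: s(1) ac)
qed

text \<open>A pair acting by zero is orthogonal to all curly wedges. Tensors with the common factor
  \<open>oct_unit 0\<close> isolate a single wedge in either component, because the wedge of a
  vector with itself vanishes; and wedges span so(8).\<close>

lemma pair_act_faithful:
  assumes "A \<in> so8_pair" "\<And>x. pair_act A x = 0" shows "A = 0"
proof -
  have "A \<bullet> curly_wedge u x = 0" for u x
    using inner_curly_wedge[OF assms(1), of u x] by (simp add: assms(2) inner_commute)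
  note o = this[of "oct_tensor _ (oct_unit 0)" "oct_tensor _ (oct_unit 0)"]
    this[of "oct_tensor (oct_unit 0) _" "oct_tensor (oct_unit 0) _"]
  have "wedge x x = 0" for x by (simp add: wedge_def)
  then have o: "fst A \<bullet> wedge a c = 0" "snd A \<bullet> wedge a c = 0" for a c
    using o[of a c] by (simp_all add: curly_wedge_oct_tensor inner_prod_def inner_axis_axis)
  have "P \<bullet> Q = 0" if "\<And>a c. P \<bullet> wedge a c = 0" "Q \<in> so8" for P Q
    by (rule linear_eq_on_so8[where g = "\<lambda>_. 0", OF _ _ _ that(2)])
       (simp_all add: that(1) linear_iff inner_add_right)
  then have "fst A \<bullet> fst A = 0" "snd A \<bullet> snd A = 0" using o assms(1) by (metis mem_Times_iff)+
  then show ?thesis by (simp add: prod_eq_iff)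
qed

text \<open>Bracketing with the unit tensor of one copy of the oct-octonions carries a second copy
  to the third by conjugation, up to sign. A nonzero entry can therefore be moved to the first copy,
  isolated with the help of \<open>spin_elt\<close>, spread over that copy by irreducibility, and
  distributed over all summands.\<close>

lemma simple_lie_algebra_A: "simple_lie_algebra space_A bracket_A"
  unfolding simple_lie_algebra_def
proof (intro conjI allI impI)
  let ?one = "oct_tensor (oct_unit 0) (oct_unit 0)"
  have one: "?one $ 0 $ 0 = 1" by (simp add: oct_tensor_def oct_unit_nth)
  then have one0: "?one \<noteq> 0" by (metis zero_index zero_neq_one)
  have z: "0 \<in> so8_pair" by (rule subspace_0[OF subspace_so8_pair])
  show "real_lie_algebra space_A bracket_A" by (rule real_lie_algebra_A)
  have "bracket_A (0, ?one, 0, 0) (0, 0, ?one, 0) = (0, 0, 0, oo_cnj ?one)"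
    by (simp add: bracket_A_eq linear_ops_simps oo_mult_cnj_unit)
  then have "bracket_A (0, ?one, 0, 0) (0, 0, ?one, 0) \<noteq> 0"
    using one0 by (simp add: zero_prod_def)
  moreover have "(0, ?one, 0, 0) \<in> space_A" "(0, 0, ?one, 0) \<in> space_A"
    using z by (simp_all only: space_A_iff)
  ultimately show "\<exists>x\<in>space_A. \<exists>y\<in>space_A. bracket_A x y \<noteq> 0"
    by blast
  fix I assume "lie_ideal space_A bracket_A I"
  then have I: "subspace I" "I \<subseteq> space_A" and br: "\<And>X Y. X \<in> space_A \<Longrightarrow> Y \<in> I \<Longrightarrow> bracket_A X Y \<in> I"
    by (auto simp: lie_ideal_def)
  have br': "bracket_A Y X \<in> I" if "X \<in> space_A" "Y \<in> I" for X Y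
    using br[OF that] subspace_neg[OF I(1)] bracket_A_skew by metis
  show "I = {0} \<or> I = space_A"
  proof (cases "I = {0}")
    case False
    then obtain X where "X \<in> I" "X \<noteq> 0" using subspace_0[OF I(1)] by blast
    moreover obtain A u v w where "X = (A, u, v, w)" by (metis prod_cases4)
    ultimately have X: "(A, u, v, w) \<in> I" "(A, u, v, w) \<noteq> 0" by simp_all
    have A: "A \<in> so8_pair" using X(1) I(2) space_A_iff by blast
    have "\<exists>X\<in>I. fst (snd X) \<noteq> 0"
    proof -
      consider "u \<noteq> 0" | "u = 0" "v \<noteq> 0" | "u = 0" "v = 0" "w \<noteq> 0" | "u = 0" "v = 0" "w = 0" "A \<noteq> 0"
        using X(2) by (auto simp: zero_prod_def)
      then show ?thesis
      proof cases
        case 1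
        then show ?thesis by (intro bexI[OF _ X(1)]) simp
      next
        case 2
        have "bracket_A (A, u, v, w) (0, 0, 0, ?one) \<in> I"
          using X(1) z by (intro br') (simp_all add: space_A_iff del: mem_Times_iff)
        then show ?thesis
          by (rule bexI[rotated]) (simp add: 2 bracket_A_eq linear_ops_simps oo_mult_cnj_unit)
      next
        case 3
        have "bracket_A (A, u, v, w) (0, 0, ?one, 0) \<in> I"
          using X(1) z by (intro br') (simp_all add: space_A_iff del: mem_Times_iff)
        then show ?thesis
          by (rule bexI[rotated]) (simp add: 3 bracket_A_eq linear_ops_simps oo_mult_cnj_unit)
      next
        case 4
        then obtain x where x: "pair_act A x \<noteq> 0" using pair_act_faithful[OF A] by blast
        have "bracket_A (A, u, v, w) (0, x, 0, 0) \<in> I"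
          using X(1) z by (intro br') (simp_all add: space_A_iff del: mem_Times_iff)
        then show ?thesis
          by (rule bexI[rotated]) (use 4 x in \<open>simp add: bracket_A_eq linear_ops_simps\<close>)
      qed
    qed
    then obtain A u v w where X: "(A, u, v, w) \<in> I" "u \<noteq> 0" by auto
    have sq: "bracket_A (H, 0, 0, 0) (bracket_A (H, 0, 0, 0) X) + X \<in> I" if "X \<in> I" "H \<in> so8_pair" for X H
      using that by (intro subspace_add[OF I(1)] br) (simp_all add: space_A_iff del: mem_Times_iff)
    have "\<exists>Y\<in>I. fst (snd Y) \<noteq> 0 \<and> snd (snd Y) = 0"
      by (rule bexI[OF _ sq[OF X(1) spin_elt_so8]])
        (simp add: X(2) bracket_A_eq linear_ops_simps spin_elt_act zero_prod_def)
    then obtain A u where X: "(A, u, 0, 0) \<in> I" "u \<noteq> 0" by (auto simp: zero_prod_def)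
    have "bracket_A (A, u, 0, 0) (0, 0, ?one, 0) \<in> I"
      using X(1) z by (intro br') (simp_all add: space_A_iff del: mem_Times_iff)
    then have "(0, 0, pair_act (Triality A) ?one, oo_cnj u) \<in> I"
      by (simp add: bracket_A_eq linear_ops_simps oo_mult_cnj_unit)
    \<comment> \<open>The twisted element acts on the fourth component as \<open>spin_elt\<close>
      itself and on the third as \<open>Triality (Triality spin_elt)\<close>. So the third component
      is annihilated and the fourth stays nonzero.\<close>
    note sq[OF this Triality_so8[OF spin_elt_so8]]
    then have "\<exists>Y\<in>I. fst Y = 0 \<and> fst (snd Y) = 0 \<and> fst (snd (snd Y)) = 0 \<and> snd (snd (snd Y)) \<noteq> 0"
      by (rule bexI[rotated])
        (simp add: X(2) bracket_A_eq linear_ops_simps spin_elt_act Triality_cube[OF spin_elt_so8])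
    then obtain w where w: "(0, 0, 0, w) \<in> I" "w \<noteq> 0" by auto
    have "bracket_A (0, 0, 0, w) (0, 0, ?one, 0) \<in> I"
      using w(1) z by (intro br') (simp_all add: space_A_iff del: mem_Times_iff)
    then have w': "(0, - oo_cnj w, 0, 0) \<in> I"
      by (simp add: bracket_A_eq linear_ops_simps oo_mult_cnj_unit)
    let ?J = "{u. (0, u, 0, 0) \<in> I}"
    have "?J = UNIV"
    proof (rule irreducible_pair_act)
      have l: "linear (\<lambda>u::mat8. (0::mat8\<times>mat8, u, 0::mat8, 0::mat8))" by (rule linearI) simp_all
      show "subspace ?J" using linear_subspace_vimage[OF l I(1)] by (simp add: vimage_def)
      show "- oo_cnj w \<in> ?J" using w' by simp
      show "- oo_cnj w \<noteq> 0" using w(2) by simp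
      fix C u assume "C \<in> so8_pair" "u \<in> ?J"
      then have "bracket_A (C, 0, 0, 0) (0, u, 0, 0) \<in> I"
        by (intro br) (simp_all add: space_A_iff del: mem_Times_iff)
      then show "pair_act C u \<in> ?J"
        by (simp add: bracket_A_eq linear_ops_simps)
    qed
    then have J1: "(0, u, 0, 0) \<in> I" for u by blast
    have J3: "(0, 0, 0, u) \<in> I" for u
    proof -
      have "bracket_A (0, oo_cnj u, 0, 0) (0, 0, ?one, 0) \<in> I"
        using J1 z by (intro br') (simp_all add: space_A_iff del: mem_Times_iff)
      then show ?thesis by (simp add: bracket_A_eq linear_ops_simps oo_mult_cnj_unit)
    qed
    have J2: "(0, 0, u, 0) \<in> I" for u
    proof -
      have "bracket_A (0, - oo_cnj u, 0, 0) (0, 0, 0, ?one) \<in> I"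
        using J1 z by (intro br') (simp_all add: space_A_iff del: mem_Times_iff)
      then show ?thesis by (simp add: bracket_A_eq linear_ops_simps oo_mult_cnj_unit linear_neg[OF oo_cnj_linear])
    qed
    have ww: "wedge x x = 0" for x by (simp add: wedge_def)
    have C: "(curly_wedge a b, 0, 0, 0) \<in> I" for a b
    proof -
      have "(- 1/4) *\<^sub>R bracket_A (0, a, 0, 0) (0, b, 0, 0) \<in> I"
        using J1 z by (intro subspace_scale[OF I(1)] br') (simp_all add: space_A_iff del: mem_Times_iff)
      then show ?thesis by (simp add: bracket_A_eq linear_ops_simps)
    qed
    have l: "linear (\<lambda>P. ((P, 0), 0, 0, 0) :: alg_A)" "linear (\<lambda>P. ((0, P), 0, 0, 0) :: alg_A)"
      by (rule linearI; simp)+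
    have "range (\<lambda>(x, y). wedge x y) \<subseteq> (\<lambda>P. ((P, 0), 0, 0, 0)) -` I"
      using C[of "oct_tensor _ (oct_unit 0)" "oct_tensor _ (oct_unit 0)"]
      by (auto simp: curly_wedge_oct_tensor ww inner_axis_axis)
    then have K1: "((P, 0), 0, 0, 0) \<in> I" if "P \<in> so8" for P
      using span_minimal[OF _ linear_subspace_vimage[OF l(1) I(1)]] that by (auto simp: so8_span)
    have "range (\<lambda>(x, y). wedge x y) \<subseteq> (\<lambda>P. ((0, P), 0, 0, 0)) -` I"
      using C[of "oct_tensor (oct_unit 0) _" "oct_tensor (oct_unit 0) _"]
      by (auto simp: curly_wedge_oct_tensor ww inner_axis_axis)
    then have K2: "((0, P), 0, 0, 0) \<in> I" if "P \<in> so8" for P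
      using span_minimal[OF _ linear_subspace_vimage[OF l(2) I(1)]] that by (auto simp: so8_span)
    have "X \<in> I" if "X \<in> space_A" for X
    proof -
      obtain P Q u v w where XX: "X = ((P, Q), u, v, w)" by (metis surj_pair)
      have "X = ((P, 0), 0, 0, 0) + ((0, Q), 0, 0, 0) + (0, u, 0, 0) + (0, 0, v, 0) + (0, 0, 0, w)"
        by (simp add: XX)
      also have "\<dots> \<in> I"
        using that by (intro subspace_add[OF I(1)] K1 K2 J1 J2 J3) (auto simp: XX space_A_iff)
      finally show ?thesis .
    qed
    then show ?thesis using I(2) by blast
  qed simp
qed


section \<open>The root system\<close>

text \<open>Root spaces are recorded by a dual functional \<open>c\<close> on the complexification (given by its
  restriction to \<open>V\<close>) together with the real and imaginary part of a root vector.\<close>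

lemma root_systemI:
  fixes T :: "'a::real_vector set" and \<phi> :: "'a \<Rightarrow> real^'n" and D :: "((real^'n) \<times> ('a \<Rightarrow> complex) \<times> 'a \<times> 'a) set"
  assumes V: "subspace V" and T: "subspace T" "T \<subseteq> V" "\<And>h k. h \<in> T \<Longrightarrow> k \<in> T \<Longrightarrow> f h k = 0"
    and \<phi>: "bij_betw \<phi> T UNIV"
    and R: "0 \<notin> R" "\<And>r. r \<in> R \<Longrightarrow> - r \<in> R"
    and c: "\<And>r c x y. (r, c, x, y) \<in> D \<Longrightarrow> r \<in> R \<and> linear c \<and>
       (\<forall>h\<in>T. \<forall>z\<in>V. c (f h z) = \<i> * complex_of_real (r \<bullet> \<phi> h) * c z)"
    and xy: "\<And>r c x y. (r, c, x, y) \<in> D \<Longrightarrow> x \<in> V \<and> y \<in> V \<and> x \<noteq> 0 \<and>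
       (\<forall>h\<in>T. f h x = - (r \<bullet> \<phi> h) *\<^sub>R y \<and> f h y = (r \<bullet> \<phi> h) *\<^sub>R x)"
    and all: "\<And>r. r \<in> R \<Longrightarrow> \<exists>c x y. (r, c, x, y) \<in> D"
    and ker: "\<And>z. z \<in> V \<Longrightarrow> (\<And>r c x y. (r, c, x, y) \<in> D \<Longrightarrow> c z = 0) \<Longrightarrow> z \<in> T"
  shows "maximal_abelian V f T"
    and "lie_root V f T \<alpha> \<longleftrightarrow> (\<exists>r\<in>R. \<forall>h\<in>T. \<alpha> h = \<i> * complex_of_real (r \<bullet> \<phi> h))"
proof -
  have ex: "\<exists>h\<in>T. r \<bullet> \<phi> h \<noteq> 0" if "r \<in> R" for r
  proof -
    obtain h where "h \<in> T" "\<phi> h = r" using \<phi> by (metis UNIV_I bij_betw_iff_bijections)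
    moreover have "r \<bullet> r \<noteq> 0" using that R(1) by auto
    ultimately show ?thesis by metis
  qed
  have "z \<in> T" if z: "z \<in> V" "\<forall>h\<in>T. f h z = 0" for z
  proof (rule ker[OF z(1)])
    fix r c x y assume D: "(r, c, x, y) \<in> D"
    obtain h where h: "h \<in> T" "r \<bullet> \<phi> h \<noteq> 0" using ex c[OF D] by blast
    have "c (f h z) = \<i> * complex_of_real (r \<bullet> \<phi> h) * c z" using c[OF D] h z(1) by blast
    moreover have "c (f h z) = 0" using z(2) h c[OF D] by (simp add: linear_0)
    ultimately show "c z = 0" using h(2) by simp
  qed
  then show "maximal_abelian V f T"
    using T by (auto simp: maximal_abelian_def)
  show "lie_root V f T \<alpha> \<longleftrightarrow> (\<exists>r\<in>R. \<forall>h\<in>T. \<alpha> h = \<i> * complex_of_real (r \<bullet> \<phi> h))"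
  proof
    assume "\<exists>r\<in>R. \<forall>h\<in>T. \<alpha> h = \<i> * complex_of_real (r \<bullet> \<phi> h)"
    then obtain r where r: "r \<in> R" "\<And>h. h \<in> T \<Longrightarrow> \<alpha> h = \<i> * complex_of_real (r \<bullet> \<phi> h)" by blast
    obtain c x y where D: "(r, c, x, y) \<in> D" using all[OF r(1)] by blast
    have "\<exists>h\<in>T. \<alpha> h \<noteq> 0" using ex[OF r(1)] r(2) by auto
    moreover have "\<forall>h\<in>T. f h x = Re (\<alpha> h) *\<^sub>R x - Im (\<alpha> h) *\<^sub>R y \<and> f h y = Im (\<alpha> h) *\<^sub>R x + Re (\<alpha> h) *\<^sub>R y"
      using xy[OF D] by (auto simp: r(2))
    ultimately show "lie_root V f T \<alpha>" using xy[OF D] unfolding lie_root_def by blast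
  next
    assume "lie_root V f T \<alpha>"
    then obtain h0 x y where h0: "h0 \<in> T" "\<alpha> h0 \<noteq> 0" and xy: "x \<in> V" "y \<in> V" "x \<noteq> 0 \<or> y \<noteq> 0"
      and f: "\<And>h. h \<in> T \<Longrightarrow> f h x = Re (\<alpha> h) *\<^sub>R x - Im (\<alpha> h) *\<^sub>R y"
        "\<And>h. h \<in> T \<Longrightarrow> f h y = Im (\<alpha> h) *\<^sub>R x + Re (\<alpha> h) *\<^sub>R y"
      unfolding lie_root_def by blast
    \<comment> \<open>If every functional vanished on \<open>x\<close> and \<open>y\<close>, both
      would lie in the abelian \<open>T\<close>. Then \<open>h0\<close> would annihilate the root
      vector although its eigenvalue is nonzero.\<close>
    have "\<exists>r c u v. (r, c, u, v) \<in> D \<and> (c x \<noteq> 0 \<or> c y \<noteq> 0)"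
    proof (rule ccontr)
      assume "\<not> (\<exists>r c u v. (r, c, u, v) \<in> D \<and> (c x \<noteq> 0 \<or> c y \<noteq> 0))"
      then have "x \<in> T" "y \<in> T" using ker[OF xy(1)] ker[OF xy(2)] by blast+
      then have "f h0 x = 0" "f h0 y = 0" using T(3) h0 by blast+
      then have e: "Re (\<alpha> h0) *\<^sub>R x - Im (\<alpha> h0) *\<^sub>R y = 0" "Im (\<alpha> h0) *\<^sub>R x + Re (\<alpha> h0) *\<^sub>R y = 0"
        using f[OF h0(1)] by simp_all
      have "((Re (\<alpha> h0))\<^sup>2 + (Im (\<alpha> h0))\<^sup>2) *\<^sub>R x =
        Re (\<alpha> h0) *\<^sub>R (Re (\<alpha> h0) *\<^sub>R x - Im (\<alpha> h0) *\<^sub>R y) + Im (\<alpha> h0) *\<^sub>R (Im (\<alpha> h0) *\<^sub>R x + Re (\<alpha> h0) *\<^sub>R y)"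
        by (simp add: algebra_simps power2_eq_square)
      moreover have "((Re (\<alpha> h0))\<^sup>2 + (Im (\<alpha> h0))\<^sup>2) *\<^sub>R y =
        Re (\<alpha> h0) *\<^sub>R (Im (\<alpha> h0) *\<^sub>R x + Re (\<alpha> h0) *\<^sub>R y) - Im (\<alpha> h0) *\<^sub>R (Re (\<alpha> h0) *\<^sub>R x - Im (\<alpha> h0) *\<^sub>R y)"
        by (simp add: algebra_simps power2_eq_square)
      ultimately have "((Re (\<alpha> h0))\<^sup>2 + (Im (\<alpha> h0))\<^sup>2) *\<^sub>R x = 0" "((Re (\<alpha> h0))\<^sup>2 + (Im (\<alpha> h0))\<^sup>2) *\<^sub>R y = 0"
        unfolding e by simp_all
      moreover have "(Re (\<alpha> h0))\<^sup>2 + (Im (\<alpha> h0))\<^sup>2 \<noteq> 0"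
        using h0(2) by (simp add: complex_eq_iff sum_power2_eq_zero_iff)
      ultimately show False using xy(3) by auto
    qed
    then obtain r c u v where D: "(r, c, u, v) \<in> D" "c x \<noteq> 0 \<or> c y \<noteq> 0" by blast
    have lin: "linear c" and r: "r \<in> R" using c[OF D(1)] by blast+
    have eig: "c (f h z) = \<i> * complex_of_real (r \<bullet> \<phi> h) * c z" if "h \<in> T" "z \<in> V" for h z
      using c[OF D(1)] that by blast
    have lr: "c (a *\<^sub>R x + b *\<^sub>R y) = complex_of_real a * c x + complex_of_real b * c y"
      "c (a *\<^sub>R x - b *\<^sub>R y) = complex_of_real a * c x - complex_of_real b * c y" for a b
      by (simp_all add: linear_add[OF lin] linear_diff[OF lin] linear_scale[OF lin] scaleR_conv_of_real)
    have e: "complex_of_real (Re (\<alpha> h)) * c x - complex_of_real (Im (\<alpha> h)) * c y = \<i> * complex_of_real (r \<bullet> \<phi> h) * c x"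
      "complex_of_real (Im (\<alpha> h)) * c x + complex_of_real (Re (\<alpha> h)) * c y = \<i> * complex_of_real (r \<bullet> \<phi> h) * c y"
      if h: "h \<in> T" for h
      using eig[OF h xy(1)] eig[OF h xy(2)] unfolding f[OF h] lr by simp_all
    have a: "\<alpha> h = complex_of_real (Re (\<alpha> h)) + \<i> * complex_of_real (Im (\<alpha> h))" for h
      by (rule complex_eq)
    \<comment> \<open>The complex-linear extension of \<open>c\<close> takes the value
      \<open>c x + \<i> * c y\<close> on the root vector and \<open>c x - \<i> * c y\<close> on its
      conjugate, and one of the two is nonzero. It reads off the eigenvalue there, which gives the
      root \<open>r\<close> in the first case and \<open>- r\<close> in the second.\<close>
    have p: "(\<alpha> h - \<i> * complex_of_real (r \<bullet> \<phi> h)) * (c x + \<i> * c y) = 0" if h: "h \<in> T" for h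
    proof -
      have "(\<alpha> h - \<i> * complex_of_real (r \<bullet> \<phi> h)) * (c x + \<i> * c y) =
        (complex_of_real (Re (\<alpha> h)) * c x - complex_of_real (Im (\<alpha> h)) * c y - \<i> * complex_of_real (r \<bullet> \<phi> h) * c x)
        + \<i> * (complex_of_real (Im (\<alpha> h)) * c x + complex_of_real (Re (\<alpha> h)) * c y - \<i> * complex_of_real (r \<bullet> \<phi> h) * c y)"
        by (subst a) (simp add: algebra_simps)
      then show ?thesis using e[OF h] by simp
    qed
    have m: "(cnj (\<alpha> h) - \<i> * complex_of_real (r \<bullet> \<phi> h)) * (c x - \<i> * c y) = 0" if h: "h \<in> T" for h
    proof -
      have cn: "cnj (\<alpha> h) = complex_of_real (Re (\<alpha> h)) - \<i> * complex_of_real (Im (\<alpha> h))"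
        by (simp add: complex_eq_iff)
      have "(cnj (\<alpha> h) - \<i> * complex_of_real (r \<bullet> \<phi> h)) * (c x - \<i> * c y) =
        (complex_of_real (Re (\<alpha> h)) * c x - complex_of_real (Im (\<alpha> h)) * c y - \<i> * complex_of_real (r \<bullet> \<phi> h) * c x)
        - \<i> * (complex_of_real (Im (\<alpha> h)) * c x + complex_of_real (Re (\<alpha> h)) * c y - \<i> * complex_of_real (r \<bullet> \<phi> h) * c y)"
        unfolding cn by (simp add: algebra_simps)
      then show ?thesis using e[OF h] by simp
    qed
    show "\<exists>r\<in>R. \<forall>h\<in>T. \<alpha> h = \<i> * complex_of_real (r \<bullet> \<phi> h)"
    proof (cases "c x + \<i> * c y = 0")
      case False
      then show ?thesis using p r by (intro bexI[of _ r]) auto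
    next
      case True
      have "c x - \<i> * c y \<noteq> 0"
      proof
        assume "c x - \<i> * c y = 0"
        then have "c x = 0" "c y = 0" using True by (auto simp: eq_neg_iff_add_eq_0 add_eq_0_iff)
        then show False using D(2) by simp
      qed
      then have "cnj (\<alpha> h) = \<i> * complex_of_real (r \<bullet> \<phi> h)" if "h \<in> T" for h
        using m[OF that] by simp
      then have "\<alpha> h = cnj (\<i> * complex_of_real (r \<bullet> \<phi> h))" if "h \<in> T" for h
        using that by (metis complex_cnj_cnj)
      then show ?thesis using R(2)[OF r] by (intro bexI[of _ "- r"]) auto
    qed
  qed
qed

definition vec8 :: "real \<Rightarrow> real \<Rightarrow> real \<Rightarrow> real \<Rightarrow> real \<Rightarrow> real \<Rightarrow> real \<Rightarrow> real \<Rightarrow> real^8" where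
  "vec8 a b c d e f g h = (\<chi> i. if i = 0 then a else if i = 1 then b else if i = 2 then c else
    if i = 3 then d else if i = 4 then e else if i = 5 then f else if i = 6 then g else h)"

lemma vec8_nth [simp]:
  "vec8 a b c d e f g h $ 0 = a" "vec8 a b c d e f g h $ 1 = b" "vec8 a b c d e f g h $ 2 = c"
  "vec8 a b c d e f g h $ 3 = d" "vec8 a b c d e f g h $ 4 = e" "vec8 a b c d e f g h $ 5 = f"
  "vec8 a b c d e f g h $ 6 = g" "vec8 a b c d e f g h $ 7 = h"
  by (simp_all only: vec8_def vec_lambda_beta neq_8 simp_thms if_True if_False)

lemma real8_eq_iff: "(r :: real^8) = s \<longleftrightarrow> r$0 = s$0 \<and> r$1 = s$1 \<and> r$2 = s$2 \<and> r$3 = s$3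
    \<and> r$4 = s$4 \<and> r$5 = s$5 \<and> r$6 = s$6 \<and> r$7 = s$7"
  by (simp only: vec_eq_iff forall_8)

lemma axis8_nth: "axis k s $ i = (if i = k then s else 0)"
  by (auto simp: axis_def)


subsection \<open>The maximal torus\<close>

definition cartan :: "real \<Rightarrow> real \<Rightarrow> real \<Rightarrow> real \<Rightarrow> mat8" where
  "cartan a b c d = a *\<^sub>R wedge (oct_unit 0) (oct_unit 1) + b *\<^sub>R wedge (oct_unit 2) (oct_unit 3)
    + c *\<^sub>R wedge (oct_unit 4) (oct_unit 5) + d *\<^sub>R wedge (oct_unit 6) (oct_unit 7)"

definition torus :: "real^8 \<Rightarrow> alg_A" where
  "torus r = ((cartan (r$0) (r$1) (r$2) (r$3), cartan (r$4) (r$5) (r$6) (r$7)), 0, 0, 0)"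

definition torus_coord :: "alg_A \<Rightarrow> real^8" where
  "torus_coord X = (let P = fst (fst X); Q = snd (fst X) in
    vec8 (P$0$1) (P$2$3) (P$4$5) (P$6$7) (Q$0$1) (Q$2$3) (Q$4$5) (Q$6$7))"

lemma oct_tensor_unit_nth:
  "oct_tensor (oct_unit m) (oct_unit n) $ i $ j = (if i = m \<and> j = n then 1 else 0)"
  by (simp add: oct_tensor_def oct_unit_nth)

lemma wedge_unit_nth: "wedge (oct_unit m) (oct_unit n) $ i $ j =
    (if i = m \<and> j = n then 1 else 0) - (if i = n \<and> j = m then 1 else 0)"
  by (simp add: wedge_def oct_tensor_unit_nth)

lemma cartan_so8: "cartan a b c d \<in> so8"
  unfolding cartan_def by (intro subspace_add[OF subspace_so8] subspace_scale[OF subspace_so8] wedge_so8)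

lemma cartan_linear:
  "cartan (a + a') (b + b') (c + c') (d + d') = cartan a b c d + cartan a' b' c' d'"
  "cartan (s * a) (s * b) (s * c) (s * d) = s *\<^sub>R cartan a b c d"
  by (simp_all add: cartan_def algebra_simps)

lemma torus_linear: "linear torus"
  by (rule linearI) (simp_all add: torus_def cartan_linear)

lemma torus_coord_linear: "linear torus_coord"
  by (rule linearI) (simp_all add: torus_coord_def Let_def real8_eq_iff)

lemma torus_coord_torus [simp]: "torus_coord (torus r) = r"
  unfolding real8_eq_iff
  by (simp only: torus_coord_def torus_def cartan_def Let_def fst_conv snd_conv vec8_nth
      vector_add_component vector_scaleR_component wedge_unit_nth neq_8 simp_thms if_True if_False) simp

lemma torus_space: "torus r \<in> space_A"
  by (auto simp: torus_def space_A_def cartan_so8)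

lemma cartan_mult_vec:
  "cartan a b c d *v x = vec8 (a * x$1) (- a * x$0) (b * x$3) (- b * x$2) (c * x$5) (- c * x$4) (d * x$7) (- d * x$6)"
  unfolding real8_eq_iff
  by (simp only: cartan_def matrix_vector_simps wedge_mult inner_axis' inner_real_def mult_1_left
      vector_add_component vector_scaleR_component vector_minus_component vec8_nth oct_unit_nth real_scaleR_def
      neq_8 simp_thms if_True if_False) simp

text \<open>The four double products of units occurring here preserve each of the four coordinate
  planes, so triality preserves this torus. The right-hand side is the matrix of its
  restriction.\<close>

lemma triality_cartan:
  "triality (cartan a b c d) = cartan ((- a + b + c - d) / 2) ((- a + b - c + d) / 2)
      ((- a - b + c + d) / 2) ((a + b + c + d) / 2)"
proof -
  have o: "oct_unit i \<bullet> oct_unit (j :: 8) = (if i = j then 1 else 0)" for i j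
    by (simp add: inner_axis_axis)
  have "triality (cartan a b c d) *v x = cartan ((- a + b + c - d) / 2) ((- a + b - c + d) / 2)
      ((- a - b + c + d) / 2) ((a + b + c + d) / 2) *v x" for x
  proof -
    have "triality (cartan a b c d) *v x = (1/2) *\<^sub>R
      (a *\<^sub>R oct_mult (oct_unit 0) (oct_mult (oct_unit 1) x) - b *\<^sub>R oct_mult (oct_unit 2) (oct_mult (oct_unit 3) x)
      - c *\<^sub>R oct_mult (oct_unit 4) (oct_mult (oct_unit 5) x) - d *\<^sub>R oct_mult (oct_unit 6) (oct_mult (oct_unit 7) x))"
      by (simp add: cartan_def linear_add[OF triality_linear] linear_scale[OF triality_linear] matrix_vector_simps
        triality_wedge_mult o oct_cnj_unit oct_simps neq_8 scaleR_diff_right scaleR_add_right mult.commute)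
    also have "\<dots> = cartan ((- a + b + c - d) / 2) ((- a + b - c + d) / 2)
      ((- a - b + c + d) / 2) ((a + b + c + d) / 2) *v x"
      unfolding cartan_mult_vec real8_eq_iff
      by (simp only: vector_add_component vector_scaleR_component vector_minus_component vec8_nth oct_mult_nth
        oct_unit_nth neq_8 simp_thms if_True if_False real_scaleR_def mult_1_left mult_zero_left
        add_0_left add_0_right diff_0_right diff_0 minus_zero)
        (simp add: field_simps)
    finally show ?thesis .
  qed
  then show ?thesis by (simp add: matrix_eq)
qed

text \<open>The cyclic automorphism in torus coordinates. Its transpose \<open>root_rotate\<close>
  is the induced map on weights. Both are orthogonal of order three, so each is the square of the
  other.\<close>

definition torus_rotate :: "real^8 \<Rightarrow> real^8" where
  "torus_rotate r = vec8
    ((- r$0 + r$1 + r$2 - r$3) / 2) ((- r$0 + r$1 - r$2 + r$3) / 2)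
    ((- r$0 - r$1 + r$2 + r$3) / 2) ((r$0 + r$1 + r$2 + r$3) / 2)
    ((- r$4 + r$5 + r$6 - r$7) / 2) ((- r$4 + r$5 - r$6 + r$7) / 2)
    ((- r$4 - r$5 + r$6 + r$7) / 2) ((r$4 + r$5 + r$6 + r$7) / 2)"

definition root_rotate :: "real^8 \<Rightarrow> real^8" where
  "root_rotate r = vec8
    ((- r$0 - r$1 - r$2 + r$3) / 2) ((r$0 + r$1 - r$2 + r$3) / 2)
    ((r$0 - r$1 + r$2 + r$3) / 2) ((- r$0 + r$1 + r$2 + r$3) / 2)
    ((- r$4 - r$5 - r$6 + r$7) / 2) ((r$4 + r$5 - r$6 + r$7) / 2)
    ((r$4 - r$5 + r$6 + r$7) / 2) ((- r$4 + r$5 + r$6 + r$7) / 2)"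

lemma rotate_torus: "rotate_A (torus r) = torus (torus_rotate r)"
  by (simp add: rotate_A_def torus_def Triality_def triality_cartan torus_rotate_def)

lemma root_rotate_inner: "root_rotate r \<bullet> g = r \<bullet> torus_rotate g"
  unfolding inner_oct root_rotate_def torus_rotate_def vec8_nth by (simp add: field_simps)

lemma torus_rotate_cube: "torus_rotate (torus_rotate (torus_rotate r)) = r"
  unfolding real8_eq_iff by (simp add: torus_rotate_def field_simps)

lemma root_rotate_cube: "root_rotate (root_rotate (root_rotate r)) = r"
  unfolding real8_eq_iff by (simp add: root_rotate_def field_simps)


section \<open>Weight functionals and root vectors\<close>

definition planar :: "mat8 \<Rightarrow> real \<Rightarrow> 8 \<Rightarrow> 8 \<Rightarrow> bool" where
  "planar H p i i' \<longleftrightarrow> (\<forall>x. (H *v x) $ i = p * x $ i' \<and> (H *v x) $ i' = - p * x $ i) \<and>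
     H *v oct_unit i = - p *\<^sub>R oct_unit i' \<and> H *v oct_unit i' = p *\<^sub>R oct_unit i"

text \<open>\<open>(i, i', k)\<close> stands for the plane spanned by \<open>e\<^sub>i\<close> and \<open>e\<^sub>i\<^sub>'\<close>, which the \<open>k\<close>-th coordinate of the
  torus rotates.\<close>

definition left_planes :: "(8 \<times> 8 \<times> 8) set" where
  "left_planes = {(0, 1, 0), (2, 3, 1), (4, 5, 2), (6, 7, 3)}"

definition right_planes :: "(8 \<times> 8 \<times> 8) set" where
  "right_planes = {(0, 1, 4), (2, 3, 5), (4, 5, 6), (6, 7, 7)}"

definition cartan_left :: "real^8 \<Rightarrow> mat8" where
  "cartan_left r = cartan (r$0) (r$1) (r$2) (r$3)"

definition cartan_right :: "real^8 \<Rightarrow> mat8" where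
  "cartan_right r = cartan (r$4) (r$5) (r$6) (r$7)"

lemma torus_eq: "torus r = ((cartan_left r, cartan_right r), 0, 0, 0)"
  by (simp add: torus_def cartan_left_def cartan_right_def)

lemma cartan_lr_so8: "cartan_left r \<in> so8" "cartan_right r \<in> so8"
  by (simp_all add: cartan_left_def cartan_right_def cartan_so8)

lemma planar_cartan:
  "planar (cartan a b c d) a 0 1" "planar (cartan a b c d) b 2 3"
  "planar (cartan a b c d) c 4 5" "planar (cartan a b c d) d 6 7"
  unfolding planar_def cartan_mult_vec real8_eq_iff
  by (simp_all only: vec8_nth oct_unit_nth vector_scaleR_component neq_8 simp_thms if_True if_False) simp_all

lemma planar_left: "(i, i', k) \<in> left_planes \<Longrightarrow> planar (cartan_left r) (r $ k) i i'"
  unfolding left_planes_def cartan_left_def using planar_cartan by auto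

lemma planar_right: "(i, i', k) \<in> right_planes \<Longrightarrow> planar (cartan_right r) (r $ k) i i'"
  unfolding right_planes_def cartan_right_def using planar_cartan by auto

text \<open>The complex conjugate of \<open>a\<^sup>t X b\<close> for the weight vectors \<open>a = e\<^sub>i + \<i> s e\<^sub>i\<^sub>'\<close> and
  \<open>b = e\<^sub>j + \<i> t e\<^sub>j\<^sub>'\<close> of the torus.\<close>

definition weight_fun :: "8 \<Rightarrow> 8 \<Rightarrow> 8 \<Rightarrow> 8 \<Rightarrow> real \<Rightarrow> real \<Rightarrow> mat8 \<Rightarrow> complex" where
  "weight_fun i i' j j' s t X =
     Complex (X $ i $ j - s * t * X $ i' $ j') (- (s * X $ i' $ j + t * X $ i $ j'))"

lemma weight_fun_linear: "linear (weight_fun i i' j j' s t)"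
  by (rule linearI) (simp_all add: weight_fun_def complex_eq_iff algebra_simps)

lemma pair_act_nth:
  assumes "K \<in> so8"
  shows "pair_act (H, K) X $ i $ j = (H *v column j X) $ i + (K *v (X $ i)) $ j"
proof -
  have "(\<Sum>k\<in>UNIV. X $ i $ k * K $ k $ j) = - (\<Sum>k\<in>UNIV. K $ j $ k * X $ i $ k)"
    by (subst so8_nth[OF assms]) (simp add: sum_negf mult.commute)
  then show ?thesis
    by (simp add: pair_act_def matrix_matrix_mult_def matrix_vector_mult_def column_def)
qed

lemma weight_fun_act:
  assumes "planar H p i i'" "planar K q j j'" "K \<in> so8" "s \<in> {1, -1}" "t \<in> {1, -1}"
  shows "weight_fun i i' j j' s t (pair_act (H, K) X) =
    \<i> * complex_of_real (s * p + t * q) * weight_fun i i' j j' s t X"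
  using assms(1,2,4,5) unfolding planar_def
  by (auto simp: weight_fun_def pair_act_nth[OF assms(3)] complex_eq_iff column_def algebra_simps)

text \<open>The real part of the complex-bilinear extension of \<open>B\<close> at the weight
  vectors \<open>oct_unit i + \<i> s oct_unit i'\<close> and
  \<open>oct_unit j + \<i> t oct_unit j'\<close>; the imaginary part is \<open>root_vec_im\<close>.
  With \<open>B\<close> either \<open>wedge\<close> or \<open>oct_tensor\<close>, one computation
  serves so(8) and the oct-octonions.\<close>

definition root_vec_re :: "(oct \<Rightarrow> oct \<Rightarrow> 'a::real_vector) \<Rightarrow> 8 \<Rightarrow> 8 \<Rightarrow> 8 \<Rightarrow> 8 \<Rightarrow> real \<Rightarrow> real \<Rightarrow> 'a" where
  "root_vec_re B i i' j j' s t = B (oct_unit i) (oct_unit j) - (s * t) *\<^sub>R B (oct_unit i') (oct_unit j')"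

definition root_vec_im :: "(oct \<Rightarrow> oct \<Rightarrow> 'a::real_vector) \<Rightarrow> 8 \<Rightarrow> 8 \<Rightarrow> 8 \<Rightarrow> 8 \<Rightarrow> real \<Rightarrow> real \<Rightarrow> 'a" where
  "root_vec_im B i i' j j' s t = s *\<^sub>R B (oct_unit i') (oct_unit j) + t *\<^sub>R B (oct_unit i) (oct_unit j')"

lemma root_vec_act:
  assumes "planar H p i i'" "planar K q j j'" "s \<in> {1, -1}" "t \<in> {1, -1}"
    and B: "bilinear B" and D: "linear D" "\<And>a b. D (B a b) = B (H *v a) b + B a (K *v b)"
  shows "D (root_vec_re B i i' j j' s t) = - (s * p + t * q) *\<^sub>R root_vec_im B i i' j j' s t"
    "D (root_vec_im B i i' j j' s t) = (s * p + t * q) *\<^sub>R root_vec_re B i i' j j' s t"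
  using assms(1-4) unfolding planar_def root_vec_re_def root_vec_im_def
  by (auto simp: linear_add[OF D(1)] linear_diff[OF D(1)] linear_scale[OF D(1)] D(2) bilinear_lmul[OF B]
    bilinear_rmul[OF B] bilinear_lneg[OF B] bilinear_rneg[OF B] algebra_simps)

text \<open>The vectors show that \<open>r\<close> occurs as a root. The functional is kept along
  with them because the functionals together have the torus as common kernel, which excludes further
  roots.\<close>

definition root_datum :: "real^8 \<Rightarrow> (alg_A \<Rightarrow> complex) \<Rightarrow> alg_A \<Rightarrow> alg_A \<Rightarrow> bool" where
  "root_datum r c x y \<longleftrightarrow> linear c \<and>
     (\<forall>g. \<forall>z\<in>space_A. c (bracket_A (torus g) z) = \<i> * complex_of_real (r \<bullet> g) * c z) \<and>
     x \<in> space_A \<and> y \<in> space_A \<and> x \<noteq> 0 \<and>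
     (\<forall>g. bracket_A (torus g) x = - (r \<bullet> g) *\<^sub>R y \<and> bracket_A (torus g) y = (r \<bullet> g) *\<^sub>R x)"

text \<open>Functionals are pulled back along the cyclic automorphism and vectors are pushed forward
  by its inverse, which is its second power. Both then have weight
  \<open>root_rotate r\<close>.\<close>

lemma root_datum_rotate:
  assumes "root_datum r c x y"
  shows "root_datum (root_rotate r) (c \<circ> rotate_A) (rotate_A (rotate_A x)) (rotate_A (rotate_A y))"
  unfolding root_datum_def
proof (intro conjI allI ballI)
  have c: "linear c" "\<And>g z. z \<in> space_A \<Longrightarrow> c (bracket_A (torus g) z) = \<i> * complex_of_real (r \<bullet> g) * c z"
    and x: "x \<in> space_A" "y \<in> space_A" "x \<noteq> 0"
    and xy: "\<And>g. bracket_A (torus g) x = - (r \<bullet> g) *\<^sub>R y" "\<And>g. bracket_A (torus g) y = (r \<bullet> g) *\<^sub>R x"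
    using assms unfolding root_datum_def by blast+
  show "linear (c \<circ> rotate_A)" by (rule linear_compose[OF rotate_A_linear c(1)])
  show "rotate_A (rotate_A x) \<in> space_A" "rotate_A (rotate_A y) \<in> space_A"
    using x by (simp_all add: rotate_A_space)
  show "rotate_A (rotate_A x) \<noteq> 0"
    using rotate_A_cube[OF x(1)] x(3) linear_0[OF rotate_A_linear] by metis
  fix g
  show "(c \<circ> rotate_A) (bracket_A (torus g) z) = \<i> * complex_of_real (root_rotate r \<bullet> g) * (c \<circ> rotate_A) z"
    if "z \<in> space_A" for z
    using that by (simp add: rotate_A_bracket torus_space rotate_torus c(2) rotate_A_space root_rotate_inner)
  have g: "torus g = rotate_A (rotate_A (torus (torus_rotate g)))"
    by (simp add: rotate_torus torus_rotate_cube)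
  have "bracket_A (torus g) (rotate_A (rotate_A z)) = rotate_A (rotate_A (bracket_A (torus (torus_rotate g)) z))"
    if "z \<in> space_A" for z
    using that by (subst g) (simp add: rotate_A_bracket rotate_A_space torus_space)
  then show "bracket_A (torus g) (rotate_A (rotate_A x)) = - (root_rotate r \<bullet> g) *\<^sub>R rotate_A (rotate_A y)"
    "bracket_A (torus g) (rotate_A (rotate_A y)) = (root_rotate r \<bullet> g) *\<^sub>R rotate_A (rotate_A x)"
    using x by (simp_all only: xy root_rotate_inner linear_scale[OF rotate_A_linear])
qed

lemma axis_inner: "(axis k s + axis l t) \<bullet> g = s * g $ k + t * g $ l" for g :: "real^8"
  by (simp add: inner_add_left inner_axis')

lemma bracket_torus:
  "bracket_A (torus g) ((P, Q), u, v, w) = ((pair_act (cartan_left g, cartan_left g) P,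
     pair_act (cartan_right g, cartan_right g) Q), pair_act (cartan_left g, cartan_right g) u,
     pair_act (Triality (cartan_left g, cartan_right g)) v,
     pair_act (Triality (Triality (cartan_left g, cartan_right g))) w)"
  by (simp add: torus_eq bracket_A_eq linear_ops_simps pair_bracket_def pair_act_def commutator_def)

lemma bilinear_oct_tensor: "bilinear oct_tensor"
  by (auto intro!: linearI simp: bilinear_def oct_tensor_simps)

lemma pair_act_wedge:
  assumes "H \<in> so8" shows "pair_act (H, H) (wedge a b) = wedge (H *v a) b + wedge a (H *v b)"
  using assms by (simp add: wedge_def linear_ops_simps pair_act_oct_tensor)

lemma pair_act_oct_tensor':
  assumes "H \<in> so8" "K \<in> so8"
  shows "pair_act (H, K) (oct_tensor a b) = oct_tensor (H *v a) b + oct_tensor a (K *v b)"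
  using assms by (simp add: pair_act_oct_tensor)

lemma root_vec_wedge_so8: "root_vec_re wedge i i' j j' s t \<in> so8" "root_vec_im wedge i i' j j' s t \<in> so8"
  unfolding root_vec_re_def root_vec_im_def
  by (intro subspace_add[OF subspace_so8] subspace_diff[OF subspace_so8] subspace_scale[OF subspace_so8] wedge_so8)+

lemma planes_distinct:
  assumes "(i, i', k) \<in> left_planes \<and> (j, j', l) \<in> left_planes \<or>
    (i, i', k) \<in> right_planes \<and> (j, j', l) \<in> right_planes" "k \<noteq> l"
  shows "i \<noteq> j \<and> i' \<noteq> j' \<and> i \<noteq> i' \<and> i \<noteq> j' \<and> j \<noteq> i'"
  using assms unfolding left_planes_def right_planes_def insert_iff empty_iff prod.inject simp_thms
  by (elim disjE conjE; hypsubst; simp only: neq_8 simp_thms)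

lemma planes_distinct':
  "(i, i', k) \<in> left_planes \<or> (i, i', k) \<in> right_planes \<Longrightarrow> i \<noteq> i'"
  unfolding left_planes_def right_planes_def insert_iff empty_iff prod.inject simp_thms
  by (elim disjE conjE; hypsubst; simp only: neq_8 simp_thms)

lemma root_vec_wedge_nonzero:
  assumes "(i, i', k) \<in> left_planes \<and> (j, j', l) \<in> left_planes \<or>
    (i, i', k) \<in> right_planes \<and> (j, j', l) \<in> right_planes" "k \<noteq> l"
  shows "root_vec_re wedge i i' j j' s t \<noteq> 0"
proof -
  have "root_vec_re wedge i i' j j' s t $ i $ j = 1"
    using planes_distinct[OF assms]
    by (simp only: root_vec_re_def vector_minus_component vector_scaleR_component wedge_unit_nth
        simp_thms if_True if_False) simp
  then show ?thesis by (metis zero_index zero_neq_one)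
qed

text \<open>These are the 24 roots of the first so(8). The second so(8) gives another 24 in
  \<open>root_datum_right\<close>, and \<open>root_datum_mixed\<close> gives the 64 roots with one
  coordinate in each half.\<close>

lemma root_datum_left:
  assumes ij: "(i, i', k) \<in> left_planes" "(j, j', l) \<in> left_planes" "k \<noteq> l" and st: "s \<in> {1, -1}" "t \<in> {1, -1}"
  shows "root_datum (axis k s + axis l t) (\<lambda>X. weight_fun i i' j j' s t (fst (fst X)))
    ((root_vec_re wedge i i' j j' s t, 0), 0, 0, 0) ((root_vec_im wedge i i' j j' s t, 0), 0, 0, 0)"
proof -
  have nz: "root_vec_re wedge i i' j j' s t \<noteq> 0"
    using ij by (intro root_vec_wedge_nonzero) blast+
  have lin: "linear (\<lambda>X::alg_A. weight_fun i i' j j' s t (fst (fst X)))"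
    by (rule linearI) (simp_all add: linear_add[OF weight_fun_linear] linear_scale[OF weight_fun_linear])
  have c: "weight_fun i i' j j' s t (fst (fst (bracket_A (torus g) z))) =
      \<i> * complex_of_real (s * g $ k + t * g $ l) * weight_fun i i' j j' s t (fst (fst z))" for g z
  proof -
    obtain P Q u v w where z: "z = ((P, Q), u, v, w)" by (metis surj_pair)
    show ?thesis
      by (simp only: z bracket_torus fst_conv
        weight_fun_act[OF planar_left[OF ij(1)] planar_left[OF ij(2)] cartan_lr_so8(1) st])
  qed
  have "pair_act (cartan_left g, cartan_left g) (root_vec_re wedge i i' j j' s t)
      = - (s * g $ k + t * g $ l) *\<^sub>R root_vec_im wedge i i' j j' s t"
    "pair_act (cartan_left g, cartan_left g) (root_vec_im wedge i i' j j' s t)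
      = (s * g $ k + t * g $ l) *\<^sub>R root_vec_re wedge i i' j j' s t" for g
    using root_vec_act[where B = wedge and D = "pair_act (cartan_left g, cartan_left g)" and H = "cartan_left g"
        and K = "cartan_left g", OF planar_left[OF ij(1)] planar_left[OF ij(2)] st bilinear_wedge
        pair_act_linear(1) pair_act_wedge[OF cartan_lr_so8(1)]]
    by blast+
  then show ?thesis
    unfolding root_datum_def axis_inner using lin c nz root_vec_wedge_so8 subspace_0[OF subspace_so8]
    by (auto simp: space_A_def bracket_torus linear_ops_simps zero_prod_def)
qed

lemma root_datum_right:
  assumes ij: "(i, i', k) \<in> right_planes" "(j, j', l) \<in> right_planes" "k \<noteq> l" and st: "s \<in> {1, -1}" "t \<in> {1, -1}"
  shows "root_datum (axis k s + axis l t) (\<lambda>X. weight_fun i i' j j' s t (snd (fst X)))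
    ((0, root_vec_re wedge i i' j j' s t), 0, 0, 0) ((0, root_vec_im wedge i i' j j' s t), 0, 0, 0)"
proof -
  have nz: "root_vec_re wedge i i' j j' s t \<noteq> 0"
    using ij by (intro root_vec_wedge_nonzero) blast+
  have lin: "linear (\<lambda>X::alg_A. weight_fun i i' j j' s t (snd (fst X)))"
    by (rule linearI) (simp_all add: linear_add[OF weight_fun_linear] linear_scale[OF weight_fun_linear])
  have c: "weight_fun i i' j j' s t (snd (fst (bracket_A (torus g) z))) =
      \<i> * complex_of_real (s * g $ k + t * g $ l) * weight_fun i i' j j' s t (snd (fst z))" for g z
  proof -
    obtain P Q u v w where z: "z = ((P, Q), u, v, w)" by (metis surj_pair)
    show ?thesis
      by (simp only: z bracket_torus fst_conv snd_conv
        weight_fun_act[OF planar_right[OF ij(1)] planar_right[OF ij(2)] cartan_lr_so8(2) st])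
  qed
  have "pair_act (cartan_right g, cartan_right g) (root_vec_re wedge i i' j j' s t)
      = - (s * g $ k + t * g $ l) *\<^sub>R root_vec_im wedge i i' j j' s t"
    "pair_act (cartan_right g, cartan_right g) (root_vec_im wedge i i' j j' s t)
      = (s * g $ k + t * g $ l) *\<^sub>R root_vec_re wedge i i' j j' s t" for g
    using root_vec_act[where B = wedge and D = "pair_act (cartan_right g, cartan_right g)" and H = "cartan_right g"
        and K = "cartan_right g", OF planar_right[OF ij(1)] planar_right[OF ij(2)] st bilinear_wedge
        pair_act_linear(1) pair_act_wedge[OF cartan_lr_so8(2)]]
    by blast+
  then show ?thesis
    unfolding root_datum_def axis_inner using lin c nz root_vec_wedge_so8 subspace_0[OF subspace_so8]
    by (auto simp: space_A_def bracket_torus linear_ops_simps zero_prod_def)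
qed

lemma root_datum_mixed:
  assumes ij: "(i, i', k) \<in> left_planes" "(j, j', l) \<in> right_planes" and st: "s \<in> {1, -1}" "t \<in> {1, -1}"
  shows "root_datum (axis k s + axis l t) (\<lambda>X. weight_fun i i' j j' s t (fst (snd X)))
    (0, root_vec_re oct_tensor i i' j j' s t, 0, 0) (0, root_vec_im oct_tensor i i' j j' s t, 0, 0)"
proof -
  have "root_vec_re oct_tensor i i' j j' s t $ i $ j = 1"
    using planes_distinct'[of i i' k] ij(1)
    by (simp add: root_vec_re_def oct_tensor_unit_nth)
  then have nz: "root_vec_re oct_tensor i i' j j' s t \<noteq> 0" by (metis zero_index zero_neq_one)
  have lin: "linear (\<lambda>X::alg_A. weight_fun i i' j j' s t (fst (snd X)))"
    by (rule linearI) (simp_all add: linear_add[OF weight_fun_linear] linear_scale[OF weight_fun_linear])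
  have c: "weight_fun i i' j j' s t (fst (snd (bracket_A (torus g) z))) =
      \<i> * complex_of_real (s * g $ k + t * g $ l) * weight_fun i i' j j' s t (fst (snd z))" for g z
  proof -
    obtain P Q u v w where z: "z = ((P, Q), u, v, w)" by (metis surj_pair)
    show ?thesis
      by (simp only: z bracket_torus fst_conv snd_conv
        weight_fun_act[OF planar_left[OF ij(1)] planar_right[OF ij(2)] cartan_lr_so8(2) st])
  qed
  have "pair_act (cartan_left g, cartan_right g) (root_vec_re oct_tensor i i' j j' s t)
      = - (s * g $ k + t * g $ l) *\<^sub>R root_vec_im oct_tensor i i' j j' s t"
    "pair_act (cartan_left g, cartan_right g) (root_vec_im oct_tensor i i' j j' s t)
      = (s * g $ k + t * g $ l) *\<^sub>R root_vec_re oct_tensor i i' j j' s t" for g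
    using root_vec_act[where B = oct_tensor and D = "pair_act (cartan_left g, cartan_right g)" and H = "cartan_left g"
        and K = "cartan_right g", OF planar_left[OF ij(1)] planar_right[OF ij(2)] st bilinear_oct_tensor
        pair_act_linear(1) pair_act_oct_tensor'[OF cartan_lr_so8]]
    by blast+
  moreover have "bracket_A (torus g) (0, u, 0, 0) = (0, pair_act (cartan_left g, cartan_right g) u, 0, 0)" for g u
    by (simp add: zero_prod_def bracket_torus linear_ops_simps)
  ultimately show ?thesis
    unfolding root_datum_def axis_inner using lin c nz subspace_0[OF subspace_so8_pair]
    by (simp add: space_A_iff zero_prod_def)
qed


subsection \<open>The roots of type \<open>E\<^sub>8\<close>\<close>

lemma prod_8: "prod f (UNIV :: 8 set) = f 0 * f 1 * f 2 * f 3 * f 4 * f 5 * f 6 * f 7"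
  unfolding UNIV_8
  by (simp only: prod.insert insert_iff empty_iff neq_8 finite.emptyI finite.insertI prod.empty mult_1_right
   simp_thms mult.assoc)

text \<open>The parity condition becomes polynomial: the product of all coordinates is positive.\<close>

lemma E8_half_iff:
  "((\<forall>i. r $ i \<in> {1/2, -1/2}) \<and> even (card {i. r $ i < 0})) \<longleftrightarrow> (\<forall>i. r $ i \<in> {1/2, -1/2}) \<and>
    (2 * r$0) * (2 * r$1) * (2 * r$2) * (2 * r$3) * (2 * r$4) * (2 * r$5) * (2 * r$6) * (2 * r$7) = 1"
  for r :: "real^8"
proof (rule conj_cong[OF refl])
  assume h: "\<forall>i. r $ i \<in> {1/2, -1/2}"
  have "(- 1) ^ card {i. r $ i < 0} = (\<Prod>i\<in>UNIV. if r $ i < 0 then - 1 else (1::real))"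
    by (simp add: prod.If_cases)
  also have "\<dots> = (\<Prod>i\<in>UNIV. 2 * r $ i)"
  proof (rule prod.cong[OF refl])
    fix i
    show "(if r $ i < 0 then - 1 else 1) = 2 * r $ i" using h[rule_format, of i] by auto
  qed
  finally have "(- 1) ^ card {i. r $ i < 0} = (2 * r$0) * (2 * r$1) * (2 * r$2) * (2 * r$3) * (2 * r$4) * (2 * r$5)
      * (2 * r$6) * (2 * r$7)"
    unfolding prod_8 .
  then show "even (card {i. r $ i < 0}) \<longleftrightarrow>
    (2 * r$0) * (2 * r$1) * (2 * r$2) * (2 * r$3) * (2 * r$4) * (2 * r$5) * (2 * r$6) * (2 * r$7) = 1"
    by (cases "even (card {i. r $ i < 0})") auto
qed

lemma E8_roots_iff: "r \<in> E8_roots \<longleftrightarrow>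
    (\<exists>i j s t. i \<noteq> j \<and> s \<in> {1, -1} \<and> t \<in> {1, -1} \<and> r = axis i s + axis j t) \<or>
    ((\<forall>i. r $ i \<in> {1/2, -1/2}) \<and>
    (2 * r$0) * (2 * r$1) * (2 * r$2) * (2 * r$3) * (2 * r$4) * (2 * r$5) * (2 * r$6) * (2 * r$7) = 1)"
  unfolding E8_half_iff[symmetric] E8_roots_def by blast

lemma E8_roots_uminus: "r \<in> E8_roots \<Longrightarrow> - r \<in> E8_roots"
proof -
  assume "r \<in> E8_roots"
  moreover have "- (axis i s + axis j t) = axis i (- s) + axis j (- t)" for i j :: 8 and s t :: real
    by (simp add: vec_eq_iff axis_def)
  moreover have "- s \<in> {1, -1}" if "s \<in> {1, -1}" for s :: real using that by auto
  ultimately show ?thesis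
    unfolding E8_roots_iff by (elim disjE exE) (blast, auto)
qed

lemma E8_roots_nonzero: "0 \<notin> E8_roots"
proof
  assume "0 \<in> E8_roots"
  then consider "\<exists>i j s t. i \<noteq> j \<and> s \<in> {1, -1} \<and> t \<in> {1, -1} \<and> (0 :: real^8) = axis i s + axis j t"
    | "\<forall>i. (0 :: real^8) $ i \<in> {1/2, -1/2}"
    unfolding E8_roots_iff by blast
  then show False
  proof cases
    case 1
    then obtain i j s t where *: "i \<noteq> j" "s \<in> {1, -1}" "(0 :: real^8) = axis i s + axis j t" by blast
    have "(0 :: real^8) $ i = s" unfolding *(3) vector_add_component using *(1) by (simp add: axis8_nth)
    then show False using *(2) by auto
  next
    case 2
    then show False by simp
  qed
qed

lemma root_rotate_linear: "linear root_rotate"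
  unfolding root_rotate_def by (rule linearI) (simp_all only: real8_eq_iff vec8_nth vector_add_component
    vector_scaleR_component real_scaleR_def, simp_all add: field_simps)

text \<open>The weights of the two half-spin representations of so(8), distinguished by the product
  \<open>e\<close> of their signs. One application of \<open>root_rotate\<close> sends the weights
  of the vector representation to those with \<open>e = 1\<close>, two applications to those with
  \<open>e = -1\<close>.\<close>

definition half_sign :: "real \<Rightarrow> real \<Rightarrow> real \<Rightarrow> real \<Rightarrow> real \<Rightarrow> bool" where
  "half_sign e a b c d \<longleftrightarrow> a \<in> {1/2, -1/2} \<and> b \<in> {1/2, -1/2} \<and> c \<in> {1/2, -1/2} \<and> d \<in> {1/2, -1/2}
     \<and> (2*a) * (2*b) * (2*c) * (2*d) = e"

lemma root_rotate_left:
  assumes "k \<in> {0, 1, 2, 3}" "s \<in> {1, -1}" "q = root_rotate (axis k s)" "q' = root_rotate q"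
  shows "half_sign 1 (q$0) (q$1) (q$2) (q$3) \<and> q$4 = 0 \<and> q$5 = 0 \<and> q$6 = 0 \<and> q$7 = 0"
    and "half_sign (-1) (q'$0) (q'$1) (q'$2) (q'$3) \<and> q'$4 = 0 \<and> q'$5 = 0 \<and> q'$6 = 0 \<and> q'$7 = 0"
  using assms(1,2) unfolding assms(3,4)
  by (elim insertE emptyE; hypsubst; simp add: half_sign_def root_rotate_def axis8_nth neq_8)+

lemma root_rotate_right:
  assumes "k \<in> {4, 5, 6, 7}" "s \<in> {1, -1}" "q = root_rotate (axis k s)" "q' = root_rotate q"
  shows "half_sign 1 (q$4) (q$5) (q$6) (q$7) \<and> q$0 = 0 \<and> q$1 = 0 \<and> q$2 = 0 \<and> q$3 = 0"
    and "half_sign (-1) (q'$4) (q'$5) (q'$6) (q'$7) \<and> q'$0 = 0 \<and> q'$1 = 0 \<and> q'$2 = 0 \<and> q'$3 = 0"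
  using assms(1,2) unfolding assms(3,4)
  by (elim insertE emptyE; hypsubst; simp add: half_sign_def root_rotate_def axis8_nth neq_8)+

lemma half_sign_combine:
  assumes "half_sign e (r$0) (r$1) (r$2) (r$3)" "half_sign e (r$4) (r$5) (r$6) (r$7)" "e * e = 1"
  shows "r \<in> E8_roots"
proof -
  have "(2 * r$0) * (2 * r$1) * (2 * r$2) * (2 * r$3) * (2 * r$4) * (2 * r$5) * (2 * r$6) * (2 * r$7)
    = ((2 * r$0) * (2 * r$1) * (2 * r$2) * (2 * r$3)) * ((2 * r$4) * (2 * r$5) * (2 * r$6) * (2 * r$7))"
    by (simp only: mult.assoc)
  also have "\<dots> = 1" using assms by (simp only: half_sign_def)
  finally show ?thesis using assms(1,2) unfolding E8_roots_iff forall_8 half_sign_def by blast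
qed

lemma root_rotate_E8:
  assumes "k \<in> {0, 1, 2, 3}" "l \<in> {4, 5, 6, 7}" "s \<in> {1, -1}" "t \<in> {1, -1}"
  shows "root_rotate (axis k s + axis l t) \<in> E8_roots"
    "root_rotate (root_rotate (axis k s + axis l t)) \<in> E8_roots"
proof -
  note L = root_rotate_left[OF assms(1,3) refl refl] and R = root_rotate_right[OF assms(2,4) refl refl]
  show "root_rotate (axis k s + axis l t) \<in> E8_roots"
    using L(1) R(1) by (intro half_sign_combine[of 1]) (simp_all add: linear_add[OF root_rotate_linear])
  show "root_rotate (root_rotate (axis k s + axis l t)) \<in> E8_roots"
    using L(2) R(2) by (intro half_sign_combine[of "-1"]) (simp_all add: linear_add[OF root_rotate_linear])
qed

definition unit4 :: "real \<Rightarrow> real \<Rightarrow> real \<Rightarrow> real \<Rightarrow> bool" where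
  "unit4 a b c d \<longleftrightarrow> (\<exists>s\<in>{1, -1}. (a, b, c, d) \<in> {(s,0,0,0), (0,s,0,0), (0,0,s,0), (0,0,0,s)})"

lemma half_sign_unit4:
  "half_sign 1 a b c d \<Longrightarrow> unit4 ((- a + b + c - d) / 2) ((- a + b - c + d) / 2)
    ((- a - b + c + d) / 2) ((a + b + c + d) / 2)"
  "half_sign (-1) a b c d \<Longrightarrow> unit4 ((- a - b - c + d) / 2) ((a + b - c + d) / 2)
    ((a - b + c + d) / 2) ((- a + b + c + d) / 2)"
  unfolding half_sign_def by (elim conjE insertE emptyE; hypsubst; simp add: unit4_def)+

lemma unit4_axes:
  fixes q :: "real^8"
  assumes "unit4 (q$0) (q$1) (q$2) (q$3)" "unit4 (q$4) (q$5) (q$6) (q$7)"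
  shows "\<exists>k\<in>{0,1,2,3}. \<exists>l\<in>{4,5,6,7}. \<exists>s\<in>{1,-1}. \<exists>t\<in>{1,-1}. q = axis k s + axis l t"
proof -
  have "\<exists>k\<in>{0,1,2,3::8}. \<exists>s\<in>{1,-1}. q$0 = axis k s $ 0 \<and> q$1 = axis k s $ 1 \<and> q$2 = axis k s $ 2 \<and> q$3 = axis k s $ 3"
  proof -
    obtain s where s: "s \<in> {1, -1}" and m: "(q$0, q$1, q$2, q$3) \<in> {(s,0,0,0), (0,s,0,0), (0,0,s,0), (0,0,0,s)}"
      using assms(1) unfolding unit4_def by blast
    from m consider "q$0 = s \<and> q$1 = 0 \<and> q$2 = 0 \<and> q$3 = 0"
      | "q$0 = 0 \<and> q$1 = s \<and> q$2 = 0 \<and> q$3 = 0"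
      | "q$0 = 0 \<and> q$1 = 0 \<and> q$2 = s \<and> q$3 = 0"
      | "q$0 = 0 \<and> q$1 = 0 \<and> q$2 = 0 \<and> q$3 = s"
      unfolding insert_iff empty_iff prod.inject by blast
    then show ?thesis
    proof cases
      case 1
      then show ?thesis using s
        by (rule_tac x = 0 in bexI, rule_tac x = s in bexI) (simp_all only: axis8_nth neq_8 simp_thms if_True if_False insert_iff empty_iff)
    next
      case 2
      then show ?thesis using s
        by (rule_tac x = 1 in bexI, rule_tac x = s in bexI) (simp_all only: axis8_nth neq_8 simp_thms if_True if_False insert_iff empty_iff)
    next
      case 3
      then show ?thesis using s
        by (rule_tac x = 2 in bexI, rule_tac x = s in bexI) (simp_all only: axis8_nth neq_8 simp_thms if_True if_False insert_iff empty_iff)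
    next
      case 4
      then show ?thesis using s
        by (rule_tac x = 3 in bexI, rule_tac x = s in bexI) (simp_all only: axis8_nth neq_8 simp_thms if_True if_False insert_iff empty_iff)
    qed
  qed
  then obtain k :: 8 and s where k: "k \<in> {0,1,2,3}" "s \<in> {1,-1}"
    "q$0 = axis k s $ 0" "q$1 = axis k s $ 1" "q$2 = axis k s $ 2" "q$3 = axis k s $ 3" by blast
  have "\<exists>k\<in>{4,5,6,7::8}. \<exists>s\<in>{1,-1}. q$4 = axis k s $ 4 \<and> q$5 = axis k s $ 5 \<and> q$6 = axis k s $ 6 \<and> q$7 = axis k s $ 7"
  proof -
    obtain s where s: "s \<in> {1, -1}" and m: "(q$4, q$5, q$6, q$7) \<in> {(s,0,0,0), (0,s,0,0), (0,0,s,0), (0,0,0,s)}"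
      using assms(2) unfolding unit4_def by blast
    from m consider "q$4 = s \<and> q$5 = 0 \<and> q$6 = 0 \<and> q$7 = 0"
      | "q$4 = 0 \<and> q$5 = s \<and> q$6 = 0 \<and> q$7 = 0"
      | "q$4 = 0 \<and> q$5 = 0 \<and> q$6 = s \<and> q$7 = 0"
      | "q$4 = 0 \<and> q$5 = 0 \<and> q$6 = 0 \<and> q$7 = s"
      unfolding insert_iff empty_iff prod.inject by blast
    then show ?thesis
    proof cases
      case 1
      then show ?thesis using s
        by (rule_tac x = 4 in bexI, rule_tac x = s in bexI) (simp_all only: axis8_nth neq_8 simp_thms if_True if_False insert_iff empty_iff)
    next
      case 2
      then show ?thesis using s
        by (rule_tac x = 5 in bexI, rule_tac x = s in bexI) (simp_all only: axis8_nth neq_8 simp_thms if_True if_False insert_iff empty_iff)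
    next
      case 3
      then show ?thesis using s
        by (rule_tac x = 6 in bexI, rule_tac x = s in bexI) (simp_all only: axis8_nth neq_8 simp_thms if_True if_False insert_iff empty_iff)
    next
      case 4
      then show ?thesis using s
        by (rule_tac x = 7 in bexI, rule_tac x = s in bexI) (simp_all only: axis8_nth neq_8 simp_thms if_True if_False insert_iff empty_iff)
    qed
  qed
  then obtain l :: 8 and t where l: "l \<in> {4,5,6,7}" "t \<in> {1,-1}"
    "q$4 = axis l t $ 4" "q$5 = axis l t $ 5" "q$6 = axis l t $ 6" "q$7 = axis l t $ 7" by blast
  have k0: "axis k s $ 4 = 0" "axis k s $ 5 = 0" "axis k s $ 6 = 0" "axis k s $ 7 = 0"
    using k(1) unfolding axis8_nth by (elim insertE emptyE; hypsubst; simp only: neq_8 if_False)+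
  have l0: "axis l t $ 0 = 0" "axis l t $ 1 = 0" "axis l t $ 2 = 0" "axis l t $ 3 = 0"
    using l(1) unfolding axis8_nth by (elim insertE emptyE; hypsubst; simp only: neq_8 if_False)+
  have "q = axis k s + axis l t"
    unfolding real8_eq_iff vector_add_component using k l by (simp only: k0 l0 add_0_left add_0_right simp_thms)
  then show ?thesis using k(1,2) l(1,2) by blast
qed

lemma root_rotate_twice: "root_rotate (root_rotate r) = torus_rotate r"
  unfolding real8_eq_iff by (simp add: root_rotate_def torus_rotate_def field_simps)

text \<open>The signs of a half-integral root have product 1, so the products over the two halves
  agree. If both are 1, two rotations lead back to a vector weight in each half; if both are -1, one
  rotation does.\<close>

lemma E8_roots_cases:
  assumes "r \<in> E8_roots"
  obtains (integral) i j s t where "i \<noteq> j" "s \<in> {1, -1}" "t \<in> {1, -1}" "r = axis i s + axis j t"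
  | (spin) k l s t where "k \<in> {0, 1, 2, 3}" "l \<in> {4, 5, 6, 7}" "s \<in> {1, -1}" "t \<in> {1, -1}"
      "r = root_rotate (axis k s + axis l t) \<or> r = root_rotate (root_rotate (axis k s + axis l t))"
proof -
  consider "\<exists>i j s t. i \<noteq> j \<and> s \<in> {1, -1} \<and> t \<in> {1, -1} \<and> r = axis i s + axis j t"
    | "\<forall>i. r $ i \<in> {1/2, -1/2}"
      "(2 * r$0) * (2 * r$1) * (2 * r$2) * (2 * r$3) * (2 * r$4) * (2 * r$5) * (2 * r$6) * (2 * r$7) = 1"
    using assms unfolding E8_roots_iff by blast
  then show ?thesis
  proof cases
    case 1
    then show ?thesis using integral by blast
  next
    case 2
    define a b where "a = (2 * r$0) * (2 * r$1) * (2 * r$2) * (2 * r$3)"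
      and "b = (2 * r$4) * (2 * r$5) * (2 * r$6) * (2 * r$7)"
    have "(2 * x) * (2 * x) = 1" if "x = 1/2 \<or> x = -1/2" for x :: real
      using that by (elim disjE; hypsubst; simp)
    then have sq: "(2 * r $ i) * (2 * r $ i) = 1" for i using 2(1) by blast
    have "a * a = ((2 * r$0) * (2 * r$0)) * ((2 * r$1) * (2 * r$1)) * ((2 * r$2) * (2 * r$2)) * ((2 * r$3) * (2 * r$3))"
      unfolding a_def by (simp only: mult_ac)
    then have aa: "a * a = 1" by (simp only: sq mult_1_left)
    moreover have "a * b = 1" using 2(2) unfolding a_def b_def by (simp only: mult.assoc)
    ultimately have "a * (b - a) = 0" "a \<noteq> 0" by (auto simp: right_diff_distrib)
    then have ab: "b = a" by simp
    have "a = 1 \<or> a = -1" using aa by (simp only: square_eq_1_iff)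
    then have "half_sign 1 (r$0) (r$1) (r$2) (r$3) \<and> half_sign 1 (r$4) (r$5) (r$6) (r$7) \<or>
       half_sign (-1) (r$0) (r$1) (r$2) (r$3) \<and> half_sign (-1) (r$4) (r$5) (r$6) (r$7)"
    proof
      assume "a = 1"
      then show ?thesis
        unfolding half_sign_def a_def[symmetric] b_def[symmetric] ab using 2(1) by blast
    next
      assume "a = -1"
      then show ?thesis
        unfolding half_sign_def a_def[symmetric] b_def[symmetric] ab using 2(1) by blast
    qed
    then show ?thesis
    proof
      let ?q = "torus_rotate r"
      assume "half_sign 1 (r$0) (r$1) (r$2) (r$3) \<and> half_sign 1 (r$4) (r$5) (r$6) (r$7)"
      then have "unit4 (?q$0) (?q$1) (?q$2) (?q$3)" "unit4 (?q$4) (?q$5) (?q$6) (?q$7)"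
        unfolding torus_rotate_def vec8_nth using half_sign_unit4(1) by blast+
      from unit4_axes[OF this] obtain k l s t where "k \<in> {0,1,2,3}" "l \<in> {4,5,6,7}" "s \<in> {1,-1}" "t \<in> {1,-1}"
        "?q = axis k s + axis l t" by blast
      moreover have "r = root_rotate ?q" by (simp only: root_rotate_twice[symmetric] root_rotate_cube)
      ultimately show ?thesis using spin by metis
    next
      let ?q = "root_rotate r"
      assume "half_sign (-1) (r$0) (r$1) (r$2) (r$3) \<and> half_sign (-1) (r$4) (r$5) (r$6) (r$7)"
      then have "unit4 (?q$0) (?q$1) (?q$2) (?q$3)" "unit4 (?q$4) (?q$5) (?q$6) (?q$7)"
        unfolding root_rotate_def vec8_nth using half_sign_unit4(2) by blast+
      from unit4_axes[OF this] obtain k l s t where "k \<in> {0,1,2,3}" "l \<in> {4,5,6,7}" "s \<in> {1,-1}" "t \<in> {1,-1}"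
        "?q = axis k s + axis l t" by blast
      moreover have "r = root_rotate (root_rotate ?q)" by (simp only: root_rotate_cube)
      ultimately show ?thesis using spin by metis
    qed
  qed
qed

lemma left_plane_ex: "k \<in> {0, 1, 2, 3} \<Longrightarrow> \<exists>i i'. (i, i', k) \<in> left_planes"
  unfolding left_planes_def by auto

lemma right_plane_ex: "k \<in> {4, 5, 6, 7} \<Longrightarrow> \<exists>i i'. (i, i', k) \<in> right_planes"
  unfolding right_planes_def by auto

lemma coord_cases: "k \<in> {0, 1, 2, 3} \<or> k \<in> {4, 5, 6, 7 :: 8}"
  using UNIV_8 by blast

lemma root_datum_exists:
  assumes "r \<in> E8_roots" shows "\<exists>c x y. root_datum r c x y"
  using assms
proof (cases rule: E8_roots_cases)
  case (integral i j s t)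
  consider "i \<in> {0, 1, 2, 3}" "j \<in> {0, 1, 2, 3}" | "i \<in> {4, 5, 6, 7}" "j \<in> {4, 5, 6, 7}"
    | "i \<in> {0, 1, 2, 3}" "j \<in> {4, 5, 6, 7}" | "i \<in> {4, 5, 6, 7}" "j \<in> {0, 1, 2, 3}"
    using coord_cases[of i] coord_cases[of j] by argo
  then show ?thesis
  proof cases
    case 1
    obtain a a' b b' where "(a, a', i) \<in> left_planes" "(b, b', j) \<in> left_planes"
      using left_plane_ex[OF 1(1)] left_plane_ex[OF 1(2)] by blast
    from root_datum_left[OF this integral(1-3)] show ?thesis unfolding integral(4) by blast
  next
    case 2
    obtain a a' b b' where "(a, a', i) \<in> right_planes" "(b, b', j) \<in> right_planes"
      using right_plane_ex[OF 2(1)] right_plane_ex[OF 2(2)] by blast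
    from root_datum_right[OF this integral(1-3)] show ?thesis unfolding integral(4) by blast
  next
    case 3
    obtain a a' b b' where "(a, a', i) \<in> left_planes" "(b, b', j) \<in> right_planes"
      using left_plane_ex[OF 3(1)] right_plane_ex[OF 3(2)] by blast
    from root_datum_mixed[OF this integral(2,3)] show ?thesis unfolding integral(4) by blast
  next
    case 4
    obtain a a' b b' where "(a, a', j) \<in> left_planes" "(b, b', i) \<in> right_planes"
      using left_plane_ex[OF 4(2)] right_plane_ex[OF 4(1)] by blast
    from root_datum_mixed[OF this integral(3,2)] show ?thesis
      unfolding integral(4) add.commute[of "axis i s"] by blast
  qed
next
  case (spin k l s t)
  obtain i i' j j' where "(i, i', k) \<in> left_planes" "(j, j', l) \<in> right_planes"
    using left_plane_ex[OF spin(1)] right_plane_ex[OF spin(2)] by blast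
  from root_datum_mixed[OF this spin(3,4)] obtain c x y where d: "root_datum (axis k s + axis l t) c x y" by blast
  show ?thesis using spin(5) root_datum_rotate[OF d] root_datum_rotate[OF root_datum_rotate[OF d]] by blast
qed

section \<open>The common kernel of the weight functionals\<close>

lemma plane_cover:
  "\<exists>a a' k. (a, a', k) \<in> left_planes \<and> i \<in> {a, a'}" "\<exists>a a' k. (a, a', k) \<in> right_planes \<and> i \<in> {a, a'}"
proof -
  have "i \<in> {0, 1, 2, 3, 4, 5, 6, 7}" using UNIV_8 by blast
  then show "\<exists>a a' k. (a, a', k) \<in> left_planes \<and> i \<in> {a, a'}" "\<exists>a a' k. (a, a', k) \<in> right_planes \<and> i \<in> {a, a'}"
    unfolding left_planes_def right_planes_def by blast+
qed

lemma plane_coord: "(i, i', k) \<in> left_planes \<Longrightarrow> k \<in> {0, 1, 2, 3}" "(i, i', k) \<in> right_planes \<Longrightarrow> k \<in> {4, 5, 6, 7}"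
  unfolding left_planes_def right_planes_def by auto

lemma weight_fun_zero:
  assumes "\<And>s t. s \<in> {1, -1} \<Longrightarrow> t \<in> {1, -1} \<Longrightarrow> weight_fun i i' j j' s t X = 0"
    "a \<in> {i, i'}" "b \<in> {j, j'}"
  shows "X $ a $ b = 0"
proof -
  \<comment> \<open>The two choices with \<open>s = 1\<close> already determine the four real
    entries of the block; the other two functionals are their complex conjugates.\<close>
  have "weight_fun i i' j j' 1 1 X = 0" "weight_fun i i' j j' 1 (-1) X = 0"
    by (intro assms(1); simp)+
  then show ?thesis using assms(2,3) by (auto simp: weight_fun_def complex_eq_iff)
qed

lemma mixed_zero:
  assumes "\<And>i i' k j j' l s t. (i, i', k) \<in> left_planes \<Longrightarrow> (j, j', l) \<in> right_planes \<Longrightarrow>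
    s \<in> {1, -1} \<Longrightarrow> t \<in> {1, -1} \<Longrightarrow> weight_fun i i' j j' s t X = 0"
  shows "X = 0"
proof -
  have "X $ a $ b = 0" for a b
    using plane_cover(1)[of a] plane_cover(2)[of b] weight_fun_zero assms by metis
  then show ?thesis by (simp add: vec_eq_iff)
qed

lemma so8_cartan:
  assumes P: "P \<in> so8" and z: "\<And>i i' k j j' l a b. (i, i', k) \<in> left_planes \<Longrightarrow> (j, j', l) \<in> left_planes \<Longrightarrow>
    k \<noteq> l \<Longrightarrow> a \<in> {i, i'} \<Longrightarrow> b \<in> {j, j'} \<Longrightarrow> P $ a $ b = 0"
  shows "P = cartan (P$0$1) (P$2$3) (P$4$5) (P$6$7)"
proof -
  have d: "P $ i $ i = 0" for i using so8_nth[OF P, of i i] by simp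
  have s: "P$1$0 = - P$0$1" "P$3$2 = - P$2$3" "P$5$4 = - P$4$5" "P$7$6 = - P$6$7"
    by (rule so8_nth[OF P])+
  have l: "(0, 1, 0) \<in> left_planes" "(2, 3, 1) \<in> left_planes" "(4, 5, 2) \<in> left_planes" "(6, 7, 3) \<in> left_planes"
    by (simp_all add: left_planes_def)
  have q: "P$i$j = 0 \<and> P$i$j' = 0 \<and> P$i'$j = 0 \<and> P$i'$j' = 0"
    if "(i, i', k) \<in> left_planes" "(j, j', l) \<in> left_planes" "k \<noteq> l" for i i' k j j' l
    using z[OF that] by blast
  have oo:
    "P$0$2 = 0 \<and> P$0$3 = 0 \<and> P$1$2 = 0 \<and> P$1$3 = 0"
    "P$0$4 = 0 \<and> P$0$5 = 0 \<and> P$1$4 = 0 \<and> P$1$5 = 0"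
    "P$0$6 = 0 \<and> P$0$7 = 0 \<and> P$1$6 = 0 \<and> P$1$7 = 0"
    "P$2$0 = 0 \<and> P$2$1 = 0 \<and> P$3$0 = 0 \<and> P$3$1 = 0"
    "P$2$4 = 0 \<and> P$2$5 = 0 \<and> P$3$4 = 0 \<and> P$3$5 = 0"
    "P$2$6 = 0 \<and> P$2$7 = 0 \<and> P$3$6 = 0 \<and> P$3$7 = 0"
    "P$4$0 = 0 \<and> P$4$1 = 0 \<and> P$5$0 = 0 \<and> P$5$1 = 0"
    "P$4$2 = 0 \<and> P$4$3 = 0 \<and> P$5$2 = 0 \<and> P$5$3 = 0"
    "P$4$6 = 0 \<and> P$4$7 = 0 \<and> P$5$6 = 0 \<and> P$5$7 = 0"
    "P$6$0 = 0 \<and> P$6$1 = 0 \<and> P$7$0 = 0 \<and> P$7$1 = 0"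
    "P$6$2 = 0 \<and> P$6$3 = 0 \<and> P$7$2 = 0 \<and> P$7$3 = 0"
    "P$6$4 = 0 \<and> P$6$5 = 0 \<and> P$7$4 = 0 \<and> P$7$5 = 0"
    by (rule q[OF l(1) l(2)] q[OF l(1) l(3)] q[OF l(1) l(4)] q[OF l(2) l(1)] q[OF l(2) l(3)] q[OF l(2) l(4)] q[OF l(3) l(1)] q[OF l(3) l(2)] q[OF l(3) l(4)] q[OF l(4) l(1)] q[OF l(4) l(2)] q[OF l(4) l(3)]; simp only: neq_8 simp_thms)+
  show ?thesis
    unfolding vec_eq_iff forall_8 cartan_def vector_add_component vector_scaleR_component wedge_unit_nth
    by (simp only: oo d s neq_8 simp_thms if_True if_False) simp
qed

text \<open>\<open>so8_cartan\<close> is phrased with the left planes. The shift by 4 names the same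
  plane by its coordinate in the second copy of so(8), so that the criterion also applies
  there.\<close>

lemma left_right_planes: "(i, i', k) \<in> left_planes \<Longrightarrow> (i, i', k + 4) \<in> right_planes"
  unfolding left_planes_def right_planes_def insert_iff empty_iff prod.inject simp_thms
  by (elim disjE conjE; hypsubst; simp)

text \<open>The mixed functionals and their two rotations force the three oct-octonion components to
  vanish. The functionals of the two copies of so(8) leave only the diagonal 2 by 2 blocks, that is,
  the torus.\<close>

lemma root_data_kernel:
  assumes z: "z \<in> space_A" and c: "\<And>r c x y. r \<in> E8_roots \<Longrightarrow> root_datum r c x y \<Longrightarrow> c z = 0"
  shows "z = torus (torus_coord z)"
proof -
  obtain P Q u v w where zz: "z = ((P, Q), u, v, w)" by (metis surj_pair)
  have E: "axis k s + axis l t \<in> E8_roots" if "k \<noteq> l" "s \<in> {1, -1}" "t \<in> {1, -1}" for k l s t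
    using that unfolding E8_roots_iff by blast
  have lr: "k \<noteq> l" if "(i, i', k) \<in> left_planes" "(j, j', l) \<in> right_planes" for i i' k j j' l
    using plane_coord(1)[OF that(1)] plane_coord(2)[OF that(2)] neq_8 by blast
  have u: "u = 0"
  proof (rule mixed_zero)
    fix i i' k j j' l and s t :: real
    assume a: "(i, i', k) \<in> left_planes" "(j, j', l) \<in> right_planes" "s \<in> {1, -1}" "t \<in> {1, -1}"
    show "weight_fun i i' j j' s t u = 0"
      using c[OF E[OF lr[OF a(1,2)] a(3,4)] root_datum_mixed[OF a]] by (simp add: zz)
  qed
  have v: "v = 0"
  proof (rule mixed_zero)
    fix i i' k j j' l and s t :: real
    assume a: "(i, i', k) \<in> left_planes" "(j, j', l) \<in> right_planes" "s \<in> {1, -1}" "t \<in> {1, -1}"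
    show "weight_fun i i' j j' s t v = 0"
      using c[OF root_rotate_E8(1)[OF plane_coord(1)[OF a(1)] plane_coord(2)[OF a(2)] a(3,4)]
          root_datum_rotate[OF root_datum_mixed[OF a]]] by (simp add: zz rotate_A_def)
  qed
  have w: "w = 0"
  proof (rule mixed_zero)
    fix i i' k j j' l and s t :: real
    assume a: "(i, i', k) \<in> left_planes" "(j, j', l) \<in> right_planes" "s \<in> {1, -1}" "t \<in> {1, -1}"
    show "weight_fun i i' j j' s t w = 0"
      using c[OF root_rotate_E8(2)[OF plane_coord(1)[OF a(1)] plane_coord(2)[OF a(2)] a(3,4)]
          root_datum_rotate[OF root_datum_rotate[OF root_datum_mixed[OF a]]]] by (simp add: zz rotate_A_def)
  qed
  have P: "P = cartan (P$0$1) (P$2$3) (P$4$5) (P$6$7)"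
  proof (rule so8_cartan)
    show "P \<in> so8" using z by (simp add: zz space_A_def)
    fix i i' k j j' l a b
    assume h: "(i, i', k) \<in> left_planes" "(j, j', l) \<in> left_planes" "k \<noteq> l" and ab: "a \<in> {i, i'}" "b \<in> {j, j'}"
    show "P $ a $ b = 0"
    proof (rule weight_fun_zero[OF _ ab])
      fix s t :: real assume st: "s \<in> {1, -1}" "t \<in> {1, -1}"
      show "weight_fun i i' j j' s t P = 0"
        using c[OF E[OF h(3) st] root_datum_left[OF h st]] by (simp add: zz)
    qed
  qed
  have Q: "Q = cartan (Q$0$1) (Q$2$3) (Q$4$5) (Q$6$7)"
  proof (rule so8_cartan)
    show "Q \<in> so8" using z by (simp add: zz space_A_def)
    fix i i' k j j' l a b
    assume h: "(i, i', k) \<in> left_planes" "(j, j', l) \<in> left_planes" "k \<noteq> l" and ab: "a \<in> {i, i'}" "b \<in> {j, j'}"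
    note h = left_right_planes[OF h(1)] left_right_planes[OF h(2)] h(3)[folded add_right_cancel[of k 4 l]]
    show "Q $ a $ b = 0"
    proof (rule weight_fun_zero[OF _ ab])
      fix s t :: real assume st: "s \<in> {1, -1}" "t \<in> {1, -1}"
      show "weight_fun i i' j j' s t Q = 0"
        using c[OF E[OF h(3) st] root_datum_right[OF h st]] by (simp add: zz)
    qed
  qed
  show ?thesis
    unfolding zz u v w torus_def torus_coord_def Let_def fst_conv snd_conv vec8_nth
    using P Q by simp
qed

lemma has_root_system_E8_A: "has_root_system_E8 space_A bracket_A"
proof -
  let ?T = "range torus"
  let ?D = "{(r, c, x, y). r \<in> E8_roots \<and> root_datum r c x y}"
  have T1: "subspace ?T" by (rule linear_subspace_image[OF torus_linear subspace_UNIV])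
  have T2: "?T \<subseteq> space_A" using torus_space by blast
  have T3: "bracket_A h k = 0" if hk: "h \<in> ?T" "k \<in> ?T" for h k
  proof -
    have comm: "commutator (cartan a b c d) (cartan a' b' c' d') = 0" for a b c d a' b' c' d'
    proof -
      have "cartan a b c d *v (cartan a' b' c' d' *v x) = cartan a' b' c' d' *v (cartan a b c d *v x)" for x
        unfolding cartan_mult_vec real8_eq_iff vec8_nth by simp
      then show ?thesis by (simp add: commutator_def matrix_eq matrix_vector_simps)
    qed
    obtain r r' where "h = torus r" "k = torus r'" using hk by blast
    then have "bracket_A h k = (pair_bracket (fst h) (fst k), 0, 0, 0)"
      by (simp only: torus_def bracket_A_eq fst_conv linear_ops_simps) simp
    moreover have "pair_bracket (fst h) (fst k) = 0"
      using \<open>h = torus r\<close> \<open>k = torus r'\<close>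
      by (simp only: torus_def pair_bracket_def fst_conv snd_conv comm zero_prod_def)
    ultimately show ?thesis by (simp only: zero_prod_def)
  qed
  have bij: "bij_betw torus_coord ?T UNIV"
    by (rule bij_betw_byWitness[where f' = torus]) auto
  have c: "r \<in> E8_roots \<and> linear c \<and> (\<forall>h\<in>?T. \<forall>z\<in>space_A. c (bracket_A h z) = \<i> * complex_of_real (r \<bullet> torus_coord h) * c z)"
      "x \<in> space_A \<and> y \<in> space_A \<and> x \<noteq> 0 \<and>
       (\<forall>h\<in>?T. bracket_A h x = - (r \<bullet> torus_coord h) *\<^sub>R y \<and> bracket_A h y = (r \<bullet> torus_coord h) *\<^sub>R x)"
      if "(r, c, x, y) \<in> ?D" for r c x y
      using that unfolding root_datum_def by auto
  have k: "z \<in> ?T" if "z \<in> space_A" "\<And>r c x y. (r, c, x, y) \<in> ?D \<Longrightarrow> c z = 0" for z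
      using root_data_kernel[OF that(1)] that(2) by blast
  have a: "\<exists>c x y. (r, c, x, y) \<in> ?D" if "r \<in> E8_roots" for r
      using root_datum_exists[OF that] that by blast
  have *: "maximal_abelian space_A bracket_A ?T"
    by (rule root_systemI(1)[OF subspace_space_A T1 T2 T3 bij E8_roots_nonzero E8_roots_uminus c a k])
  have **: "lie_root space_A bracket_A ?T \<alpha> \<longleftrightarrow>
      (\<exists>r\<in>E8_roots. \<forall>h\<in>?T. \<alpha> h = \<i> * complex_of_real (r \<bullet> torus_coord h))" for \<alpha>
    by (rule root_systemI(2)[OF subspace_space_A T1 T2 T3 bij E8_roots_nonzero E8_roots_uminus c a k])
  have "linear_map_on ?T torus_coord"
    by (simp add: linear_map_on_def linear_add[OF torus_coord_linear] linear_scale[OF torus_coord_linear])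
  then show ?thesis
    unfolding has_root_system_E8_def using * ** bij by blast
qed


section \<open>The compact group of a Lie algebra with invariant inner product\<close>

subsection \<open>The matrix exponential\<close>

primrec matpow :: "real^'n^'n \<Rightarrow> nat \<Rightarrow> real^'n^'n" where
  "matpow D 0 = mat 1"
| "matpow D (Suc k) = D ** matpow D k"

text \<open>The exponential of \<open>t D\<close>, taken entry by entry so that convergence and
  termwise differentiation are those of real power series.\<close>

definition mexp :: "real^'n^'n \<Rightarrow> real \<Rightarrow> real^'n^'n" where
  "mexp D t = (\<chi> i j. \<Sum>k. matpow D k $ i $ j / fact k * t ^ k)"

lemma matpow_bound:
  fixes D :: "real^'n^'n"
  shows "\<bar>matpow D k $ i $ j\<bar> \<le> (\<Sum>i\<in>UNIV. \<Sum>j\<in>UNIV. \<bar>D $ i $ j\<bar>) ^ k"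
proof (induction k arbitrary: i j)
  case 0
  show ?case by (simp add: mat_def)
next
  case (Suc k)
  let ?c = "\<Sum>i\<in>UNIV. \<Sum>j\<in>UNIV. \<bar>D $ i $ j\<bar>"
  have "\<bar>matpow D (Suc k) $ i $ j\<bar> \<le> (\<Sum>l\<in>UNIV. \<bar>D $ i $ l * matpow D k $ l $ j\<bar>)"
    by (simp add: matrix_matrix_mult_def)
  also have "\<dots> \<le> (\<Sum>l\<in>UNIV. \<bar>D $ i $ l\<bar> * ?c ^ k)"
    by (intro sum_mono) (simp add: abs_mult mult_left_mono Suc)
  also have "\<dots> = (\<Sum>l\<in>UNIV. \<bar>D $ i $ l\<bar>) * ?c ^ k"
    by (simp add: sum_distrib_right)
  also have "\<dots> \<le> ?c * ?c ^ k"
    by (intro mult_right_mono zero_le_power sum_nonneg member_le_sum[of i UNIV "\<lambda>i. \<Sum>l\<in>UNIV. \<bar>D $ i $ l\<bar>"])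
       (auto intro: sum_nonneg)
  finally show ?case by simp
qed

lemma mexp_summable: "summable (\<lambda>k. matpow D k $ i $ j / fact k * t ^ k)"
proof (rule summable_comparison_test')
  let ?c = "\<Sum>i\<in>UNIV. \<Sum>j\<in>UNIV. \<bar>D $ i $ j\<bar>"
  show "summable (\<lambda>k. inverse (fact k) * (?c * \<bar>t\<bar>) ^ k)" by (rule summable_exp)
  fix k
  have "\<bar>matpow D k $ i $ j\<bar> * \<bar>t\<bar> ^ k / fact k \<le> ?c ^ k * \<bar>t\<bar> ^ k / fact k"
    by (intro divide_right_mono mult_right_mono matpow_bound) auto
  then show "norm (matpow D k $ i $ j / fact k * t ^ k) \<le> inverse (fact k) * (?c * \<bar>t\<bar>) ^ k"
    by (simp add: abs_mult power_abs power_mult_distrib divide_inverse mult_ac)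
qed

lemma mexp_0 [simp]: "mexp D 0 = mat 1"
proof -
  have "mexp D 0 $ i $ j = mat 1 $ i $ j" for i j
  proof -
    have "(\<Sum>k. matpow D k $ i $ j / fact k * 0 ^ k) = (\<Sum>k\<in>{0}. matpow D k $ i $ j / fact k * 0 ^ k)"
      by (rule suminf_finite) auto
    then show ?thesis by (simp add: mexp_def)
  qed
  then show ?thesis by (simp add: vec_eq_iff)
qed

lemma mexp_nth_deriv:
  "((\<lambda>t. mexp D t $ i $ j) has_real_derivative (D ** mexp D t) $ i $ j) (at t)"
proof -
  let ?c = "\<lambda>i j k. matpow D k $ i $ j / fact k"
  have "((\<lambda>t. \<Sum>k. ?c i j k * t ^ k) has_real_derivative (\<Sum>k. diffs (?c i j) k * t ^ k)) (at t)"
    by (intro termdiffs_strong_converges_everywhere mexp_summable)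
  moreover have "diffs (?c i j) k * t ^ k = (\<Sum>l\<in>UNIV. D $ i $ l * (?c l j k * t ^ k))" for k
  proof -
    have "diffs (?c i j) k = matpow D (Suc k) $ i $ j / fact k"
      by (simp add: diffs_def field_simps del: of_nat_Suc matpow.simps)
    then show ?thesis
      by (simp add: matrix_matrix_mult_def sum_distrib_right sum_divide_distrib mult.assoc)
  qed
  moreover have "(\<Sum>k. \<Sum>l\<in>UNIV. D $ i $ l * (?c l j k * t ^ k)) = (\<Sum>l\<in>UNIV. D $ i $ l * mexp D t $ l $ j)"
    by (subst suminf_sum[OF summable_mult[OF mexp_summable]])
       (simp only: suminf_mult[OF mexp_summable] mexp_def vec_lambda_beta)
  ultimately show ?thesis
    by (simp add: mexp_def matrix_matrix_mult_def)
qed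

lemma has_vector_derivative_matrix:
  fixes f :: "real \<Rightarrow> real^'n^'m"
  assumes "\<And>i j. ((\<lambda>t. f t $ i $ j) has_real_derivative f' $ i $ j) (at t)"
  shows "(f has_vector_derivative f') (at t)"
proof -
  have e: "M = (\<Sum>i\<in>UNIV. \<Sum>j\<in>UNIV. M $ i $ j *\<^sub>R axis i (axis j 1))" for M :: "real^'n^'m"
  proof -
    have "M $ p $ q = (\<Sum>i\<in>UNIV. \<Sum>j\<in>UNIV. M $ i $ j *\<^sub>R axis i (axis j 1)) $ p $ q" for p q
    proof -
      have "(\<Sum>i\<in>UNIV. \<Sum>j\<in>UNIV. M $ i $ j *\<^sub>R axis i (axis j 1)) $ p $ q
        = (\<Sum>i\<in>UNIV. if i = p then \<Sum>j\<in>UNIV. if j = q then M $ i $ j else 0 else 0)"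
        unfolding sum_component
        by (intro sum.cong refl) (auto simp: axis_def intro!: sum.neutral sum.cong
            simp del: sum.delta sum.delta')
      then show ?thesis by simp
    qed
    then show ?thesis unfolding vec_eq_iff by blast
  qed
  have "((\<lambda>t. f t $ i $ j *\<^sub>R (axis i (axis j 1) :: real^'n^'m)) has_vector_derivative f' $ i $ j *\<^sub>R axis i (axis j 1)) (at t)" for i j
    using has_vector_derivative_scaleR[OF assms[of i j] has_vector_derivative_const[of "axis i (axis j 1)"]] by simp
  then have "((\<lambda>t. \<Sum>i\<in>UNIV. \<Sum>j\<in>UNIV. f t $ i $ j *\<^sub>R (axis i (axis j 1) :: real^'n^'m)) has_vector_derivative
    (\<Sum>i\<in>UNIV. \<Sum>j\<in>UNIV. f' $ i $ j *\<^sub>R axis i (axis j 1))) (at t)"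
    by (intro has_vector_derivative_sum)
  then show ?thesis by (simp only: e[symmetric])
qed

lemma mexp_deriv: "(mexp D has_vector_derivative D ** mexp D t) (at t)"
  by (rule has_vector_derivative_matrix) (rule mexp_nth_deriv)

lemma bounded_linear_mult_vec: "bounded_linear (\<lambda>A :: real^'n^'m. A *v x)"
  unfolding linear_conv_bounded_linear[symmetric]
  by (rule linearI) (simp_all add: matrix_vector_mult_add_rdistrib scaleR_matrix_vector_assoc)

lemma mexp_mult_deriv: "((\<lambda>t. mexp D t *v x) has_vector_derivative D *v (mexp D t *v x)) (at t)"
  using bounded_linear.has_vector_derivative[OF bounded_linear_mult_vec mexp_deriv]
  by (simp add: matrix_vector_mul_assoc)

text \<open>Skewness keeps the norm of a solution constant. This is the uniqueness statement that
  propagates identities along the exponential.\<close>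

lemma skew_flow_zero:
  fixes W :: "real \<Rightarrow> real^'n"
  assumes D: "\<And>x. (D *v x) \<bullet> x = 0" and W: "\<And>t. (W has_vector_derivative D *v W t) (at t)" and "W 0 = 0"
  shows "W t = 0"
proof -
  have "((\<lambda>t. W t \<bullet> W t) has_real_derivative 0) (at t)" for t
    using bounded_bilinear.has_vector_derivative[OF bounded_bilinear_inner W W, of t] D
    by (simp add: has_real_derivative_iff_has_vector_derivative inner_commute)
  then have "W t \<bullet> W t = W 0 \<bullet> W 0"
    using DERIV_isconst_all[of "\<lambda>t. W t \<bullet> W t"] by blast
  then show ?thesis using assms(3) by simp
qed


subsection \<open>The adjoint group\<close>

lemma matrix_inv:
  assumes "invertible A" shows "A ** matrix_inv A = mat 1" "matrix_inv A ** A = mat 1"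
  using someI_ex[OF assms[unfolded invertible_def]] by (simp_all add: matrix_inv_def)

text \<open>The standard inner product of \<open>real^'n\<close> serves as the invariant form, so
  that \<open>ad\<close> has skew values and the group consists of orthogonal matrices.\<close>

locale invariant_lie =
  fixes br :: "real^'n \<Rightarrow> real^'n \<Rightarrow> real^'n"
  assumes bilinear_br: "bilinear br"
    and skew_br: "br x y = - br y x"
    and jacobi_br: "br (br x y) z + br (br y z) x + br (br z x) y = 0"
    and invariant_br: "br x y \<bullet> z = x \<bullet> br y z"
    and centre_br: "(\<And>y. br x y = 0) \<Longrightarrow> x = 0"
begin

definition ad :: "real^'n \<Rightarrow> real^'n^'n" where
  "ad x = matrix (br x)"

lemma ad_mult [simp]: "ad x *v y = br x y"
  using bilinear_br by (simp add: ad_def bilinear_def)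

lemma ad_linear: "linear ad"
  by (rule linearI) (simp_all add: matrix_eq matrix_vector_mult_add_rdistrib scaleR_matrix_vector_assoc[symmetric]
    bilinear_ladd[OF bilinear_br] bilinear_lmul[OF bilinear_br])

lemma ad_inj: "inj ad"
  unfolding linear_injective_0[OF ad_linear]
proof (intro allI impI)
  fix x assume "ad x = 0"
  then have "br x y = 0" for y using ad_mult[of x y] by simp
  then show "x = 0" by (rule centre_br)
qed

lemma br_derivation: "br z (br x y) = br (br z x) y + br x (br z y)"
proof -
  have "br (br z x) y + br (br x y) z + br (br y z) x = 0" by (rule jacobi_br)
  moreover have "br (br x y) z = - br z (br x y)" "br (br y z) x = - br x (br y z)" by (rule skew_br)+
  moreover have "br x (br y z) = - br x (br z y)"
    using skew_br[of y z] by (simp add: bilinear_rneg[OF bilinear_br])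
  ultimately show ?thesis by (simp add: algebra_simps eq_neg_iff_add_eq_0)
qed

lemma ad_br: "ad (br x y) = commutator (ad x) (ad y)"
proof -
  have "br (br x y) z = br x (br y z) - br y (br x z)" for z
    using br_derivation[of x y z] by simp
  then show ?thesis by (simp add: matrix_eq commutator_def matrix_vector_simps)
qed

lemma ad_skew: "br z x \<bullet> y = - (x \<bullet> br z y)"
  using invariant_br[of x z y] skew_br[of z x] by simp

definition derivations :: "(real^'n^'n) set" where
  "derivations = {D. (\<forall>x y. D *v br x y = br (D *v x) y + br x (D *v y)) \<and>
     (\<forall>x y. (D *v x) \<bullet> y = - (x \<bullet> (D *v y)))}"

lemma ad_derivation: "ad x \<in> derivations"
  by (simp add: derivations_def br_derivation[symmetric] ad_skew[symmetric])

lemma transpose_skew: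
  assumes "\<And>x y. (D *v x) \<bullet> y = - (x \<bullet> (D *v y))" shows "transpose D = - (D :: real^'n^'n)"
proof -
  have "D $ j $ i = - D $ i $ j" for i j
    using assms[of "axis i 1" "axis j 1"]
    by (simp only: matrix_vector_mult_basis inner_axis inner_axis' column_def vec_lambda_beta
        inner_real_def mult_1_left mult_1_right)
  then show ?thesis unfolding vec_eq_iff transpose_def vec_lambda_beta vector_uminus_component by blast
qed

text \<open>The component of a derivation orthogonal to the inner ones (for the trace form) commutes
  with them, by invariance of the trace form, and hence takes values in the centre.\<close>

lemma derivation_inner:
  assumes "D \<in> derivations" shows "D \<in> range ad"
proof -
  have span: "span (range ad) = range ad"
    by (rule span_eq_iff[THEN iffD2], rule linear_subspace_image[OF ad_linear subspace_UNIV])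
  obtain y E where "y \<in> span (range ad)" and E: "\<And>w. w \<in> span (range ad) \<Longrightarrow> orthogonal E w" and D: "D = y + E"
    using orthogonal_subspace_decomp_exists[of "range ad" D] by metis
  then obtain z where y: "y = ad z" unfolding span by blast
  have E': "E = D - ad z" using D y by simp
  have der: "E *v br a b = br (E *v a) b + br a (E *v b)" for a b
    using assms ad_derivation[of z] unfolding derivations_def E'
    by (simp add: matrix_vector_mult_diff_rdistrib bilinear_lsub[OF bilinear_br] bilinear_rsub[OF bilinear_br])
  have com: "ad (E *v x) = commutator E (ad x)" for x
    by (simp add: matrix_eq commutator_def matrix_vector_simps der)
  have tr: "transpose (ad x) = - ad x" for x
    by (rule transpose_skew) (simp add: ad_skew)
  have "E *v x = 0" for x
  proof -
    have "ad (E *v x) \<bullet> ad w = E \<bullet> ad (br x w)" for w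
      unfolding com by (subst commutator_inner[OF tr]) (simp add: ad_br)
    also have "E \<bullet> ad (br x w) = 0" for w using E[unfolded span orthogonal_def] by blast
    finally have "ad (E *v x) \<bullet> ad (E *v x) = 0" .
    then have "ad (E *v x) = ad 0" by (simp add: linear_0[OF ad_linear])
    then show ?thesis using ad_inj by (simp add: inj_eq)
  qed
  then have "E = 0" by (simp add: matrix_eq)
  then show ?thesis using D y by simp
qed

definition automorphisms :: "(real^'n^'n) set" where
  "automorphisms = {g. (\<forall>x y. g *v br x y = br (g *v x) (g *v y)) \<and> (\<forall>x y. (g *v x) \<bullet> (g *v y) = x \<bullet> y)}"

text \<open>For fixed \<open>x\<close> and \<open>y\<close> the failure of the exponential to
  respect the bracket solves the equation of \<open>skew_flow_zero\<close>, because \<open>D\<close>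
  is a derivation, and it is 0 at time 0. Inner products are constant in time because
  \<open>D\<close> is skew.\<close>

lemma mexp_automorphism:
  assumes "D \<in> derivations" shows "mexp D t \<in> automorphisms"
proof -
  have D: "D *v br x y = br (D *v x) y + br x (D *v y)" "(D *v x) \<bullet> y = - (x \<bullet> (D *v y))" for x y
    using assms by (auto simp: derivations_def)
  have D0: "(D *v x) \<bullet> x = 0" for x using D(2)[of x x] by (simp add: inner_commute)
  have bb: "bounded_bilinear br" using bilinear_br by (simp add: bilinear_conv_bounded_bilinear)
  let ?E = "mexp D"
  have "?E t *v br x y - br (?E t *v x) (?E t *v y) = 0" for x y
  proof (rule skew_flow_zero[OF D0])
    fix t
    have "((\<lambda>t. br (?E t *v x) (?E t *v y)) has_vector_derivative
        br (?E t *v x) (D *v (?E t *v y)) + br (D *v (?E t *v x)) (?E t *v y)) (at t)"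
      by (rule bounded_bilinear.has_vector_derivative[OF bb mexp_mult_deriv mexp_mult_deriv])
    then have "((\<lambda>t. ?E t *v br x y - br (?E t *v x) (?E t *v y)) has_vector_derivative
       D *v (?E t *v br x y) - (br (?E t *v x) (D *v (?E t *v y)) + br (D *v (?E t *v x)) (?E t *v y))) (at t)"
      by (rule has_vector_derivative_diff[OF mexp_mult_deriv])
    then show "((\<lambda>t. ?E t *v br x y - br (?E t *v x) (?E t *v y)) has_vector_derivative
       D *v (?E t *v br x y - br (?E t *v x) (?E t *v y))) (at t)"
      by (simp add: matrix_vector_mult_diff_distrib D(1) add.commute)
  qed simp
  moreover have "(?E t *v x) \<bullet> (?E t *v y) = x \<bullet> y" for x y
  proof -
    have "((\<lambda>t. (?E t *v x) \<bullet> (?E t *v y)) has_real_derivative 0) (at t)" for t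
      using bounded_bilinear.has_vector_derivative[OF bounded_bilinear_inner mexp_mult_deriv[of D x t] mexp_mult_deriv[of D y t]] D(2)
      by (simp add: has_real_derivative_iff_has_vector_derivative)
    then have "(?E t *v x) \<bullet> (?E t *v y) = (?E 0 *v x) \<bullet> (?E 0 *v y)"
      using DERIV_isconst_all[of "\<lambda>t. (?E t *v x) \<bullet> (?E t *v y)"] by blast
    then show ?thesis by simp
  qed
  ultimately show ?thesis by (simp add: automorphisms_def)
qed

lemma automorphisms_mult: "g \<in> automorphisms \<Longrightarrow> h \<in> automorphisms \<Longrightarrow> g ** h \<in> automorphisms"
  by (simp add: automorphisms_def matrix_vector_mul_assoc[symmetric])

lemma automorphisms_one: "mat 1 \<in> automorphisms"
  by (simp add: automorphisms_def)

lemma automorphisms_inverse: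
  assumes "g \<in> automorphisms"
  shows "invertible g" "matrix_inv g \<in> automorphisms"
proof -
  have g: "g *v br x y = br (g *v x) (g *v y)" "(g *v x) \<bullet> (g *v y) = x \<bullet> y" for x y
    using assms by (auto simp: automorphisms_def)
  have "inj ((*v) g)"
    unfolding linear_injective_0[OF matrix_vector_mul_linear] using g(2) by (metis inner_eq_zero_iff)
  then show inv: "invertible g"
    by (simp add: invertible_left_inverse matrix_left_invertible_injective)
  let ?h = "matrix_inv g"
  have gh: "g ** ?h = mat 1" and hg: "?h ** g = mat 1"
    using matrix_inv[OF inv] by auto
  have c: "g *v (?h *v x) = x" "?h *v (g *v x) = x" for x
    by (simp_all add: matrix_vector_mul_assoc gh hg)
  have "?h *v br x y = br (?h *v x) (?h *v y)" for x y
    using g(1)[of "?h *v x" "?h *v y"] by (metis c)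
  moreover have "(?h *v x) \<bullet> (?h *v y) = x \<bullet> y" for x y
    using g(2)[of "?h *v x" "?h *v y"] by (simp add: c)
  ultimately show "matrix_inv g \<in> automorphisms" by (simp add: automorphisms_def)
qed

text \<open>The defining conditions are closed, and the columns of an orthogonal matrix are unit
  vectors, which bounds its entries.\<close>

lemma automorphisms_compact: "compact automorphisms"
proof -
  have bb: "bounded_bilinear br" using bilinear_br by (simp add: bilinear_conv_bounded_bilinear)
  have cont: "continuous_on UNIV (\<lambda>g :: real^'n^'n. g *v x)" for x
    by (rule linear_continuous_on[OF bounded_linear_mult_vec])
  have "automorphisms = (\<Inter>x. \<Inter>y. {g. g *v br x y = br (g *v x) (g *v y)} \<inter> {g. (g *v x) \<bullet> (g *v y) = x \<bullet> y})"
    by (auto simp: automorphisms_def)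
  moreover have "closed {g. g *v br x y = br (g *v x) (g *v y)}" for x y
    by (intro closed_Collect_eq cont bounded_bilinear.continuous_on[OF bb])
  moreover have "closed {g :: real^'n^'n. (g *v x) \<bullet> (g *v y) = x \<bullet> y}" for x y
    by (intro closed_Collect_eq cont continuous_on_inner continuous_on_const)
  ultimately have "closed automorphisms" by (auto intro!: closed_INT closed_Int)
  moreover have "bounded automorphisms"
  proof (rule boundedI)
    fix g assume "g \<in> automorphisms"
    then have g: "(g *v x) \<bullet> (g *v y) = x \<bullet> y" for x y by (auto simp: automorphisms_def)
    have "\<bar>g $ i $ j\<bar> \<le> 1" for i j
    proof -
      have "norm (g *v axis j 1) = 1"
        using g[of "axis j 1" "axis j 1"] by (simp add: norm_eq_sqrt_inner inner_axis)
      then show ?thesis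
        using component_le_norm_cart[of "g *v axis j 1" i] by (simp add: matrix_vector_mult_basis column_def)
    qed
    then have "norm (g $ i) \<le> (\<Sum>j\<in>(UNIV :: 'n set). 1)" for i
      using norm_le_l1_cart[of "g $ i"] by (meson order_trans sum_mono)
    then have "norm g \<le> (\<Sum>i\<in>(UNIV :: 'n set). \<Sum>j\<in>(UNIV :: 'n set). 1)"
      using L2_set_le_sum[of UNIV "\<lambda>i. norm (g $ i)"] norm_vec_def[of g]
      by (metis (no_types, lifting) norm_ge_zero order_trans sum_mono)
    then show "norm g \<le> (\<Sum>i\<in>(UNIV :: 'n set). \<Sum>j\<in>(UNIV :: 'n set). 1)" .
  qed
  ultimately show ?thesis by (simp add: compact_eq_bounded_closed)
qed

text \<open>Passing to the identity component gives connectedness and preserves compactness. No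
  tangent vector is lost, because the exponential curves start at the identity and stay in the
  component.\<close>

definition adjoint_group :: "(real^'n^'n) set" where
  "adjoint_group = connected_component_set automorphisms (mat 1)"

lemma adjoint_group_subset: "adjoint_group \<subseteq> automorphisms"
  unfolding adjoint_group_def by (rule connected_component_subset)

lemma continuous_left_mult: "continuous_on S (\<lambda>h :: real^'n^'n. g ** h)"
proof -
  have "linear (\<lambda>h :: real^'n^'n. g ** h)"
    by (rule linearI) (simp_all add: matrix_mul_simps)
  then show ?thesis by (simp add: linear_continuous_on linear_conv_bounded_linear)
qed

lemma left_translate:
  assumes g: "g \<in> automorphisms" and h: "connected_component automorphisms h k"
  shows "connected_component automorphisms (g ** h) (g ** k)"
proof -
  obtain T where T: "connected T" "T \<subseteq> automorphisms" "h \<in> T" "k \<in> T"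
    using h unfolding connected_component_def by blast
  show ?thesis
  proof (rule connected_componentI)
    show "connected ((**) g ` T)" by (rule connected_continuous_image[OF continuous_left_mult T(1)])
    show "(**) g ` T \<subseteq> automorphisms" using T(2) automorphisms_mult[OF g] by blast
  qed (use T in auto)
qed

lemma adjoint_group_compact_linear: "compact_linear_group adjoint_group"
  unfolding compact_linear_group_def
proof (intro conjI ballI)
  show "mat 1 \<in> adjoint_group"
    by (simp add: adjoint_group_def automorphisms_one)
  fix g assume g: "g \<in> adjoint_group"
  then have ga: "g \<in> automorphisms" using adjoint_group_subset by blast
  have 1: "connected_component automorphisms (mat 1) g" using g by (simp add: adjoint_group_def)
  show "invertible g" by (rule automorphisms_inverse[OF ga])
  have "connected_component automorphisms (matrix_inv g ** mat 1) (matrix_inv g ** g)"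
    by (rule left_translate[OF automorphisms_inverse(2)[OF ga] 1])
  then show "matrix_inv g \<in> adjoint_group"
    using matrix_inv[OF automorphisms_inverse(1)[OF ga]]
    by (simp add: adjoint_group_def connected_component_sym)
  fix h assume "h \<in> adjoint_group"
  then have "connected_component automorphisms (g ** mat 1) (g ** h)"
    by (intro left_translate[OF ga]) (simp add: adjoint_group_def)
  then show "g ** h \<in> adjoint_group"
    using 1 connected_component_trans by (auto simp: adjoint_group_def)
next
  have "closed adjoint_group" unfolding adjoint_group_def
    by (rule closed_connected_component[OF compact_imp_closed[OF automorphisms_compact]])
  then have "compact (automorphisms \<inter> adjoint_group)"
    by (rule compact_Int_closed[OF automorphisms_compact])
  moreover have "automorphisms \<inter> adjoint_group = adjoint_group" using adjoint_group_subset by blast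
  ultimately show "compact adjoint_group" by simp
qed

lemma adjoint_group_connected: "connected adjoint_group"
  unfolding adjoint_group_def by (rule connected_connected_component)

text \<open>The curves \<open>mexp D\<close> for inner \<open>D\<close> give one inclusion. For the
  other, the two conditions on automorphisms are differentiated at the identity; the result is a
  skew derivation, hence inner.\<close>

lemma adjoint_group_lie_algebra: "lie_algebra_of adjoint_group = range ad"
proof
  show "range ad \<subseteq> lie_algebra_of adjoint_group"
  proof
    fix D assume "D \<in> range ad"
    then have D: "D \<in> derivations" using ad_derivation by blast
    have "mexp D differentiable (at s)" for s
      using mexp_deriv[of D s] by (rule differentiableI_vector)
    moreover have "mexp D s \<in> adjoint_group" for s
    proof -
      have "continuous_on UNIV (mexp D)"
        using mexp_deriv has_vector_derivative_continuous by (blast intro: continuous_at_imp_continuous_on)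
      then have "connected (range (mexp D))" by (rule connected_continuous_image) simp
      moreover have "range (mexp D) \<subseteq> automorphisms" using mexp_automorphism[OF D] by blast
      moreover have "mat 1 \<in> range (mexp D)" by (metis mexp_0 rangeI)
      ultimately show ?thesis unfolding adjoint_group_def mem_Collect_eq
        by (intro connected_componentI) auto
    qed
    moreover have "(mexp D has_vector_derivative D) (at 0)"
      using mexp_deriv[of D 0] by simp
    ultimately show "D \<in> lie_algebra_of adjoint_group"
      unfolding lie_algebra_of_def by (auto intro!: exI[of _ "mexp D"])
  qed
  show "lie_algebra_of adjoint_group \<subseteq> range ad"
  proof
    fix X assume "X \<in> lie_algebra_of adjoint_group"
    then obtain \<gamma> where G: "\<And>s. \<gamma> s \<in> adjoint_group" "\<gamma> 0 = mat 1" and d: "(\<gamma> has_vector_derivative X) (at 0)"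
      unfolding lie_algebra_of_def by blast
    have a: "\<gamma> s *v br x y = br (\<gamma> s *v x) (\<gamma> s *v y)" "(\<gamma> s *v x) \<bullet> (\<gamma> s *v y) = x \<bullet> y" for s x y
      using G(1)[of s] adjoint_group_subset by (auto simp: automorphisms_def)
    have bb: "bounded_bilinear br" using bilinear_br by (simp add: bilinear_conv_bounded_bilinear)
    have dv: "((\<lambda>s. \<gamma> s *v x) has_vector_derivative X *v x) (at 0)" for x
      by (rule bounded_linear.has_vector_derivative[OF bounded_linear_mult_vec d])
    have "X *v br x y = br (X *v x) y + br x (X *v y)" for x y
    proof (rule vector_derivative_unique_at[OF dv])
      show "((\<lambda>s. \<gamma> s *v br x y) has_vector_derivative br (X *v x) y + br x (X *v y)) (at 0)"
        using bounded_bilinear.has_vector_derivative[OF bb dv[of x] dv[of y]]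
        by (simp add: a(1) G(2) add.commute)
    qed
    moreover have "(X *v x) \<bullet> y = - (x \<bullet> (X *v y))" for x y
    proof -
      have "((\<lambda>s. (\<gamma> s *v x) \<bullet> (\<gamma> s *v y)) has_vector_derivative x \<bullet> (X *v y) + (X *v x) \<bullet> y) (at 0)"
        using bounded_bilinear.has_vector_derivative[OF bounded_bilinear_inner dv[of x] dv[of y]] by (simp add: G(2))
      then have "((\<lambda>s::real. x \<bullet> y) has_vector_derivative x \<bullet> (X *v y) + (X *v x) \<bullet> y) (at 0)"
        by (simp only: a(2))
      then have "x \<bullet> (X *v y) + (X *v x) \<bullet> y = 0"
        by (rule vector_derivative_unique_at) (rule has_vector_derivative_const)
      then show ?thesis by simp
    qed
    ultimately have "X \<in> derivations" by (simp add: derivations_def)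
    then show "X \<in> range ad" by (rule derivation_inner)
  qed
qed

end


section \<open>Transport along isomorphisms\<close>

text \<open>The Lie algebra axioms are assumed for \<open>V\<close>; those of the image are
  conclusions, together with simplicity and the root system.\<close>

locale lie_isomorphism =
  fixes V :: "'a::real_vector set" and f :: "'a \<Rightarrow> 'a \<Rightarrow> 'a"
    and W :: "'b::real_vector set" and g :: "'b \<Rightarrow> 'b \<Rightarrow> 'b" and \<Phi> :: "'a \<Rightarrow> 'b"
  assumes lie_V: "real_lie_algebra V f"
    and linear: "linear_map_on V \<Phi>" and bij: "bij_betw \<Phi> V W"
    and hom: "\<And>x y. x \<in> V \<Longrightarrow> y \<in> V \<Longrightarrow> \<Phi> (f x y) = g (\<Phi> x) (\<Phi> y)"
begin

lemma V: "subspace V" "\<And>x y. x \<in> V \<Longrightarrow> y \<in> V \<Longrightarrow> f x y \<in> V"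
  using lie_V by (auto simp: real_lie_algebra_def)

lemma add: "x \<in> V \<Longrightarrow> y \<in> V \<Longrightarrow> \<Phi> (x + y) = \<Phi> x + \<Phi> y"
  and scale: "x \<in> V \<Longrightarrow> \<Phi> (c *\<^sub>R x) = c *\<^sub>R \<Phi> x"
  using linear by (auto simp: linear_map_on_def)

lemma zero: "\<Phi> 0 = 0"
  using scale[OF subspace_0[OF V(1)], of 0] by simp

lemma neg: "x \<in> V \<Longrightarrow> \<Phi> (- x) = - \<Phi> x"
  using scale[of x "-1"] by simp

lemma diff: "x \<in> V \<Longrightarrow> y \<in> V \<Longrightarrow> \<Phi> (x - y) = \<Phi> x - \<Phi> y"
  using add[of x "- y"] neg[of y] subspace_neg[OF V(1)] by simp

lemma eq_iff: "x \<in> V \<Longrightarrow> y \<in> V \<Longrightarrow> \<Phi> x = \<Phi> y \<longleftrightarrow> x = y"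
  using bij by (meson bij_betw_imp_inj_on inj_onD)

lemma eq_0_iff: "x \<in> V \<Longrightarrow> \<Phi> x = 0 \<longleftrightarrow> x = 0"
  using eq_iff[OF _ subspace_0[OF V(1)]] zero by simp

lemma W: "W = \<Phi> ` V"
  using bij by (simp add: bij_betw_def)

lemma subspace_image:
  assumes "subspace U" "U \<subseteq> V" shows "subspace (\<Phi> ` U)"
  unfolding subspace_def
proof (intro conjI ballI allI)
  show "0 \<in> \<Phi> ` U" using imageI[OF subspace_0[OF assms(1)], of \<Phi>] by (simp add: zero)
  show "x + y \<in> \<Phi> ` U" if xy: "x \<in> \<Phi> ` U" "y \<in> \<Phi> ` U" for x y
  proof -
    obtain a b where ab: "a \<in> U" "b \<in> U" "x = \<Phi> a" "y = \<Phi> b" using xy by blast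
    then have "x + y = \<Phi> (a + b)" using add assms(2) by (simp add: subset_iff)
    then show ?thesis using ab subspace_add[OF assms(1)] by blast
  qed
  show "c *\<^sub>R x \<in> \<Phi> ` U" if x: "x \<in> \<Phi> ` U" for c x
  proof -
    obtain a where a: "a \<in> U" "x = \<Phi> a" using x by blast
    then have "c *\<^sub>R x = \<Phi> (c *\<^sub>R a)" using scale assms(2) by (simp add: subset_iff)
    then show ?thesis using a subspace_scale[OF assms(1)] by blast
  qed
qed

lemma real_lie_algebra_image: "real_lie_algebra W g"
proof -
  note cl = V(2) subspace_add[OF V(1)] subspace_scale[OF V(1)] add scale neg hom zero
  have f: "f (x + y) z = f x z + f y z" "f z (x + y) = f z x + f z y"
    "f (f x y) z + f (f y z) x + f (f z x) y = 0" if "x \<in> V" "y \<in> V" "z \<in> V" for x y z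
    using lie_V that unfolding real_lie_algebra_def bilinear_on_def jacobi_on_def by blast+
  have f': "f (c *\<^sub>R x) y = c *\<^sub>R f x y" "f x (c *\<^sub>R y) = c *\<^sub>R f x y" "f x y = - f y x"
    if "x \<in> V" "y \<in> V" for x y c
    using lie_V that unfolding real_lie_algebra_def bilinear_on_def skew_symmetric_on_def by blast+
  have g: "g (\<Phi> x + \<Phi> y) (\<Phi> z) = g (\<Phi> x) (\<Phi> z) + g (\<Phi> y) (\<Phi> z)"
    "g (\<Phi> z) (\<Phi> x + \<Phi> y) = g (\<Phi> z) (\<Phi> x) + g (\<Phi> z) (\<Phi> y)"
    "g (g (\<Phi> x) (\<Phi> y)) (\<Phi> z) + g (g (\<Phi> y) (\<Phi> z)) (\<Phi> x) + g (g (\<Phi> z) (\<Phi> x)) (\<Phi> y) = 0"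
    if "x \<in> V" "y \<in> V" "z \<in> V" for x y z
    using f[OF that, THEN arg_cong[of _ _ \<Phi>]] that by (simp_all add: cl)
  have g': "g (c *\<^sub>R \<Phi> x) (\<Phi> y) = c *\<^sub>R g (\<Phi> x) (\<Phi> y)"
    "g (\<Phi> x) (c *\<^sub>R \<Phi> y) = c *\<^sub>R g (\<Phi> x) (\<Phi> y)" "g (\<Phi> x) (\<Phi> y) = - g (\<Phi> y) (\<Phi> x)"
    if "x \<in> V" "y \<in> V" for x y c
    using f'[OF that, THEN arg_cong[of _ _ \<Phi>]] that by (simp_all add: cl)
  have "bilinear_on W g" unfolding bilinear_on_def W using g(1,2) g'(1,2) by blast
  moreover have "skew_symmetric_on W g" unfolding skew_symmetric_on_def W using g'(3) by blast
  moreover have "jacobi_on W g" unfolding jacobi_on_def W using g(3) by blast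
  moreover have "\<forall>x\<in>W. \<forall>y\<in>W. g x y \<in> W"
    unfolding W by (auto simp: hom[symmetric] V(2))
  ultimately show ?thesis
    using subspace_image[OF V(1)] by (simp add: real_lie_algebra_def W)
qed

lemma simple_image:
  assumes "simple_lie_algebra V f" shows "simple_lie_algebra W g"
  unfolding simple_lie_algebra_def
proof (intro conjI allI impI real_lie_algebra_image)
  obtain x y where "x \<in> V" "y \<in> V" "f x y \<noteq> 0" using assms by (auto simp: simple_lie_algebra_def)
  then have "\<Phi> x \<in> W" "\<Phi> y \<in> W" "g (\<Phi> x) (\<Phi> y) \<noteq> 0"
    by (simp_all add: W hom[symmetric] eq_0_iff V(2))
  then show "\<exists>x\<in>W. \<exists>y\<in>W. g x y \<noteq> 0" by blast
  fix I assume I: "lie_ideal W g I"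
  let ?J = "{x \<in> V. \<Phi> x \<in> I}"
  have IJ: "I = \<Phi> ` ?J" using I unfolding lie_ideal_def W by blast
  have "lie_ideal V f ?J"
    using I V hom unfolding lie_ideal_def W
    by (auto simp: subspace_def zero add scale)
  then have "?J = {0} \<or> ?J = V" using assms by (simp add: simple_lie_algebra_def)
  then show "I = {0} \<or> I = W"
  proof
    assume "?J = {0}"
    then have "I = \<Phi> ` {0}" using IJ by simp
    then show ?thesis by (simp add: zero)
  next
    assume "?J = V"
    then show ?thesis using IJ W by simp
  qed
qed

lemma root_system_image:
  assumes "has_root_system_E8 V f" shows "has_root_system_E8 W g"
proof -
  obtain T \<phi> where T: "maximal_abelian V f T" and \<phi>: "linear_map_on T \<phi>" "bij_betw \<phi> T UNIV"
    and root: "\<And>\<alpha>. lie_root V f T \<alpha> \<longleftrightarrow> (\<exists>r\<in>E8_roots. \<forall>h\<in>T. \<alpha> h = \<i> * complex_of_real (r \<bullet> \<phi> h))"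
    using assms unfolding has_root_system_E8_def by blast
  have TV: "T \<subseteq> V" and sT: "subspace T" using T by (auto simp: maximal_abelian_def)
  let ?\<psi> = "inv_into V \<Phi>"
  have inv: "?\<psi> (\<Phi> x) = x" if "x \<in> V" for x
    using bij that by (simp add: bij_betw_inv_into_left)
  have "maximal_abelian W g (\<Phi> ` T)"
  proof -
    have "subspace (\<Phi> ` T)" "\<Phi> ` T \<subseteq> W" using subspace_image[OF sT TV] TV W by auto
    moreover have "g h k = 0" if "h \<in> \<Phi> ` T" "k \<in> \<Phi> ` T" for h k
      using that T TV zero by (auto simp: maximal_abelian_def subset_iff hom[symmetric])
    moreover have "x \<in> \<Phi> ` T" if x: "x \<in> W" "\<forall>h\<in>\<Phi> ` T. g h x = 0" for x
    proof -
      obtain a where a: "a \<in> V" "x = \<Phi> a" using x(1) W by blast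
      have "f h a = 0" if "h \<in> T" for h
      proof -
        have "\<Phi> (f h a) = 0" using x(2) that a TV by (simp add: hom subset_iff)
        then show ?thesis using eq_0_iff V(2) a(1) that TV by blast
      qed
      then have "a \<in> T" using T a(1) by (auto simp: maximal_abelian_def)
      then show ?thesis using a(2) by blast
    qed
    ultimately show ?thesis by (auto simp: maximal_abelian_def)
  qed
  moreover have "linear_map_on (\<Phi> ` T) (\<phi> \<circ> ?\<psi>)"
    unfolding linear_map_on_def
  proof (intro conjI ballI allI)
    fix x y c assume "x \<in> \<Phi> ` T"
    then obtain a where a: "a \<in> T" "a \<in> V" "x = \<Phi> a" using TV by blast
    have "(\<phi> \<circ> ?\<psi>) (c *\<^sub>R x) = \<phi> (?\<psi> (\<Phi> (c *\<^sub>R a)))" using a by (simp add: scale)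
    also have "\<dots> = \<phi> (c *\<^sub>R a)" using inv subspace_scale[OF V(1) a(2)] by simp
    finally show "(\<phi> \<circ> ?\<psi>) (c *\<^sub>R x) = c *\<^sub>R (\<phi> \<circ> ?\<psi>) x"
      using \<phi>(1) a inv by (simp add: linear_map_on_def)
    assume "y \<in> \<Phi> ` T"
    then obtain b where b: "b \<in> T" "b \<in> V" "y = \<Phi> b" using TV by blast
    have "(\<phi> \<circ> ?\<psi>) (x + y) = \<phi> (?\<psi> (\<Phi> (a + b)))" using a b by (simp add: add)
    also have "\<dots> = \<phi> (a + b)" using inv subspace_add[OF V(1) a(2) b(2)] by simp
    finally show "(\<phi> \<circ> ?\<psi>) (x + y) = (\<phi> \<circ> ?\<psi>) x + (\<phi> \<circ> ?\<psi>) y"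
      using \<phi>(1) a b inv by (simp add: linear_map_on_def)
  qed
  moreover have "bij_betw (\<phi> \<circ> ?\<psi>) (\<Phi> ` T) UNIV"
  proof (rule bij_betw_trans[OF _ \<phi>(2)])
    show "bij_betw ?\<psi> (\<Phi> ` T) T"
      by (rule bij_betw_byWitness[where f' = \<Phi>]) (use inv TV in \<open>auto simp: subset_iff\<close>)
  qed
  moreover have "lie_root W g (\<Phi> ` T) \<alpha> \<longleftrightarrow>
      (\<exists>r\<in>E8_roots. \<forall>h\<in>\<Phi> ` T. \<alpha> h = \<i> * complex_of_real (r \<bullet> (\<phi> \<circ> ?\<psi>) h))" for \<alpha>
  proof -
    have e: "g (\<Phi> h) (\<Phi> x) = a *\<^sub>R \<Phi> x - b *\<^sub>R \<Phi> y \<longleftrightarrow> f h x = a *\<^sub>R x - b *\<^sub>R y"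
      "g (\<Phi> h) (\<Phi> y) = b *\<^sub>R \<Phi> x + a *\<^sub>R \<Phi> y \<longleftrightarrow> f h y = b *\<^sub>R x + a *\<^sub>R y"
      if "h \<in> T" "x \<in> V" "y \<in> V" for h x y a b
    proof -
      have h: "h \<in> V" using that TV by blast
      have "a *\<^sub>R \<Phi> x - b *\<^sub>R \<Phi> y = \<Phi> (a *\<^sub>R x - b *\<^sub>R y)" "b *\<^sub>R \<Phi> x + a *\<^sub>R \<Phi> y = \<Phi> (b *\<^sub>R x + a *\<^sub>R y)"
        using that subspace_scale[OF V(1)] by (simp_all add: diff add scale)
      then show "g (\<Phi> h) (\<Phi> x) = a *\<^sub>R \<Phi> x - b *\<^sub>R \<Phi> y \<longleftrightarrow> f h x = a *\<^sub>R x - b *\<^sub>R y"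
        "g (\<Phi> h) (\<Phi> y) = b *\<^sub>R \<Phi> x + a *\<^sub>R \<Phi> y \<longleftrightarrow> f h y = b *\<^sub>R x + a *\<^sub>R y"
        using that h V subspace_scale[OF V(1)] subspace_add[OF V(1)] subspace_diff[OF V(1)]
        by (simp_all add: hom[symmetric] eq_iff)
    qed
    have "lie_root W g (\<Phi> ` T) \<alpha> \<longleftrightarrow> lie_root V f T (\<alpha> \<circ> \<Phi>)"
      unfolding lie_root_def W by (simp add: e eq_0_iff cong: conj_cong bex_cong ball_cong)
    also have "\<dots> \<longleftrightarrow> (\<exists>r\<in>E8_roots. \<forall>h\<in>\<Phi> ` T. \<alpha> h = \<i> * complex_of_real (r \<bullet> (\<phi> \<circ> ?\<psi>) h))"
      unfolding root using inv TV by (simp add: subset_iff)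
    finally show ?thesis .
  qed
  ultimately show ?thesis unfolding has_root_system_E8_def by blast
qed

end


section \<open>The compact form of \<open>E\<^sub>8\<close>\<close>

text \<open>The wedges of units with \<open>i < j\<close> are pairwise orthogonal of squared length
  2, and there are (64 - 8) / 2 of them.\<close>

lemma dim_so8: "dim so8 = 28"
proof -
  let ?L = "{p :: 8 \<times> 8. fst p < snd p}"
  let ?w = "\<lambda>(i, j). wedge (oct_unit i) (oct_unit j)"
  have inner: "wedge (oct_unit i) (oct_unit j) \<bullet> wedge (oct_unit k) (oct_unit l) =
      2 * ((if i = k \<and> j = l then 1 else 0) - (if i = l \<and> j = k then 1 else 0))" for i j k l
  proof -
    have "oct_unit i \<bullet> oct_unit (j :: 8) = (if i = j then 1 else 0)" for i j
      by (simp add: inner_axis_axis)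
    then have "wedge (oct_unit i) (oct_unit j) \<bullet> wedge (oct_unit k) (oct_unit l) =
      2 * ((if j = l then 1 else 0) * (if k = i then 1 else 0) - (if i = l then 1 else 0) * (if k = j then 1 else 0))"
      by (simp only: inner_wedge[OF wedge_so8] wedge_mult inner_diff_right inner_scaleR_right)
    then show ?thesis
      unfolding eq_commute[of k i] eq_commute[of k j]
      by (cases "i = k"; cases "j = l"; cases "i = l"; cases "j = k")
        (simp_all only: simp_thms if_True if_False mult_1_left mult_zero_left mult_1_right mult_zero_right)
  qed
  have orth: "?w p \<bullet> ?w q = (if p = q then 2 else 0)" if pq: "p \<in> ?L" "q \<in> ?L" for p q
  proof -
    obtain i j k l where e: "p = (i, j)" "q = (k, l)" and lt: "i < j" "k < l"
      using pq by (cases p; cases q) auto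
    have "(i = l \<and> j = k) = False" using lt by (metis less_asym)
    then show ?thesis
      unfolding e prod.case inner prod.inject
      by (cases "i = k \<and> j = l") (simp_all only: simp_thms if_True if_False diff_0_right mult_1_right mult_zero_right)
  qed
  have inj: "inj_on ?w ?L"
  proof (rule inj_onI)
    fix p q assume pq: "p \<in> ?L" "q \<in> ?L" "?w p = ?w q"
    then show "p = q" using orth[OF pq(1,2)] orth[OF pq(1,1)] by (metis zero_neq_numeral)
  qed
  have "pairwise orthogonal (?w ` ?L)"
    unfolding pairwise_def orthogonal_def using orth by force
  moreover have "0 \<notin> ?w ` ?L"
  proof
    assume "0 \<in> ?w ` ?L"
    then obtain p where "p \<in> ?L" "?w p = 0" by force
    then show False using orth[of p p] by simp
  qed
  ultimately have ind: "independent (?w ` ?L)" by (rule pairwise_orthogonal_independent)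
  have w: "wedge (oct_unit i) (oct_unit j) \<in> span (?w ` ?L)" for i j
  proof (cases i j rule: linorder_cases)
    case less
    then show ?thesis by (intro span_base) (auto intro!: image_eqI[of _ _ "(i, j)"])
  next
    case equal
    then show ?thesis by (simp add: wedge_def span_zero)
  next
    case greater
    have "wedge (oct_unit i) (oct_unit j) = - ?w (j, i)" by (simp add: wedge_def)
    also have "\<dots> \<in> span (?w ` ?L)" using greater by (intro span_neg span_base) (auto intro!: image_eqI[of _ _ "(j, i)"])
    finally show ?thesis .
  qed
  have "wedge a b \<in> span (?w ` ?L)" for a b
  proof -
    have l: "linear (\<lambda>a. wedge a b)" "linear (wedge a)" for a b
      using bilinear_wedge by (simp_all add: bilinear_def)
    have "wedge a b = (\<Sum>i\<in>UNIV. a $ i *\<^sub>R wedge (oct_unit i) b)"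
      by (subst oct_expand[of a]) (simp add: linear_sum[OF l(1)] linear_scale[OF l(1)])
    also have "\<dots> = (\<Sum>i\<in>UNIV. a $ i *\<^sub>R (\<Sum>j\<in>UNIV. b $ j *\<^sub>R wedge (oct_unit i) (oct_unit j)))"
      by (subst oct_expand[of b]) (simp add: linear_sum[OF l(2)] linear_scale[OF l(2)])
    also have "\<dots> \<in> span (?w ` ?L)" by (intro span_sum span_scale w)
    finally show ?thesis .
  qed
  then have "so8 \<subseteq> span (?w ` ?L)"
    unfolding so8_span by (intro span_minimal subspace_span) auto
  moreover have "?w ` ?L \<subseteq> so8" by (auto simp: wedge_so8)
  moreover have "card ?L = 28"
  proof -
    have "(UNIV :: (8 \<times> 8) set) = ?L \<union> prod.swap ` ?L \<union> (\<lambda>i. (i, i)) ` UNIV"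
      by (auto simp: image_iff)
    then have "card (UNIV :: (8 \<times> 8) set) = card (?L \<union> prod.swap ` ?L) + card ((\<lambda>i::8. (i, i)) ` UNIV)"
      by (subst card_Un_disjoint[symmetric]) auto
    also have "card (?L \<union> prod.swap ` ?L) = card ?L + card (prod.swap ` ?L)"
      by (rule card_Un_disjoint) auto
    also have "card (prod.swap ` ?L) = card ?L" by (rule card_image) (auto intro: inj_onI)
    also have "card ((\<lambda>i::8. (i, i)) ` UNIV) = 8" by (subst card_image) (auto intro: inj_onI)
    finally show ?thesis by (simp add: card_cartesian_product flip: UNIV_Times_UNIV)
  qed
  ultimately show ?thesis
    using dim_unique[of "?w ` ?L" so8 28] ind by (simp add: card_image[OF inj])
qed

text \<open>The count is 28 + 28 + 3 * 64; it allows the algebra to be modelled on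
  \<open>real^248\<close>.\<close>

lemma dim_space_A: "dim space_A = 248"
  unfolding space_A_def
  by (simp add: dim_Times subspace_Times subspace_so8 dim_so8)

text \<open>The centre is an ideal, and it is proper because the bracket is not identically
  zero.\<close>

lemma centre_A:
  assumes "X \<in> space_A" "\<And>Y. Y \<in> space_A \<Longrightarrow> bracket_A X Y = 0" shows "X = 0"
proof -
  let ?Z = "{X \<in> space_A. \<forall>Y\<in>space_A. bracket_A X Y = 0}"
  have "subspace ?Z"
    using subspace_space_A
    by (auto simp: subspace_def linear_add[OF bracket_A_linear(2)] linear_scale[OF bracket_A_linear(2)]
      linear_0[OF bracket_A_linear(2)])
  moreover have "bracket_A X Y = 0" if "X \<in> space_A" "Y \<in> ?Z" for X Y
    using that by (subst bracket_A_skew) simp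
  moreover have "0 \<in> ?Z" using \<open>subspace ?Z\<close> by (rule subspace_0)
  ultimately have "lie_ideal space_A bracket_A ?Z"
    unfolding lie_ideal_def by simp
  then have "?Z = {0} \<or> ?Z = space_A" using simple_lie_algebra_A by (simp add: simple_lie_algebra_def)
  moreover have "?Z \<noteq> space_A" using simple_lie_algebra_A by (auto simp: simple_lie_algebra_def)
  ultimately show ?thesis using assms by blast
qed

text \<open>For \<open>c = sqrt 8\<close> this turns \<open>form_A\<close> into the standard inner
  product of the product type.\<close>

definition rescale_A :: "real \<Rightarrow> alg_A \<Rightarrow> alg_A" where
  "rescale_A c X = (c *\<^sub>R fst X, snd X)"

lemma rescale_A_linear: "linear (rescale_A c)"
  by (rule linearI) (simp_all add: rescale_A_def algebra_simps)

lemma rescale_A_space: "X \<in> space_A \<Longrightarrow> rescale_A c X \<in> space_A"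
  by (cases X) (auto simp: rescale_A_def space_A_def subspace_scale[OF subspace_so8])

lemma form_A_rescale: "form_A (rescale_A (sqrt 8) X) (rescale_A (sqrt 8) Y) = X \<bullet> Y"
proof -
  have "X \<bullet> Y = fst X \<bullet> fst Y + snd X \<bullet> snd Y" by (rule inner_prod_def)
  moreover have "(sqrt 8 *\<^sub>R fst X) \<bullet> (sqrt 8 *\<^sub>R fst Y) = 8 * (fst X \<bullet> fst Y)"
    unfolding inner_scaleR_left inner_scaleR_right mult.assoc[symmetric] by simp
  ultimately show ?thesis by (simp only: form_A_def rescale_A_def fst_conv snd_conv)
qed

theorem theorem4p1:
  shows "real_lie_algebra space_A bracket_A \<and>
    (\<exists>G :: (real^248^248) set.
       compact_simple_Lie_group_E8 G \<and>
       lie_isomorphic space_A bracket_A (lie_algebra_of G) commutator)"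
proof (intro conjI real_lie_algebra_A)
  have "dim (UNIV :: (real^248) set) = dim space_A" by (simp add: dim_space_A)
  then obtain h k where hk: "linear h" "linear k" "h ` (UNIV :: (real^248) set) = space_A"
    "\<And>x. norm (h x) = norm x" "\<And>x. k (h x) = x" "\<And>X. X \<in> space_A \<Longrightarrow> h (k X) = X"
    using isometries_subspaces[OF subspace_UNIV subspace_space_A] by (metis UNIV_I)
  have h_inner: "h x \<bullet> h y = x \<bullet> y" for x y
    using hk(4)[of "x + y"] hk(4)[of x] hk(4)[of y] by (simp add: linear_add[OF hk(1)] dot_norm)
  \<comment> \<open>\<open>p\<close> is an isometry of \<open>real^248\<close> onto the algebra with
    \<open>form_A\<close>, and \<open>q\<close> inverts it. The bracket pulled back along
    \<open>p\<close> is then invariant for the standard inner product.\<close>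
  define p where "p x = rescale_A (sqrt 8) (h x)" for x
  define q where "q X = k (rescale_A (1 / sqrt 8) X)" for X
  have p: "linear p" and q: "linear q"
    using linear_compose[OF hk(1) rescale_A_linear] linear_compose[OF rescale_A_linear hk(2)]
    by (simp_all add: p_def[abs_def] q_def[abs_def] o_def)
  have r: "rescale_A (1 / sqrt 8) (rescale_A (sqrt 8) X) = X" "rescale_A (sqrt 8) (rescale_A (1 / sqrt 8) X) = X" for X
    by (simp_all add: rescale_A_def)
  have pA: "p x \<in> space_A" for x using hk(3) by (auto simp: p_def intro!: rescale_A_space)
  have qp: "q (p x) = x" for x by (simp add: p_def q_def r hk(5))
  have pq: "p (q X) = X" if "X \<in> space_A" for X
    using that by (simp add: p_def q_def r hk(6) rescale_A_space)
  have form: "form_A (p x) (p y) = x \<bullet> y" for x y by (simp add: p_def form_A_rescale h_inner)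
  define br where "br x y = q (bracket_A (p x) (p y))" for x y
  have pbr: "p (br x y) = bracket_A (p x) (p y)" for x y
    by (simp add: br_def pq bracket_A_space pA)
  interpret invariant_lie br
  proof
    show "bilinear br"
      by (auto intro!: linearI simp: bilinear_def br_def linear_add[OF p] linear_scale[OF p] linear_add[OF q]
        linear_scale[OF q] linear_add[OF bracket_A_linear(1)] linear_add[OF bracket_A_linear(2)]
        linear_scale[OF bracket_A_linear(1)] linear_scale[OF bracket_A_linear(2)])
    fix x y z
    show "br x y = - br y x"
      unfolding br_def by (subst bracket_A_skew) (simp add: linear_neg[OF q])
    show "br (br x y) z + br (br y z) x + br (br z x) y = 0"
      using jacobiator_A[OF pA pA pA, of x y z]
      by (simp add: br_def[of "br _ _"] pbr jacobiator_A_def linear_add[OF q, symmetric] linear_0[OF q])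
    show "br x y \<bullet> z = x \<bullet> br y z"
      by (simp add: form[symmetric] pbr form_A_invariant pA)
    show "x = 0" if c: "\<And>y. br x y = 0"
    proof -
      have "bracket_A (p x) Y = 0" if "Y \<in> space_A" for Y
        using pbr[of x "q Y"] c[of "q Y"] pq[OF that] linear_0[OF p] by simp
      then have "p x = 0" using centre_A[OF pA] by blast
      then show ?thesis using qp[of x] linear_0[OF q] by simp
    qed
  qed
  \<comment> \<open>The isomorphism with the tangent space is the adjoint representation of the
    model on \<open>real^248\<close>.\<close>
  interpret lie_isomorphism space_A bracket_A "range ad" commutator "ad \<circ> q"
  proof
    show "real_lie_algebra space_A bracket_A" by (rule real_lie_algebra_A)
    show "linear_map_on space_A (ad \<circ> q)"
      by (simp add: linear_map_on_def linear_add[OF q] linear_scale[OF q] linear_add[OF ad_linear] linear_scale[OF ad_linear])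
    have "bij_betw q space_A UNIV"
      by (rule bij_betw_byWitness[where f' = p]) (auto simp: pq qp pA)
    moreover have "bij_betw ad UNIV (range ad)" using ad_inj by (rule inj_on_imp_bij_betw)
    ultimately show "bij_betw (ad \<circ> q) space_A (range ad)" by (rule bij_betw_trans)
    show "(ad \<circ> q) (bracket_A X Y) = commutator ((ad \<circ> q) X) ((ad \<circ> q) Y)" if "X \<in> space_A" "Y \<in> space_A" for X Y
      using that by (simp add: ad_br[symmetric] br_def pq)
  qed
  have "compact_simple_Lie_group_E8 adjoint_group"
    unfolding compact_simple_Lie_group_E8_def adjoint_group_lie_algebra
    using adjoint_group_compact_linear adjoint_group_connected simple_image[OF simple_lie_algebra_A]
      root_system_image[OF has_root_system_E8_A] by blast
  moreover have "lie_isomorphic space_A bracket_A (lie_algebra_of adjoint_group) commutator"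
    unfolding lie_isomorphic_def adjoint_group_lie_algebra using linear bij hom by blast
  ultimately show "\<exists>G :: (real^248^248) set. compact_simple_Lie_group_E8 G \<and>
      lie_isomorphic space_A bracket_A (lie_algebra_of G) commutator" by blast
qed

end
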